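(* Let $\mathrm{L}$ and $\mathbf{D}$ be a spline-admissible pair of order $r>d/2$ on $\mathbb{R}^d$, and let $j\in\mathbb{Z}$ be an arbitrary scale. Then the family of functions $\Psi_{j+1}=\{\psi_{j+1}^{(m)}\}_{m=1}^{|\det(\mathbf{D})|-1}$ generates a Riesz basis of $W_{j+1}$ (i.e. the translates $\psi_{j+1}^{(m)}(\cdot-\mathbf{D}^{j+1}\bm{k})$, $1\le m\le|\det(\mathbf{D})|-1$, $\bm{k}\in\mathbb{Z}^d$, form a Riesz basis of $W_{j+1}$) if and only if $$\mathcal{N}_j^{(0)}\cap\mathcal{N}_j^{(m)}=\emptyset\qquad\text{for each }1\le m\le|\det(\mathbf{D})|-1.$$
   Context: Conventions: $\widehat f(\bm{\omega})=\int_{\mathbb{R}^d}f(\bm{x})e^{-i\bm{x}\cdot\bm{\omega}}\,d\bm{x}$, $g^\vee$ is the inverse Fourier transform, $z^*$ denotes the complex conjugate. A Fourier multiplier operator $\mathrm{L}$ with measurable symbol $\widehat L$ acts by $\mathrm{L}f=(\widehat L\,\widehat f)^\vee$; its adjoint $\mathrm{L}^*$ has symbol $\widehat L^*$. $\mathrm{L}$ is admissible if $\widehat L=f/g$ with $f,g$ continuous functions on $\mathbb{R}^d$ such that the set of zeros of $fg$ has Lebesgue measure zero and the zero sets of $f$ and $g$ are disjoint. An operator $\mathrm{L}$ and an integer $d\times d$ matrix $\mathbf{D}$ are a spline-admissible pair of order $r>d/2$ if: (1) $\mathrm{L}$ is an admissible Fourier multiplier operator; (2) $\mathbf{D}=a\mathbf{R}$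 with $\mathbf{R}$ orthogonal and $a>1$; (3) there is $C_{\mathrm{L}}>0$ with $C_{\mathrm{L}}(1+|\widehat L(\bm{\omega})|^2)\ge|\bm{\omega}|^{2r}$ for almost every $\bm{\omega}$; (4) for every $j\in\mathbb{Z}$ there is a periodic function $\widehat L_{\mathrm{d},j}(\bm{\omega})=\sum_{\bm{k}\in\mathbb{Z}^d}p_j[\bm{k}]e^{i\bm{\omega}\cdot\mathbf{D}^j\bm{k}}$ with $p_j\in\ell_1(\mathbb{Z}^d)$ such that $\widehat\varphi_j:=\widehat L_{\mathrm{d},j}\widehat L^{-1}$ satisfies, for some real constants $A_j,B_j$ and almost every $\bm{\omega}$, $$0<A_j\le\sum_{\bm{k}\in\mathbb{Z}^d}|\widehat\varphi_j(\bm{\omega}+2\pi(\mathbf{D}^T)^{-j}\bm{k})|^2\le B_j<\infty.$$ The functions $\varphi_j:=(\widehat\varphi_j)^\vee$ are the generalized B-splines for $\mathrm{L}$; $V_j=\{\sum_{\bm{k}}c[\bm{k}]\varphi_j(\cdot-\mathbf{D}^j\bm{k}):c\in\ell_2(\mathbb{Z}^d)\}$. One has $V_{j+1}\subseteq V_j$, and $W_{j+1}$ denotes the orthogonal complement of $V_{j+1}$ in $V_j$. The $\mathrm{L}^*\mathrm{L}$-spline interpolant $\phi_j$ is given by $\widehat\phi_j(\bm{\omega})=|\det(\mathbf{D})|^j\,|\widehat\varphi_j(\bm{\omega})|^2\big/\sum_{\bm{k}\in\mathbb{Z}^d}|\widehat\varphi_j(\bm{\omega}+2\pi(\mathbf{D}^T)^{-j}\bm{k})|^2$,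 and $\psi_{j+1}:=\mathrm{L}^*\phi_j$. Let $\bm{e}_0=\bm{0},\bm{e}_1,\dots,\bm{e}_{|\det(\mathbf{D})|-1}\in\mathbb{Z}^d$ be vectors that form a complete set of coset representatives both of $\mathbb{Z}^d/\mathbf{D}\mathbb{Z}^d$ and of $\mathbb{Z}^d/\mathbf{D}^T\mathbb{Z}^d$. Put $\psi_{j+1}^{(m)}(\bm{x}):=\psi_{j+1}(\bm{x}-\mathbf{D}^j\bm{e}_m)$ for $1\le m\le|\det(\mathbf{D})|-1$. The zero set of the symbol is $\mathcal{N}=\{\bm{p}\in\mathbb{R}^d:\widehat L(\bm{p})=0\}$, and for $0\le m\le|\det(\mathbf{D})|-1$, $$\mathcal{N}_j^{(m)}=\{\bm{p}-2\pi(\mathbf{D}^T)^{-j-1}\bm{e}_m+2\pi(\mathbf{D}^T)^{-j}\bm{k}:\bm{p}\in\mathcal{N},\ \bm{k}\in\mathbb{Z}^d\}.$$ *)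

theory Defs
  imports "HOL-Analysis.Analysis"
begin

section \<open>Square-integrable functions and the Fourier transform\<close>

text \<open>
  Elements of \<open>L\<^sub>2(\<real>\<^sup>d)\<close> are represented by Borel functions; functions that agree almost
  everywhere are not identified, so statements about an element quantify over its representatives.
\<close>

definition L2 :: "(real^'d \<Rightarrow> complex) \<Rightarrow> bool" where
  "L2 f \<longleftrightarrow> f \<in> borel_measurable lborel \<and> integrable lborel (\<lambda>x. (cmod (f x))\<^sup>2)"

definition L2_norm :: "(real^'d \<Rightarrow> complex) \<Rightarrow> real" where
  "L2_norm f = sqrt (LINT x|lborel. (cmod (f x))\<^sup>2)"

definition L2_inner :: "(real^'d \<Rightarrow> complex) \<Rightarrow> (real^'d \<Rightarrow> complex) \<Rightarrow> complex" where
  "L2_inner f g = (LINT x|lborel. f x * cnj (g x))"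

text \<open>
  The nonnegative integral is used because a difference that is not square integrable must
  count as infinitely large, whereas its Bochner integral would be \<open>0\<close>.
\<close>

definition L2_tendsto ::
    "('i \<Rightarrow> real^'d \<Rightarrow> complex) \<Rightarrow> (real^'d \<Rightarrow> complex) \<Rightarrow> 'i filter \<Rightarrow> bool" where
  "L2_tendsto u f F \<longleftrightarrow>
     ((\<lambda>i. \<integral>\<^sup>+ x. ennreal ((cmod (u i x - f x))\<^sup>2) \<partial>lborel) \<longlongrightarrow> 0) F"

text \<open>
  \<open>L2_fourier f F\<close>: the function \<open>F\<close> represents the Fourier(-Plancherel) transform of \<open>f\<close>, that
  is, the \<open>L\<^sub>2\<close> limit of the Fourier integrals of the truncations of \<open>f\<close> to balls.
  \<open>L2_inv_fourier F f\<close> is the same for the inverse transform.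
\<close>

definition L2_fourier :: "(real^'d \<Rightarrow> complex) \<Rightarrow> (real^'d \<Rightarrow> complex) \<Rightarrow> bool" where
  "L2_fourier f F \<longleftrightarrow> L2 f \<and> L2 F \<and>
     L2_tendsto (\<lambda>R \<omega>. LINT x:cball 0 R|lborel. f x * cis (- (x \<bullet> \<omega>))) F at_top"

definition L2_inv_fourier :: "(real^'d \<Rightarrow> complex) \<Rightarrow> (real^'d \<Rightarrow> complex) \<Rightarrow> bool" where
  "L2_inv_fourier F f \<longleftrightarrow> L2 F \<and> L2 f \<and>
     L2_tendsto (\<lambda>R x. (LINT \<omega>:cball 0 R|lborel. F \<omega> * cis (x \<bullet> \<omega>)) / (2 * pi) ^ CARD('d)) f at_top"

text \<open>\<open>fourier_multiplier s f h\<close>: the function \<open>h\<close> represents the image of \<open>f\<close> under the Fourier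
  multiplier operator with symbol \<open>s\<close>.\<close>

definition fourier_multiplier ::
    "(real^'d \<Rightarrow> complex) \<Rightarrow> (real^'d \<Rightarrow> complex) \<Rightarrow> (real^'d \<Rightarrow> complex) \<Rightarrow> bool" where
  "fourier_multiplier s f h \<longleftrightarrow>
     (\<exists>F. L2_fourier f F \<and> L2_inv_fourier (\<lambda>\<omega>. s \<omega> * F \<omega>) h)"

definition riesz_basis ::
    "'i set \<Rightarrow> ('i \<Rightarrow> real^'d \<Rightarrow> complex) \<Rightarrow> (real^'d \<Rightarrow> complex) set \<Rightarrow> bool" where
  "riesz_basis I f W \<longleftrightarrow>
     (\<forall>i\<in>I. f i \<in> W) \<and>
     (\<forall>g\<in>W. \<forall>\<epsilon>>0. \<exists>J c. finite J \<and> J \<subseteq> I \<and> L2_norm (\<lambda>x. g x - (\<Sum>i\<in>J. c i * f i x)) < \<epsilon>) \<and>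
     (\<exists>A>0. \<exists>B. \<forall>J c. finite J \<and> J \<subseteq> I \<longrightarrow>
        A * (\<Sum>i\<in>J. (cmod (c i))\<^sup>2) \<le> (L2_norm (\<lambda>x. \<Sum>i\<in>J. c i * f i x))\<^sup>2 \<and>
        (L2_norm (\<lambda>x. \<Sum>i\<in>J. c i * f i x))\<^sup>2 \<le> B * (\<Sum>i\<in>J. (cmod (c i))\<^sup>2))"


section \<open>Integer lattices and dilations\<close>

definition rvec :: "int^'d \<Rightarrow> real^'d" where
  "rvec k = (\<chi> i. real_of_int (k $ i))"

definition rmat :: "int^'d^'d \<Rightarrow> real^'d^'d" where
  "rmat D = map_matrix real_of_int D"

definition mat_zpow :: "real^'d^'d \<Rightarrow> int \<Rightarrow> real^'d^'d" where
  "mat_zpow A j =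
     (if j \<ge> 0 then (((**) A) ^^ nat j) (mat 1) else (((**) (matrix_inv A)) ^^ nat (- j)) (mat 1))"

text \<open>\<open>coset_reps D n e\<close>: the vectors \<open>e 0, \<dots>, e (n - 1)\<close> form a complete set of representatives
  of \<open>\<int>\<^sup>d / D\<int>\<^sup>d\<close>.\<close>

definition coset_reps :: "int^'d^'d \<Rightarrow> nat \<Rightarrow> (nat \<Rightarrow> int^'d) \<Rightarrow> bool" where
  "coset_reps D n e \<longleftrightarrow> (\<forall>k. \<exists>!m. m < n \<and> (\<exists>l. k - e m = D *v l))"


section \<open>Spline-admissible pairs\<close>

text \<open>
  The symbol of an admissible operator is given by its numerator \<open>f\<close> and denominator \<open>g\<close>. At a
  zero of \<open>g\<close> the symbol has a pole, but \<open>f \<omega> / g \<omega> = 0\<close> in HOL; this is harmless in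
  almost-everywhere statements, but such points must be excluded from the zero set.
\<close>

definition symbol :: "(real^'d \<Rightarrow> complex) \<Rightarrow> (real^'d \<Rightarrow> complex) \<Rightarrow> real^'d \<Rightarrow> complex" where
  "symbol f g \<omega> = f \<omega> / g \<omega>"

definition symbol_zeros :: "(real^'d \<Rightarrow> complex) \<Rightarrow> (real^'d \<Rightarrow> complex) \<Rightarrow> (real^'d) set" where
  "symbol_zeros f g = {p. g p \<noteq> 0 \<and> symbol f g p = 0}"

definition admissible :: "(real^'d \<Rightarrow> complex) \<Rightarrow> (real^'d \<Rightarrow> complex) \<Rightarrow> bool" where
  "admissible f g \<longleftrightarrow>
     continuous_on UNIV f \<and> continuous_on UNIV g \<and>
     {\<omega>. f \<omega> * g \<omega> = 0} \<in> null_sets lborel \<and>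
     {\<omega>. f \<omega> = 0} \<inter> {\<omega>. g \<omega> = 0} = {}"

definition periodic_symbol ::
    "int^'d^'d \<Rightarrow> int \<Rightarrow> (int^'d \<Rightarrow> complex) \<Rightarrow> real^'d \<Rightarrow> complex" where
  "periodic_symbol D j p \<omega> =
     (\<Sum>\<^sub>\<infinity>k\<in>UNIV. p k * cis (\<omega> \<bullet> (mat_zpow (rmat D) j *v rvec k)))"

definition bspline_hat ::
    "(real^'d \<Rightarrow> complex) \<Rightarrow> (real^'d \<Rightarrow> complex) \<Rightarrow> int^'d^'d \<Rightarrow> int \<Rightarrow> (int^'d \<Rightarrow> complex) \<Rightarrow>
     real^'d \<Rightarrow> complex" where
  "bspline_hat f g D j p \<omega> = periodic_symbol D j p \<omega> / symbol f g \<omega>"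

text \<open>The point \<open>2\<pi> (D\<^sup>T)\<^sup>-\<^sup>j k\<close> of the lattice dual to \<open>D\<^sup>j \<int>\<^sup>d\<close>.\<close>

definition dual_point :: "int^'d^'d \<Rightarrow> int \<Rightarrow> int^'d \<Rightarrow> real^'d" where
  "dual_point D j k = (2 * pi) *\<^sub>R (mat_zpow (transpose (rmat D)) (- j) *v rvec k)"

definition localizing ::
    "(real^'d \<Rightarrow> complex) \<Rightarrow> (real^'d \<Rightarrow> complex) \<Rightarrow> int^'d^'d \<Rightarrow> int \<Rightarrow> (int^'d \<Rightarrow> complex) \<Rightarrow> bool" where
  "localizing f g D j p \<longleftrightarrow>
     (\<lambda>k. cmod (p k)) summable_on UNIV \<and>
     (\<exists>A B. 0 < A \<and> (AE \<omega> in lborel.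
        (\<lambda>k. (cmod (bspline_hat f g D j p (\<omega> + dual_point D j k)))\<^sup>2) summable_on UNIV \<and>
        A \<le> (\<Sum>\<^sub>\<infinity>k\<in>UNIV. (cmod (bspline_hat f g D j p (\<omega> + dual_point D j k)))\<^sup>2) \<and>
        (\<Sum>\<^sub>\<infinity>k\<in>UNIV. (cmod (bspline_hat f g D j p (\<omega> + dual_point D j k)))\<^sup>2) \<le> B))"

definition spline_admissible ::
    "(real^'d \<Rightarrow> complex) \<Rightarrow> (real^'d \<Rightarrow> complex) \<Rightarrow> int^'d^'d \<Rightarrow> real \<Rightarrow> bool" where
  "spline_admissible f g D r \<longleftrightarrow>
     r > real CARD('d) / 2 \<and>
     admissible f g \<and>
     (\<exists>a R. a > 1 \<and> orthogonal_matrix R \<and> rmat D = a *\<^sub>R R) \<and>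
     (\<exists>C>0. AE \<omega> in lborel. norm \<omega> powr (2 * r) \<le> C * (1 + (cmod (symbol f g \<omega>))\<^sup>2)) \<and>
     (\<forall>j. \<exists>p. localizing f g D j p)"


section \<open>Spline spaces, wavelet spaces and interpolants\<close>

definition spline_space ::
    "int^'d^'d \<Rightarrow> (int \<Rightarrow> real^'d \<Rightarrow> complex) \<Rightarrow> int \<Rightarrow> (real^'d \<Rightarrow> complex) set" where
  "spline_space D \<phi> j =
     {h. L2 h \<and> (\<exists>c. (\<lambda>k::int^'d. (cmod (c k))\<^sup>2) summable_on UNIV \<and>
        L2_tendsto (\<lambda>K x. \<Sum>k\<in>K. c k * \<phi> j (x - mat_zpow (rmat D) j *v rvec k)) h
          (finite_subsets_at_top UNIV))}"

definition wavelet_space ::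
    "int^'d^'d \<Rightarrow> (int \<Rightarrow> real^'d \<Rightarrow> complex) \<Rightarrow> int \<Rightarrow> (real^'d \<Rightarrow> complex) set" where
  "wavelet_space D \<phi> j =
     {h \<in> spline_space D \<phi> (j - 1). \<forall>u \<in> spline_space D \<phi> j. L2_inner h u = 0}"

definition interpolant_hat ::
    "(real^'d \<Rightarrow> complex) \<Rightarrow> (real^'d \<Rightarrow> complex) \<Rightarrow> int^'d^'d \<Rightarrow> int \<Rightarrow> (int^'d \<Rightarrow> complex) \<Rightarrow>
     real^'d \<Rightarrow> complex" where
  "interpolant_hat f g D j p \<omega> = complex_of_real
     ((real_of_int \<bar>det D\<bar> powi j) * (cmod (bspline_hat f g D j p \<omega>))\<^sup>2 /
      (\<Sum>\<^sub>\<infinity>k\<in>UNIV. (cmod (bspline_hat f g D j p (\<omega> + dual_point D j k)))\<^sup>2))"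

definition shifted_zeros ::
    "(real^'d \<Rightarrow> complex) \<Rightarrow> (real^'d \<Rightarrow> complex) \<Rightarrow> int^'d^'d \<Rightarrow> int \<Rightarrow> int^'d \<Rightarrow> (real^'d) set" where
  "shifted_zeros f g D j v =
     {p - dual_point D (j + 1) v + dual_point D j k | p k. p \<in> symbol_zeros f g}"

end

theory Submission
  imports Defs
begin

text \<open>
  Write \<open>u = 1 / L\<close> for the inverse symbol, \<open>\<Lambda>\<close> for the dual lattice of scale \<open>j\<close> and \<open>\<Lambda>'\<close> for that of scale
  \<open>j + 1\<close>, which contains \<open>\<Lambda>\<close> with index \<open>n = \<bar>det D\<bar>\<close>. Splines of scale \<open>j\<close> have Fourier transforms \<open>q u\<close>
  with \<open>q\<close> periodic under \<open>\<Lambda>\<close>, and the norm of \<open>q u\<close> is that of \<open>q\<close> in \<open>L\<^sub>2\<close> of a cell with weight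
  \<open>M \<omega> = (\<Sum>k. \<bar>u (\<omega> + k)\<bar>\<^sup>2)\<close>, the sum being over \<open>\<Lambda>\<close>. In terms of \<open>s = q M\<close> the weight becomes \<open>w = 1 / M\<close>,
  the orthogonal complement of the coarse splines is the set of those \<open>s\<close> whose sum over each coset of
  \<open>\<Lambda>'\<close> modulo \<open>\<Lambda>\<close> vanishes, and the wavelets are, up to a factor, the characters whose frequencies
  avoid \<open>D \<int>\<^sup>d\<close>, an orthogonal basis of this set when the weight is constant. As \<open>w\<close> is bounded, the Riesz
  property amounts to the inequality that the sum of the \<open>w (\<omega> + l) \<bar>s (\<omega> + l)\<bar>\<^sup>2\<close> over cosets \<open>l\<close> dominates
  that of the \<open>\<bar>s (\<omega> + l)\<bar>\<^sup>2\<close>, uniformly in \<open>\<omega>\<close> for \<open>s\<close> with vanishing coset sums; and this means that no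
  two of the numbers \<open>w (\<omega> + l)\<close> are small at the same time. Since \<open>r > d / 2\<close>, the function \<open>w\<close> is
  continuous, and its zero set consists of the translates of the zeros of \<open>L\<close> under \<open>\<Lambda>\<close>, so that by
  compactness uniformity is automatic and the condition is the disjointness of the shifted zero sets.
\<close>

section \<open>Square-integrable functions on a measure space\<close>

text \<open>The filters drop out of the wavelets: in the interpolant |Ld|^2 cancels between
  numerator and denominator, and the conjugate of L times |u|^2 is u. A wavelet therefore has
  transform constant times character times \<open>w\<close> times u, so that its s is a bare
  character and only the zeros of L can matter. The weight \<open>w\<close> is preferred to M
  because M has poles at the zeros of L, where \<open>w\<close> extends continuously by 0. The
  hypotheses hold almost everywhere while the condition is pointwise; continuity closes this gap.
  For necessity, the lower Riesz bound is first carried by density from finite combinations of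
  wavelets to every s with vanishing coset sums, and then tested on indicators. For completeness, an
  element of W is approximated by a spline, whose coarse part is small because the element is
  orthogonal to the coarse space; what remains, multiplied by M, is square integrable on the cell by
  the lower bound, and its Fourier series has no frequency in D Z^d.\<close>

lemma borel_measurable_cnj [measurable (raw)]:
  "f \<in> borel_measurable M \<Longrightarrow> (\<lambda>x. cnj (f x)) \<in> borel_measurable M"
  by (rule borel_measurable_continuous_on[where f = cnj]) (auto intro: continuous_intros)

text \<open>The measure is arbitrary because the same calculus serves Lebesgue measure, a cell, and
  the cell with the weights M and \<open>w\<close>.\<close>

definition sq_int :: "'a measure \<Rightarrow> ('a \<Rightarrow> complex) \<Rightarrow> bool" where
  "sq_int N f \<longleftrightarrow> f \<in> borel_measurable N \<and> integrable N (\<lambda>x. (cmod (f x))\<^sup>2)"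

definition nsq :: "'a measure \<Rightarrow> ('a \<Rightarrow> complex) \<Rightarrow> real" where
  "nsq N f = (\<integral>x. (cmod (f x))\<^sup>2 \<partial>N)"

definition ip :: "'a measure \<Rightarrow> ('a \<Rightarrow> complex) \<Rightarrow> ('a \<Rightarrow> complex) \<Rightarrow> complex" where
  "ip N f g = (\<integral>x. f x * cnj (g x) \<partial>N)"

lemma cmod_add_sq_le: "(cmod (a + b))\<^sup>2 \<le> 2 * (cmod a)\<^sup>2 + 2 * (cmod b)\<^sup>2"
proof -
  have "(cmod (a + b))\<^sup>2 \<le> (cmod a + cmod b)\<^sup>2"
    by (intro power_mono norm_triangle_ineq) auto
  also have "\<dots> \<le> 2 * (cmod a)\<^sup>2 + 2 * (cmod b)\<^sup>2"
    using sum_squares_ge_zero[of "cmod a - cmod b" 0] by (simp add: power2_eq_square algebra_simps)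
  finally show ?thesis .
qed

lemma sq_int_measurable [measurable_dest]: "sq_int N f \<Longrightarrow> f \<in> borel_measurable N"
  by (simp add: sq_int_def)

lemma sq_int_integrable: "sq_int N f \<Longrightarrow> integrable N (\<lambda>x. (cmod (f x))\<^sup>2)"
  by (simp add: sq_int_def)

lemma sq_int_bound:
  assumes "sq_int N f" "g \<in> borel_measurable N" "AE x in N. cmod (g x) \<le> C * cmod (f x)"
  shows "sq_int N g"
  unfolding sq_int_def
proof (intro conjI assms)
  show "integrable N (\<lambda>x. (cmod (g x))\<^sup>2)"
  proof (rule Bochner_Integration.integrable_bound)
    show "integrable N (\<lambda>x. C\<^sup>2 * (cmod (f x))\<^sup>2)"
      using sq_int_integrable[OF assms(1)] by simp
    show "(\<lambda>x. (cmod (g x))\<^sup>2) \<in> borel_measurable N" using assms(2) by measurable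
    show "AE x in N. norm ((cmod (g x))\<^sup>2) \<le> norm (C\<^sup>2 * (cmod (f x))\<^sup>2)"
      using assms(3)
    proof eventually_elim
      case (elim x)
      then show ?case using power_mono[OF elim, of 2] by (simp add: power_mult_distrib)
    qed
  qed
qed

lemma sq_int_cong_AE:
  assumes "sq_int N f" "g \<in> borel_measurable N" "AE x in N. f x = g x"
  shows "sq_int N g"
  by (rule sq_int_bound[OF assms(1,2), of 1]) (use assms(3) in auto)

lemma sq_int_mult_bounded:
  assumes "sq_int N f" "h \<in> borel_measurable N" "AE x in N. cmod (h x) \<le> C"
  shows "sq_int N (\<lambda>x. h x * f x)"
proof (rule sq_int_bound[OF assms(1), of _ C])
  show "(\<lambda>x. h x * f x) \<in> borel_measurable N" using assms by measurable
  show "AE x in N. cmod (h x * f x) \<le> C * cmod (f x)"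
    using assms(3) by eventually_elim (simp add: norm_mult mult_right_mono)
qed

lemma sq_int_cmult: "sq_int N f \<Longrightarrow> sq_int N (\<lambda>x. c * f x)"
  using sq_int_mult_bounded[of N f "\<lambda>_. c" "cmod c"] by simp

lemma sq_int_add:
  assumes "sq_int N f" "sq_int N g"
  shows "sq_int N (\<lambda>x. f x + g x)"
  unfolding sq_int_def
proof (intro conjI)
  show m: "(\<lambda>x. f x + g x) \<in> borel_measurable N" using assms by measurable
  show "integrable N (\<lambda>x. (cmod (f x + g x))\<^sup>2)"
  proof (rule Bochner_Integration.integrable_bound)
    show "integrable N (\<lambda>x. 2 * (cmod (f x))\<^sup>2 + 2 * (cmod (g x))\<^sup>2)"
      using assms[THEN sq_int_integrable] by simp
    show "(\<lambda>x. (cmod (f x + g x))\<^sup>2) \<in> borel_measurable N" using m by measurable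
    show "AE x in N. norm ((cmod (f x + g x))\<^sup>2) \<le> norm (2 * (cmod (f x))\<^sup>2 + 2 * (cmod (g x))\<^sup>2)"
      using cmod_add_sq_le by auto
  qed
qed

lemma sq_int_zero [simp]: "sq_int N (\<lambda>x. 0)"
  by (simp add: sq_int_def)

lemma sq_int_diff:
  assumes "sq_int N f" "sq_int N g"
  shows "sq_int N (\<lambda>x. f x - g x)"
  using sq_int_add[OF assms(1) sq_int_cmult[OF assms(2), of "-1"]] by simp

lemma sq_int_sum:
  assumes "\<And>i. i \<in> I \<Longrightarrow> sq_int N (f i)"
  shows "sq_int N (\<lambda>x. \<Sum>i\<in>I. f i x)"
  using assms by (induction I rule: infinite_finite_induct) (auto intro: sq_int_add)

lemma integrable_ip:
  assumes "sq_int N f" "sq_int N g"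
  shows "integrable N (\<lambda>x. f x * cnj (g x))"
proof (rule Bochner_Integration.integrable_bound)
  show "integrable N (\<lambda>x. (cmod (f x))\<^sup>2 + (cmod (g x))\<^sup>2)"
    using assms[THEN sq_int_integrable] by simp
  show "(\<lambda>x. f x * cnj (g x)) \<in> borel_measurable N" using assms by measurable
  have "cmod a * cmod b \<le> (cmod a)\<^sup>2 + (cmod b)\<^sup>2" for a b :: complex
  proof -
    have "2 * cmod a * cmod b \<le> (cmod a)\<^sup>2 + (cmod b)\<^sup>2"
      using sum_squares_ge_zero[of "cmod a - cmod b" 0] by (simp add: power2_eq_square algebra_simps)
    moreover have "0 \<le> cmod a * cmod b" by simp
    ultimately show ?thesis by linarith
  qed
  then show "AE x in N. norm (f x * cnj (g x)) \<le> norm ((cmod (f x))\<^sup>2 + (cmod (g x))\<^sup>2)"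
    by (simp add: norm_mult)
qed

lemma nsq_nonneg [simp]: "0 \<le> nsq N f"
  by (simp add: nsq_def)

lemma nsq_ip: "of_real (nsq N f) = ip N f f"
proof -
  have "f x * cnj (f x) = complex_of_real ((cmod (f x))\<^sup>2)" for x
    by (simp only: complex_norm_square)
  then show ?thesis by (simp only: nsq_def ip_def integral_complex_of_real)
qed

lemma nn_nsq:
  assumes "sq_int N f"
  shows "(\<integral>\<^sup>+x. ennreal ((cmod (f x))\<^sup>2) \<partial>N) = ennreal (nsq N f)"
  unfolding nsq_def by (rule nn_integral_eq_integral) (use sq_int_integrable[OF assms] in auto)

lemma sq_int_iff_nn:
  assumes "f \<in> borel_measurable N"
  shows "sq_int N f \<longleftrightarrow> (\<integral>\<^sup>+x. ennreal ((cmod (f x))\<^sup>2) \<partial>N) < \<infinity>"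
  unfolding sq_int_def using assms by (auto simp: integrable_iff_bounded)

lemma nsq_enn2real:
  assumes "f \<in> borel_measurable N"
  shows "nsq N f = enn2real (\<integral>\<^sup>+x. ennreal ((cmod (f x))\<^sup>2) \<partial>N)"
  unfolding nsq_def by (rule integral_eq_nn_integral) (use assms in auto)

lemma nsq_mono:
  assumes "sq_int N g" "f \<in> borel_measurable N" "AE x in N. cmod (f x) \<le> cmod (g x)"
  shows "nsq N f \<le> nsq N g"
  unfolding nsq_def
proof (rule integral_mono_AE)
  have "sq_int N f" by (rule sq_int_bound[OF assms(1,2), of 1]) (use assms in auto)
  then show "integrable N (\<lambda>x. (cmod (f x))\<^sup>2)" by (rule sq_int_integrable)
  show "integrable N (\<lambda>x. (cmod (g x))\<^sup>2)" using assms(1) by (rule sq_int_integrable)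
  show "AE x in N. (cmod (f x))\<^sup>2 \<le> (cmod (g x))\<^sup>2"
    using assms(3) by eventually_elim (auto intro: power_mono)
qed

lemma nsq_cong_AE:
  assumes "f \<in> borel_measurable N" "g \<in> borel_measurable N" "AE x in N. f x = g x"
  shows "nsq N f = nsq N g"
  unfolding nsq_def by (rule integral_cong_AE) (use assms in auto)

lemma ip_sym: "ip N g f = cnj (ip N f g)"
proof -
  have "ip N g f = (\<integral>x. cnj (f x * cnj (g x)) \<partial>N)" by (simp add: ip_def mult.commute)
  then show ?thesis by (simp only: Bochner_Integration.integral_cnj ip_def)
qed

lemma ip_add_left:
  assumes "sq_int N f" "sq_int N g" "sq_int N h"
  shows "ip N (\<lambda>x. f x + g x) h = ip N f h + ip N g h"
  using integrable_ip[OF assms(1,3)] integrable_ip[OF assms(2,3)]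
  by (simp add: ip_def distrib_right)

lemma ip_cmult_left: "ip N (\<lambda>x. c * f x) h = c * ip N f h"
  by (simp add: ip_def mult.assoc)

lemma ip_zero_left [simp]: "ip N (\<lambda>x. 0) h = 0"
  by (simp add: ip_def)

lemma ip_diff_left:
  assumes "sq_int N f" "sq_int N g" "sq_int N h"
  shows "ip N (\<lambda>x. f x - g x) h = ip N f h - ip N g h"
  using integrable_ip[OF assms(1,3)] integrable_ip[OF assms(2,3)]
  by (simp add: ip_def left_diff_distrib)

lemma ip_sum_left:
  assumes "\<And>i. i \<in> I \<Longrightarrow> sq_int N (f i)" "sq_int N h"
  shows "ip N (\<lambda>x. \<Sum>i\<in>I. f i x) h = (\<Sum>i\<in>I. ip N (f i) h)"
  using assms
  by (induction I rule: infinite_finite_induct) (auto simp: ip_add_left sq_int_sum)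

lemma ip_add_right:
  assumes "sq_int N f" "sq_int N g" "sq_int N h"
  shows "ip N h (\<lambda>x. f x + g x) = ip N h f + ip N h g"
  using ip_add_left[OF assms] by (simp add: ip_sym[of N h])

lemma ip_diff_right:
  assumes "sq_int N f" "sq_int N g" "sq_int N h"
  shows "ip N h (\<lambda>x. f x - g x) = ip N h f - ip N h g"
  using ip_diff_left[OF assms] by (simp add: ip_sym[of N h])

lemma ip_cmult_right: "ip N h (\<lambda>x. c * f x) = cnj c * ip N h f"
  by (simp add: ip_sym[of N h] ip_cmult_left)

lemma ip_sum_right:
  assumes "\<And>i. i \<in> I \<Longrightarrow> sq_int N (f i)" "sq_int N h"
  shows "ip N h (\<lambda>x. \<Sum>i\<in>I. f i x) = (\<Sum>i\<in>I. ip N h (f i))"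
  by (subst ip_sym) (simp add: ip_sum_left[OF assms] ip_sym[of N h])

lemma nsq_cmult: "nsq N (\<lambda>x. c * f x) = (cmod c)\<^sup>2 * nsq N f"
  by (simp add: nsq_def norm_mult power_mult_distrib)

lemma nsq_add:
  assumes "sq_int N f" "sq_int N g"
  shows "nsq N (\<lambda>x. f x + g x) = nsq N f + nsq N g + 2 * Re (ip N f g)"
proof -
  have "complex_of_real (nsq N (\<lambda>x. f x + g x)) = ip N f f + ip N g g + (ip N f g + cnj (ip N f g))"
    using assms by (simp add: nsq_ip ip_add_left ip_add_right sq_int_add ip_sym[of N g f])
  also have "\<dots> = complex_of_real (nsq N f + nsq N g + 2 * Re (ip N f g))"
    by (simp add: nsq_ip[symmetric] complex_add_cnj)
  finally show ?thesis by (simp only: of_real_eq_iff)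
qed

lemma nsq_diff:
  assumes "sq_int N f" "sq_int N g"
  shows "nsq N (\<lambda>x. f x - g x) = nsq N f + nsq N g - 2 * Re (ip N f g)"
  using nsq_add[OF assms(1) sq_int_cmult[OF assms(2), of "-1"]]
  by (simp add: nsq_cmult[of N "-1", simplified] ip_cmult_right[of N f "-1", simplified])

text \<open>The squared norm of f - t z g is nonnegative, where z is the inner product; the factor z
  makes the cross term real, so that a real t suffices.\<close>

lemma ip_Cauchy_Schwarz:
  assumes "sq_int N f" "sq_int N g"
  shows "(cmod (ip N f g))\<^sup>2 \<le> nsq N f * nsq N g"
proof -
  define z where "z = ip N f g"
  have *: "0 \<le> nsq N f + t\<^sup>2 * (cmod z)\<^sup>2 * nsq N g - 2 * t * (cmod z)\<^sup>2" for t :: real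
  proof -
    have "0 \<le> nsq N (\<lambda>x. f x - (of_real t * z) * g x)" by simp
    also have "\<dots> = nsq N f + (cmod (of_real t * z))\<^sup>2 * nsq N g - 2 * Re (cnj (of_real t * z) * z)"
      using assms by (simp only: nsq_diff sq_int_cmult nsq_cmult ip_cmult_right z_def)
    also have "Re (cnj (of_real t * z) * z) = t * (cmod z)\<^sup>2"
      by (simp only: cmod_power2) (simp add: power2_eq_square algebra_simps)
    finally show ?thesis by (simp add: norm_mult power_mult_distrib mult.assoc)
  qed
  show ?thesis
  proof (cases "nsq N g = 0")
    case True
    have "z = 0"
    proof (rule ccontr)
      assume "z \<noteq> 0"
      then have p: "(cmod z)\<^sup>2 > 0" by simp
      \<comment> \<open>With g of norm 0 the quadratic is linear in t; this t brings it down to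
        -1.\<close>
      have "2 * ((nsq N f + 1) / (2 * (cmod z)\<^sup>2)) * (cmod z)\<^sup>2 = nsq N f + 1"
        using p by (simp only: field_simps) simp
      then show False using *[of "(nsq N f + 1) / (2 * (cmod z)\<^sup>2)"] True by simp
    qed
    then show ?thesis using True by (simp add: z_def)
  next
    case False
    then have p: "nsq N g > 0" using nsq_nonneg[of N g] by linarith
    have "0 \<le> nsq N g * (nsq N f + (1 / nsq N g)\<^sup>2 * (cmod z)\<^sup>2 * nsq N g - 2 * (1 / nsq N g) * (cmod z)\<^sup>2)"
      using *[of "1 / nsq N g"] p by (intro mult_nonneg_nonneg) auto
    also have "\<dots> = nsq N f * nsq N g - (cmod z)\<^sup>2"
      using False by (simp add: field_simps power2_eq_square)
    finally show ?thesis by (simp add: z_def)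
  qed
qed

lemma nsq_add_le:
  assumes "sq_int N f" "sq_int N g"
  shows "nsq N (\<lambda>x. f x + g x) \<le> 2 * nsq N f + 2 * nsq N g"
proof -
  have "0 \<le> nsq N (\<lambda>x. f x - g x)" by simp
  then show ?thesis using nsq_diff[OF assms] nsq_add[OF assms] by linarith
qed

lemma sqrt_nsq_triangle:
  assumes "sq_int N f" "sq_int N g"
  shows "sqrt (nsq N (\<lambda>x. f x + g x)) \<le> sqrt (nsq N f) + sqrt (nsq N g)"
proof (rule real_le_lsqrt)
  have "Re (ip N f g) \<le> cmod (ip N f g)" by (rule complex_Re_le_cmod)
  also have "\<dots> \<le> sqrt (nsq N f * nsq N g)"
    using ip_Cauchy_Schwarz[OF assms] by (simp add: real_le_rsqrt)
  finally show "nsq N (\<lambda>x. f x + g x) \<le> (sqrt (nsq N f) + sqrt (nsq N g))\<^sup>2"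
    by (simp add: nsq_add[OF assms] power2_sum real_sqrt_mult)
qed (auto)

section \<open>Lattices and their cells\<close>

lemma rvec_add: "rvec (k + l) = rvec k + rvec l"
  and rvec_diff: "rvec (k - l) = rvec k - rvec l"
  and rvec_minus: "rvec (- k) = - rvec k"
  and rvec_0 [simp]: "rvec 0 = 0"
  by (simp_all add: rvec_def vec_eq_iff)

lemma rvec_nth [simp]: "rvec k $ i = real_of_int (k $ i)"
  by (simp add: rvec_def)

lemma rvec_inject [simp]: "rvec k = rvec l \<longleftrightarrow> k = l"
  by (simp add: vec_eq_iff)

lemma rvec_axis: "rvec (axis i 1) = axis i 1"
  by (simp add: vec_eq_iff axis_def)

lemma rvec_inner_Ints: "rvec k \<bullet> rvec l \<in> \<int>"
  by (auto simp: inner_vec_def intro!: Ints_sum)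

lemma cis_2pi_Ints: "x \<in> \<int> \<Longrightarrow> cis (2 * pi * x) = 1"
  by (auto simp: Ints_def cis_multiple_2pi)

lemma cis_eq_1_imp_Ints:
  assumes "cis (2 * pi * x) = 1"
  shows "x \<in> \<int>"
proof -
  have "cos (2 * pi * x) = 1" using assms by (metis cis.sel(1) one_complex.sel(1))
  then obtain n :: int where "2 * pi * x = of_int n * 2 * pi"
    by (auto simp: cos_one_2pi_int)
  then have "x = of_int n" by simp
  then show ?thesis by simp
qed

section \<open>Measurability, lattice sums as integrals, translations\<close>

lemma borel_measurable_mult_vec [measurable (raw)]:
  fixes A :: "real^'n^'m"
  assumes "f \<in> borel_measurable M"
  shows "(\<lambda>x. A *v f x) \<in> borel_measurable M"
  by (rule borel_measurable_continuous_on[OF _ assms]) (intro continuous_intros)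

lemma borel_measurable_vec_nth' [measurable (raw)]:
  fixes f :: "'a \<Rightarrow> 'b::euclidean_space^'n"
  assumes "f \<in> borel_measurable M"
  shows "(\<lambda>x. f x $ i) \<in> borel_measurable M"
  by (rule borel_measurable_continuous_on[OF _ assms]) (intro continuous_intros)

lemma borel_measurable_vec_lambda:
  fixes f :: "'a \<Rightarrow> 'n::finite \<Rightarrow> 'b::euclidean_space"
  assumes "\<And>i. (\<lambda>x. f x i) \<in> borel_measurable M"
  shows "(\<lambda>x. \<chi> i. f x i) \<in> borel_measurable M"
  unfolding borel_measurable_euclidean_space[of "\<lambda>x. \<chi> i. f x i"]
proof
  fix b :: "'b^'n" assume "b \<in> Basis"
  then obtain i u where b: "b = axis i u" by (auto simp: Basis_vec_def)
  have "(\<lambda>x. (\<chi> i. f x i) \<bullet> b) = (\<lambda>x. f x i \<bullet> u)" by (simp add: b inner_axis)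
  then show "(\<lambda>x. (\<chi> i. f x i) \<bullet> b) \<in> borel_measurable M"
    using assms by simp
qed

text \<open>Lattice sums are treated as integrals against counting measure, so that Tonelli's
  theorem applies; this leads back to \<open>infsum\<close>.\<close>

lemma nn_integral_count_space_infsum:
  fixes F :: "'i \<Rightarrow> real"
  assumes "F summable_on UNIV" "\<And>k. 0 \<le> F k"
  shows "(\<integral>\<^sup>+k. ennreal (F k) \<partial>count_space UNIV) = ennreal (\<Sum>\<^sub>\<infinity>k. F k)"
proof -
  have a: "Infinite_Sum.abs_summable_on F UNIV"
    using assms(1) summable_on_iff_abs_summable_on_real by blast
  then have b: "Infinite_Set_Sum.abs_summable_on F UNIV"
    using abs_summable_equivalent by blast
  have "(\<integral>\<^sup>+k. ennreal (F k) \<partial>count_space UNIV) = ennreal (\<integral>k. F k \<partial>count_space UNIV)"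
    by (rule nn_integral_eq_integral) (use b assms in \<open>auto simp: abs_summable_on_def\<close>)
  also have "(\<integral>k. F k \<partial>count_space UNIV) = infsetsum F UNIV"
    by (simp add: infsetsum_def)
  finally show ?thesis by (simp add: infsetsum_infsum[OF b])
qed

lemma nn_integral_lborel_translate:
  fixes c :: "'a::euclidean_space"
  assumes "h \<in> borel_measurable borel"
  shows "(\<integral>\<^sup>+x. h (x + c) \<partial>lborel) = (\<integral>\<^sup>+x. h x \<partial>lborel)"
proof -
  have "(\<integral>\<^sup>+x. h x \<partial>lborel) = (\<integral>\<^sup>+x. h x \<partial>distr lborel borel ((+) c))"
    by (simp only: lborel_distr_plus)
  also have "\<dots> = (\<integral>\<^sup>+x. h (c + x) \<partial>lborel)"
    by (rule nn_integral_distr) (use assms in auto)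
  finally show ?thesis by (simp add: add.commute)
qed

lemma AE_lborel_translate:
  fixes c :: "'a::euclidean_space"
  assumes "AE x in lborel. P x"
  shows "AE x in lborel. P (x + c)"
proof -
  obtain N where N: "{x. \<not> P x} \<subseteq> N" "emeasure lborel N = 0" "N \<in> sets borel"
    using AE_E[OF assms] by auto
  have "(\<integral>\<^sup>+x. indicator N (x + c) \<partial>lborel) = emeasure lborel N"
    using N nn_integral_lborel_translate[of "indicator N" c] by simp
  then have "AE x in lborel. indicator N (x + c) = (0::ennreal)"
    using N by (subst nn_integral_0_iff_AE[symmetric]) auto
  then show ?thesis
    by eventually_elim (use N in \<open>auto simp: indicator_def split: if_splits\<close>)
qed

lemma mult_vec_minus: "A *v (- x) = - (A *v (x :: real^'n))"
  using matrix_vector_mult_diff_distrib[of A 0 x] by simp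

lemma borel_measurable_nn_count_space:
  fixes F :: "'a \<Rightarrow> 'k::countable \<Rightarrow> ennreal"
  assumes [measurable]: "\<And>k. (\<lambda>x. F x k) \<in> borel_measurable M"
  shows "(\<lambda>x. \<integral>\<^sup>+k. F x k \<partial>count_space UNIV) \<in> borel_measurable M"
proof (rule sigma_finite_measure.borel_measurable_nn_integral[OF sigma_finite_measure_count_space])
  have "(\<lambda>p. (\<lambda>k p. F (fst p) k) (snd p) p) \<in> borel_measurable (M \<Otimes>\<^sub>M count_space UNIV)"
    by (rule measurable_compose_countable) auto
  then show "case_prod F \<in> borel_measurable (M \<Otimes>\<^sub>M count_space UNIV)"
    by (simp add: case_prod_beta')
qed

text \<open>The lattice is the image of the integer vectors under \<open>T\<close>, and
  \<open>S\<close> gives lattice coordinates. Besides the dual lattice of scale j, the cubic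
  lattices in the proof of Plancherel's formula are instances.\<close>

locale lattice =
  fixes T S :: "real^'d^'d"
  assumes TS: "T ** S = mat 1" and ST: "S ** T = mat 1"
begin

lemma TS_v [simp]: "T *v (S *v x) = x" and ST_v [simp]: "S *v (T *v x) = x"
  by (simp_all add: matrix_vector_mul_assoc TS ST)

definition pt :: "int^'d \<Rightarrow> real^'d" where "pt k = T *v rvec k"

definition fl :: "real^'d \<Rightarrow> int^'d" where "fl \<omega> = (\<chi> i. \<lfloor>(S *v \<omega>) $ i\<rfloor>)"

definition cell :: "(real^'d) set" where "cell = {\<omega>. fl \<omega> = 0}"

definition red :: "real^'d \<Rightarrow> real^'d" where "red \<omega> = \<omega> - pt (fl \<omega>)"

text \<open>A density rather than a restricted space: Borel functions on the whole space are then
  measurable for it as they stand.\<close>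

definition cellm :: "(real^'d) measure" where "cellm = density lborel (indicator cell)"

definition chr :: "int^'d \<Rightarrow> real^'d \<Rightarrow> complex" where
  "chr k \<omega> = cis (2 * pi * (rvec k \<bullet> (S *v \<omega>)))"

definition per :: "(real^'d \<Rightarrow> 'b) \<Rightarrow> bool" where
  "per q \<longleftrightarrow> (\<forall>\<omega> k. q (\<omega> + pt k) = q \<omega>)"

lemma perD: "per q \<Longrightarrow> q (\<omega> + pt k) = q \<omega>"
  by (simp add: per_def)

lemma pt_add: "pt (k + l) = pt k + pt l" and pt_diff: "pt (k - l) = pt k - pt l"
  and pt_minus: "pt (- k) = - pt k" and pt_0 [simp]: "pt 0 = 0"
  by (simp_all add: pt_def rvec_add rvec_diff rvec_minus matrix_vector_right_distrib
      matrix_vector_mult_diff_distrib mult_vec_minus)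

lemma per_minus: "per q \<Longrightarrow> q (\<omega> - pt k) = q \<omega>"
  using perD[of q \<omega> "- k"] by (simp add: pt_minus)

lemma per_red: "per q \<Longrightarrow> q (red \<omega>) = q \<omega>"
  by (simp add: red_def per_minus)

lemma fl_add_pt: "fl (\<omega> + pt k) = fl \<omega> + k"
  by (simp add: fl_def pt_def vec_eq_iff matrix_vector_right_distrib)

lemma fl_diff_pt: "fl (\<omega> - pt k) = fl \<omega> - k"
  using fl_add_pt[of \<omega> "- k"] by (simp add: pt_minus)

lemma red_in_cell [simp]: "red \<omega> \<in> cell"
  by (simp add: red_def cell_def fl_diff_pt)

lemma red_cell: "\<omega> \<in> cell \<Longrightarrow> red \<omega> = \<omega>"
  by (simp add: red_def cell_def)

lemma per_red': "per red"
  by (simp add: per_def red_def fl_add_pt pt_add)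

lemma fl_measurable: "{\<omega>. fl \<omega> = k} \<in> sets borel"
proof -
  have "{\<omega>. fl \<omega> = k} = {\<omega> \<in> space borel. \<forall>i. real_of_int \<lfloor>(S *v \<omega>) $ i\<rfloor> = real_of_int (k $ i)}"
    by (auto simp: fl_def vec_eq_iff)
  also have "\<dots> \<in> sets borel" by measurable
  finally show ?thesis .
qed

lemma cell_sets [measurable]: "cell \<in> sets borel"
  unfolding cell_def by (rule fl_measurable)

lemma red_measurable [measurable]: "red \<in> borel_measurable borel"
proof -
  have "(\<lambda>\<omega>. \<omega> - T *v (\<chi> i. real_of_int \<lfloor>(S *v \<omega>) $ i\<rfloor>)) \<in> borel_measurable borel"
    by (intro borel_measurable_diff borel_measurable_mult_vec borel_measurable_vec_lambda) auto
  moreover have "rvec (fl \<omega>) = (\<chi> i. real_of_int \<lfloor>(S *v \<omega>) $ i\<rfloor>)" for \<omega>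
    by (simp add: fl_def rvec_def)
  ultimately show ?thesis by (simp add: red_def[abs_def] pt_def)
qed

lemma sets_cellm [simp, measurable_cong]: "sets cellm = sets borel"
  and space_cellm [simp]: "space cellm = UNIV"
  by (simp_all add: cellm_def)

lemma nn_cellm:
  assumes "h \<in> borel_measurable borel"
  shows "(\<integral>\<^sup>+\<omega>. h \<omega> \<partial>cellm) = (\<integral>\<^sup>+\<omega>. indicator cell \<omega> * h \<omega> \<partial>lborel)"
  unfolding cellm_def by (rule nn_integral_density) (use assms in auto)

lemma AE_cellm_iff: "(AE \<omega> in cellm. P \<omega>) \<longleftrightarrow> (AE \<omega> in lborel. \<omega> \<in> cell \<longrightarrow> P \<omega>)"
  unfolding cellm_def by (subst AE_density) (auto simp: indicator_def)

lemma AE_cellm: "(AE \<omega> in lborel. P \<omega>) \<Longrightarrow> (AE \<omega> in cellm. P \<omega>)"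
  unfolding AE_cellm_iff by auto

lemma AE_cellm_cell: "AE \<omega> in cellm. \<omega> \<in> cell"
  unfolding AE_cellm_iff by auto

text \<open>The translates of the cell tile the space, so their indicators sum to 1. Inserting this
  sum, exchanging by Tonelli and translating each term back to the cell leaves \<open>q\<close>
  unchanged and spreads \<open>v\<close> over the lattice.\<close>

lemma periodize:
  fixes q v :: "real^'d \<Rightarrow> ennreal"
  assumes [measurable]: "q \<in> borel_measurable borel" "v \<in> borel_measurable borel" and q: "per q"
  shows "(\<integral>\<^sup>+\<omega>. q \<omega> * v \<omega> \<partial>lborel) = (\<integral>\<^sup>+\<omega>. q \<omega> * (\<integral>\<^sup>+k. v (\<omega> + pt k) \<partial>count_space UNIV) \<partial>cellm)"
proof -
  have 1: "(\<integral>\<^sup>+k. indicator cell (\<omega> - pt k) \<partial>count_space UNIV) = (1::ennreal)" for \<omega>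
  proof -
    have "(\<integral>\<^sup>+k. indicator cell (\<omega> - pt k) \<partial>count_space UNIV) = (\<integral>\<^sup>+k. indicator {fl \<omega>} k \<partial>count_space UNIV)"
      by (intro nn_integral_cong) (auto simp: indicator_def cell_def fl_diff_pt)
    then show ?thesis by simp
  qed
  have "(\<integral>\<^sup>+\<omega>. q \<omega> * v \<omega> \<partial>lborel)
      = (\<integral>\<^sup>+\<omega>. \<integral>\<^sup>+k. q \<omega> * v \<omega> * indicator cell (\<omega> - pt k) \<partial>count_space UNIV \<partial>lborel)"
    by (subst nn_integral_cmult) (auto simp: 1)
  also have "\<dots> = (\<integral>\<^sup>+k. \<integral>\<^sup>+\<omega>. q \<omega> * v \<omega> * indicator cell (\<omega> - pt k) \<partial>lborel \<partial>count_space UNIV)"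
    by (rule nn_integral_count_space_nn_integral) auto
  also have "\<dots> = (\<integral>\<^sup>+k. \<integral>\<^sup>+\<omega>. q \<omega> * v (\<omega> + pt k) * indicator cell \<omega> \<partial>lborel \<partial>count_space UNIV)"
  proof (rule nn_integral_cong)
    fix k :: "int^'d"
    show "(\<integral>\<^sup>+\<omega>. q \<omega> * v \<omega> * indicator cell (\<omega> - pt k) \<partial>lborel) = (\<integral>\<^sup>+\<omega>. q \<omega> * v (\<omega> + pt k) * indicator cell \<omega> \<partial>lborel)"
      by (subst nn_integral_lborel_translate[of _ "pt k", symmetric]) (auto simp: perD[OF q])
  qed
  also have "\<dots> = (\<integral>\<^sup>+\<omega>. \<integral>\<^sup>+k. q \<omega> * v (\<omega> + pt k) * indicator cell \<omega> \<partial>count_space UNIV \<partial>lborel)"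
    by (rule nn_integral_count_space_nn_integral[symmetric]) auto
  also have "\<dots> = (\<integral>\<^sup>+\<omega>. indicator cell \<omega> * (q \<omega> * (\<integral>\<^sup>+k. v (\<omega> + pt k) \<partial>count_space UNIV)) \<partial>lborel)"
    by (simp add: nn_integral_cmult nn_integral_multc mult_ac)
  also have "\<dots> = (\<integral>\<^sup>+\<omega>. q \<omega> * (\<integral>\<^sup>+k. v (\<omega> + pt k) \<partial>count_space UNIV) \<partial>cellm)"
  proof (rule nn_cellm[symmetric])
    have "(\<lambda>\<omega>. \<integral>\<^sup>+k. v (\<omega> + pt k) \<partial>count_space UNIV) \<in> borel_measurable borel"
      by (rule borel_measurable_nn_count_space) measurable
    then show "(\<lambda>\<omega>. q \<omega> * (\<integral>\<^sup>+k. v (\<omega> + pt k) \<partial>count_space UNIV)) \<in> borel_measurable borel"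
      by measurable
  qed
  finally show ?thesis .
qed

text \<open>A translated cell is again a fundamental domain: periodizing its indicator gives
  1.\<close>

lemma nn_cellm_translate:
  fixes q :: "real^'d \<Rightarrow> ennreal"
  assumes [measurable]: "q \<in> borel_measurable borel" and q: "per q"
  shows "(\<integral>\<^sup>+\<omega>. q (\<omega> + \<eta>) \<partial>cellm) = (\<integral>\<^sup>+\<omega>. q \<omega> \<partial>cellm)"
proof -
  have 1: "(\<integral>\<^sup>+k. indicator cell (\<omega> + pt k - \<eta>) \<partial>count_space UNIV) = (1::ennreal)" for \<omega>
  proof -
    have "fl (\<omega> + pt k - \<eta>) = fl (\<omega> - \<eta>) + k" for k
      using fl_add_pt[of "\<omega> - \<eta>" k] by (simp add: algebra_simps)
    then have "(\<integral>\<^sup>+k. indicator cell (\<omega> + pt k - \<eta>) \<partial>count_space UNIV)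
        = (\<integral>\<^sup>+k. indicator {- fl (\<omega> - \<eta>)} k \<partial>count_space UNIV)"
      by (intro nn_integral_cong) (auto simp: indicator_def cell_def add_eq_0_iff)
    then show ?thesis by simp
  qed
  have "(\<integral>\<^sup>+\<omega>. q (\<omega> + \<eta>) \<partial>cellm) = (\<integral>\<^sup>+\<omega>. indicator cell \<omega> * q (\<omega> + \<eta>) \<partial>lborel)"
    by (rule nn_cellm) measurable
  also have "\<dots> = (\<integral>\<^sup>+\<omega>. q \<omega> * indicator cell (\<omega> - \<eta>) \<partial>lborel)"
    by (subst nn_integral_lborel_translate[of _ \<eta>, symmetric]) (auto simp: mult.commute)
  also have "\<dots> = (\<integral>\<^sup>+\<omega>. q \<omega> * (\<integral>\<^sup>+k. indicator cell (\<omega> + pt k - \<eta>) \<partial>count_space UNIV) \<partial>cellm)"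
    by (rule periodize[OF _ _ q]) measurable
  finally show ?thesis by (simp add: 1)
qed

definition covol :: real where "covol = measure lborel cell"

lemma cell_subset: "cell \<subseteq> (*v) T ` cbox 0 1"
proof
  fix \<omega> assume "\<omega> \<in> cell"
  then have "\<lfloor>(S *v \<omega>) $ i\<rfloor> = 0" for i by (auto simp: cell_def fl_def vec_eq_iff)
  then have "0 \<le> (S *v \<omega>) $ i \<and> (S *v \<omega>) $ i < 1" for i by (simp add: floor_eq_iff)
  then have "S *v \<omega> \<in> cbox 0 1" by (auto simp: mem_box_cart less_imp_le)
  then show "\<omega> \<in> (*v) T ` cbox 0 1" by (metis TS_v imageI)
qed

lemma compact_fundamental: "compact ((*v) T ` cbox 0 1)"
  by (intro compact_continuous_image continuous_intros) auto

lemma cell_bounded: "bounded cell"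
  by (rule bounded_subset[OF compact_imp_bounded[OF compact_fundamental] cell_subset])

lemma emeasure_cell_finite: "emeasure lborel cell < \<infinity>"
  using emeasure_bounded_finite[OF cell_bounded] by simp

lemma emeasure_cell: "emeasure lborel cell = ennreal covol"
  unfolding covol_def using emeasure_cell_finite by (intro emeasure_eq_ennreal_measure) auto

lemma emeasure_cellm: "emeasure cellm UNIV = ennreal covol"
  using nn_cellm[of "\<lambda>_. 1"] by (simp add: emeasure_cell)

lemma finite_cellm: "finite_measure cellm"
  by (rule finite_measureI) (simp add: emeasure_cellm)

text \<open>If the cell were null, periodizing the constant 1 would make the whole space
  null.\<close>

lemma covol_pos: "covol > 0"
proof (rule ccontr)
  assume "\<not> covol > 0"
  then have "emeasure cellm UNIV = 0" by (simp add: emeasure_cellm ennreal_neg)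
  then have "AE \<omega> in cellm. False" by (intro AE_I[where N = UNIV]) auto
  then have z: "(\<integral>\<^sup>+\<omega>. h \<omega> \<partial>cellm) = 0" for h :: "_ \<Rightarrow> ennreal"
  proof -
    have "AE \<omega> in cellm. h \<omega> = 0" using \<open>AE \<omega> in cellm. False\<close> by eventually_elim simp
    then show ?thesis using nn_integral_cong_AE[of h "\<lambda>_. 0" cellm] by simp
  qed
  have "emeasure lborel (UNIV :: (real^'d) set) = (\<integral>\<^sup>+\<omega>. 1 * 1 \<partial>(lborel :: (real^'d) measure))"
    by simp
  also have "\<dots> = (\<integral>\<^sup>+\<omega>. 1 * (\<integral>\<^sup>+k. 1 \<partial>count_space (UNIV :: (int^'d) set)) \<partial>cellm)"
    by (rule periodize) (auto simp: per_def)
  also have "\<dots> = 0" by (rule z)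
  finally show False by simp
qed

section \<open>Characters trivial on the lattice and their orthogonality\<close>

lemma chr_add_arg: "chr k (\<omega> + \<eta>) = chr k \<omega> * chr k \<eta>"
  by (simp add: chr_def matrix_vector_right_distrib inner_add_right distrib_left cis_mult)

lemma chr_add: "chr (k + l) \<omega> = chr k \<omega> * chr l \<omega>"
  by (simp add: chr_def rvec_add inner_add_left distrib_left cis_mult)

lemma chr_minus: "chr (- k) \<omega> = cnj (chr k \<omega>)"
  by (simp add: chr_def rvec_minus cis_cnj)

lemma chr_diff: "chr (k - l) \<omega> = chr k \<omega> * cnj (chr l \<omega>)"
  using chr_add[of k "- l" \<omega>] by (simp add: chr_minus)

lemma chr_0 [simp]: "chr 0 \<omega> = 1" and chr_arg_0 [simp]: "chr k 0 = 1"
  by (simp_all add: chr_def)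

lemma cmod_chr [simp]: "cmod (chr k \<omega>) = 1"
  by (simp add: chr_def)

lemma chr_pt [simp]: "chr k (pt l) = 1"
  unfolding chr_def pt_def by (simp add: cis_2pi_Ints rvec_inner_Ints)

lemma per_chr: "per (chr k)"
  by (simp add: per_def chr_add_arg)

lemma chr_continuous: "continuous_on A (chr k)"
  unfolding chr_def[abs_def] cis_conv_exp by (intro continuous_intros)

lemma chr_measurable [measurable]: "chr k \<in> borel_measurable borel"
  by (rule borel_measurable_continuous_onI[OF chr_continuous])

lemma sq_int_bounded_cellm:
  assumes "f \<in> borel_measurable borel" "\<And>\<omega>. cmod (f \<omega>) \<le> C"
  shows "sq_int cellm f"
proof -
  interpret finite_measure cellm by (rule finite_cellm)
  have "sq_int cellm (\<lambda>_. 1)" by (simp add: sq_int_def)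
  from sq_int_mult_bounded[OF this, of f C] assms show ?thesis by simp
qed

lemma sq_int_chr: "sq_int cellm (chr k)"
  by (rule sq_int_bounded_cellm[of _ 1]) auto

text \<open>Stated for measures, periodization applies to nonnegative and to complex integrands alike.\<close>

lemma distr_red:
  assumes [measurable]: "v \<in> borel_measurable borel"
  shows "distr (density lborel v) borel red
       = density cellm (\<lambda>\<omega>. \<integral>\<^sup>+k. v (\<omega> + pt k) \<partial>count_space UNIV)"
proof (rule measure_eqI)
  fix A assume "A \<in> sets (distr (density lborel v) borel red)"
  then have [measurable]: "A \<in> sets borel" by simp
  have V: "(\<lambda>\<omega>. \<integral>\<^sup>+k. v (\<omega> + pt k) \<partial>count_space UNIV) \<in> borel_measurable cellm"
    by (rule borel_measurable_nn_count_space) measurable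
  have "emeasure (distr (density lborel v) borel red) A = emeasure (density lborel v) (red -` A)"
    by (subst emeasure_distr) auto
  also have "\<dots> = (\<integral>\<^sup>+\<omega>. v \<omega> * indicator (red -` A) \<omega> \<partial>lborel)"
    using measurable_sets[OF red_measurable \<open>A \<in> sets borel\<close>] by (intro emeasure_density) auto
  also have "\<dots> = (\<integral>\<^sup>+\<omega>. indicator A (red \<omega>) * v \<omega> \<partial>lborel)"
    by (simp add: mult.commute indicator_def)
  also have "\<dots> = (\<integral>\<^sup>+\<omega>. indicator A (red \<omega>) * (\<integral>\<^sup>+k. v (\<omega> + pt k) \<partial>count_space UNIV) \<partial>cellm)"
    by (rule periodize) (auto simp: per_def perD[OF per_red'])
  also have "\<dots> = (\<integral>\<^sup>+\<omega>. (\<integral>\<^sup>+k. v (\<omega> + pt k) \<partial>count_space UNIV) * indicator A \<omega> \<partial>cellm)"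
    by (rule nn_integral_cong_AE) (use AE_cellm_cell in eventually_elim, simp add: red_cell mult.commute)
  also have "\<dots> = emeasure (density cellm (\<lambda>\<omega>. \<integral>\<^sup>+k. v (\<omega> + pt k) \<partial>count_space UNIV)) A"
    by (rule emeasure_density[symmetric]) (use V in auto)
  finally show "emeasure (distr (density lborel v) borel red) A
     = emeasure (density cellm (\<lambda>\<omega>. \<integral>\<^sup>+k. v (\<omega> + pt k) \<partial>count_space UNIV)) A" .
qed simp

text \<open>Translation invariance as an equality of measures; it passes to Bochner integrals of
  periodic functions by change of variables.\<close>

lemma distr_red_translate: "distr (distr cellm borel (\<lambda>\<omega>. \<omega> + \<eta>)) borel red = cellm"
proof (rule measure_eqI)
  fix A assume "A \<in> sets (distr (distr cellm borel (\<lambda>\<omega>. \<omega> + \<eta>)) borel red)"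
  then have [measurable]: "A \<in> sets borel" by simp
  have "emeasure (distr (distr cellm borel (\<lambda>\<omega>. \<omega> + \<eta>)) borel red) A
     = (\<integral>\<^sup>+\<omega>. indicator A \<omega> \<partial>(distr (distr cellm borel (\<lambda>\<omega>. \<omega> + \<eta>)) borel red))"
    by (rule nn_integral_indicator[symmetric]) auto
  also have "\<dots> = (\<integral>\<^sup>+\<omega>. indicator A (red (\<omega> + \<eta>)) \<partial>cellm)"
    by (simp add: nn_integral_distr del: nn_integral_indicator)
  also have "\<dots> = (\<integral>\<^sup>+\<omega>. indicator A (red \<omega>) \<partial>cellm)"
    by (rule nn_cellm_translate[where q = "\<lambda>\<omega>. indicator A (red \<omega>)"]) (auto simp: per_def perD[OF per_red'])
  also have "\<dots> = (\<integral>\<^sup>+\<omega>. indicator A \<omega> \<partial>cellm)"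
    by (rule nn_integral_cong_AE) (use AE_cellm_cell in eventually_elim, simp add: red_cell)
  finally show "emeasure (distr (distr cellm borel (\<lambda>\<omega>. \<omega> + \<eta>)) borel red) A = emeasure cellm A"
    by simp
qed simp

lemma integral_cellm_translate:
  fixes q :: "real^'d \<Rightarrow> 'b::{banach, second_countable_topology}"
  assumes [measurable]: "q \<in> borel_measurable borel" and q: "per q"
  shows "(\<integral>\<omega>. q (\<omega> + \<eta>) \<partial>cellm) = (\<integral>\<omega>. q \<omega> \<partial>cellm)"
proof -
  have "(\<integral>\<omega>. q \<omega> \<partial>cellm) = (\<integral>\<omega>. q \<omega> \<partial>distr (distr cellm borel (\<lambda>\<omega>. \<omega> + \<eta>)) borel red)"
    by (simp only: distr_red_translate)
  also have "\<dots> = (\<integral>\<omega>. q (red (\<omega> + \<eta>)) \<partial>cellm)"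
    by (simp add: integral_distr)
  finally show ?thesis by (simp add: per_red[OF q])
qed

lemma integrable_cellm_translate:
  fixes q :: "real^'d \<Rightarrow> 'b::{banach, second_countable_topology}"
  assumes [measurable]: "q \<in> borel_measurable borel" and q: "per q"
  shows "integrable cellm (\<lambda>\<omega>. q (\<omega> + \<eta>)) \<longleftrightarrow> integrable cellm q"
proof -
  have "integrable cellm q \<longleftrightarrow> integrable (distr (distr cellm borel (\<lambda>\<omega>. \<omega> + \<eta>)) borel red) q"
    by (simp only: distr_red_translate)
  also have "\<dots> \<longleftrightarrow> integrable cellm (\<lambda>\<omega>. q (red (\<omega> + \<eta>)))"
    by (simp add: integrable_distr_eq)
  finally show ?thesis by (simp add: per_red[OF q])
qed

lemma integral_chr:
  assumes "k \<noteq> 0"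
  shows "(\<integral>\<omega>. chr k \<omega> \<partial>cellm) = 0"
proof -
  obtain i where i: "k $ i \<noteq> 0" using assms by (auto simp: vec_eq_iff)
  \<comment> \<open>Half a period in a coordinate where \<open>k\<close> is nonzero: shifting by it
    changes the sign of the character but not its integral.\<close>
  define \<eta> where "\<eta> = T *v axis i (1 / (2 * real_of_int (k $ i)))"
  have "chr k \<eta> = cis pi"
    using i by (simp add: chr_def \<eta>_def inner_axis)
  then have \<eta>: "chr k \<eta> = -1" by simp
  have "(\<integral>\<omega>. chr k \<omega> \<partial>cellm) = (\<integral>\<omega>. chr k (\<omega> + \<eta>) \<partial>cellm)"
    by (rule integral_cellm_translate[symmetric]) (auto simp: per_chr)
  also have "\<dots> = - (\<integral>\<omega>. chr k \<omega> \<partial>cellm)"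
    by (simp add: chr_add_arg \<eta>)
  finally show ?thesis by simp
qed

lemma ip_chr: "ip cellm (chr k) (chr l) = (if k = l then of_real covol else 0)"
proof -
  have "ip cellm (chr k) (chr l) = (\<integral>\<omega>. chr (k - l) \<omega> \<partial>cellm)"
    by (simp add: ip_def chr_diff)
  moreover have "(\<integral>\<omega>. (1::complex) \<partial>cellm) = of_real covol"
    using covol_pos by (simp add: measure_def emeasure_cellm scaleR_conv_of_real)
  ultimately show ?thesis using integral_chr[of "k - l"] by auto
qed

section \<open>Fourier series on a cell\<close>

text \<open>An inductive definition makes closure under products, needed for Stone--Weierstrass, a
  matter of induction; \<open>trig_sum\<close> recovers finite sums of characters.\<close>

inductive trig :: "(real^'d \<Rightarrow> complex) \<Rightarrow> bool" where
  trig_chr: "trig (chr k)"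
| trig_add: "trig P \<Longrightarrow> trig Q \<Longrightarrow> trig (\<lambda>\<omega>. P \<omega> + Q \<omega>)"
| trig_cmult: "trig P \<Longrightarrow> trig (\<lambda>\<omega>. c * P \<omega>)"

lemma trig_const: "trig (\<lambda>\<omega>. c)"
  using trig_cmult[OF trig_chr[of 0], of c] by simp

lemma trig_mult:
  assumes "trig P" "trig Q"
  shows "trig (\<lambda>\<omega>. P \<omega> * Q \<omega>)"
  using assms(1)
proof (induction P rule: trig.induct)
  case (trig_chr k)
  show ?case
    using assms(2)
  proof (induction Q rule: trig.induct)
    case (trig_chr l)
    then show ?case using trig.trig_chr[of "k + l"] by (simp add: chr_add[abs_def])
  next
    case (trig_add P Q)
    then show ?case using trig.trig_add by (fastforce simp: distrib_left)
  next
    case (trig_cmult P c)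
    then show ?case using trig.trig_cmult[OF trig_cmult.IH, of c] by (simp add: mult_ac)
  qed
next
  case (trig_add P P')
  then show ?case using trig.trig_add by (fastforce simp: distrib_right)
next
  case (trig_cmult P c)
  then show ?case using trig.trig_cmult[OF trig_cmult.IH, of c] by (simp add: mult_ac)
qed

lemma trig_sum:
  assumes "trig P"
  shows "\<exists>K c. finite K \<and> P = (\<lambda>\<omega>. \<Sum>k\<in>K. c k * chr k \<omega>)"
  using assms
proof (induction P rule: trig.induct)
  case (trig_chr k)
  show ?case by (rule exI[of _ "{k}"], rule exI[of _ "\<lambda>_. 1"]) simp
next
  case (trig_add P Q)
  then obtain K c L b where *: "finite K" "P = (\<lambda>\<omega>. \<Sum>k\<in>K. c k * chr k \<omega>)"
    "finite L" "Q = (\<lambda>\<omega>. \<Sum>k\<in>L. b k * chr k \<omega>)" by blast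
  have "P \<omega> + Q \<omega> = (\<Sum>k\<in>K \<union> L. ((if k \<in> K then c k else 0) + (if k \<in> L then b k else 0)) * chr k \<omega>)" for \<omega>
  proof -
    have "(\<Sum>k\<in>K \<union> L. (if k \<in> K then c k else 0) * chr k \<omega>) = P \<omega>"
      using * by (auto intro!: sum.mono_neutral_cong_right)
    moreover have "(\<Sum>k\<in>K \<union> L. (if k \<in> L then b k else 0) * chr k \<omega>) = Q \<omega>"
      using * by (auto intro!: sum.mono_neutral_cong_right)
    ultimately show ?thesis by (simp add: distrib_right sum.distrib)
  qed
  then have "finite (K \<union> L) \<and> (\<lambda>\<omega>. P \<omega> + Q \<omega>)
      = (\<lambda>\<omega>. \<Sum>k\<in>K \<union> L. ((if k \<in> K then c k else 0) + (if k \<in> L then b k else 0)) * chr k \<omega>)"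
    using * by auto
  then show ?case by (intro exI)
next
  case (trig_cmult P c)
  then obtain K b where "finite K" "P = (\<lambda>\<omega>. \<Sum>k\<in>K. b k * chr k \<omega>)" by blast
  then have "finite K \<and> (\<lambda>\<omega>. c * P \<omega>) = (\<lambda>\<omega>. \<Sum>k\<in>K. (c * b k) * chr k \<omega>)"
    by (simp add: sum_distrib_left mult.assoc)
  then show ?case by (intro exI)
qed

lemma sq_int_trig_sum: "sq_int cellm (\<lambda>\<omega>. \<Sum>k\<in>K. c k * chr k \<omega>)"
  by (intro sq_int_sum sq_int_cmult sq_int_chr)

lemma sq_int_trig: "trig P \<Longrightarrow> sq_int cellm P"
  using trig_sum sq_int_trig_sum by blast

text \<open>The closure of the trigonometric polynomials in the square-integrable functions on the
  cell. The lemmas up to \<open>trig_dense\<close> show that it is everything.\<close>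

definition trig_approx :: "(real^'d \<Rightarrow> complex) \<Rightarrow> bool" where
  "trig_approx F \<longleftrightarrow> sq_int cellm F \<and> (\<forall>\<epsilon>>0. \<exists>P. trig P \<and> nsq cellm (\<lambda>\<omega>. F \<omega> - P \<omega>) < \<epsilon>)"

lemma trig_approx_sq_int: "trig_approx F \<Longrightarrow> sq_int cellm F"
  by (simp add: trig_approx_def)

lemma trig_approx_trig: "trig P \<Longrightarrow> trig_approx P"
  unfolding trig_approx_def using sq_int_trig by (auto intro!: exI[of _ P] simp: nsq_def)

lemma trig_approx_closed:
  assumes F: "sq_int cellm F" and G: "\<And>\<epsilon>. \<epsilon> > 0 \<Longrightarrow> \<exists>G. trig_approx G \<and> nsq cellm (\<lambda>\<omega>. F \<omega> - G \<omega>) < \<epsilon>"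
  shows "trig_approx F"
  unfolding trig_approx_def
proof (intro conjI F allI impI)
  fix \<epsilon> :: real assume "\<epsilon> > 0"
  \<comment> \<open>The quarter compensates the factor 2 in \<open>nsq_add_le\<close>, for each of
    two errors.\<close>
  then obtain G where G: "trig_approx G" "nsq cellm (\<lambda>\<omega>. F \<omega> - G \<omega>) < \<epsilon> / 4"
    using G[of "\<epsilon> / 4"] by auto
  then obtain P where P: "trig P" "nsq cellm (\<lambda>\<omega>. G \<omega> - P \<omega>) < \<epsilon> / 4"
    using \<open>\<epsilon> > 0\<close> unfolding trig_approx_def by (meson divide_pos_pos zero_less_numeral)
  have "nsq cellm (\<lambda>\<omega>. (F \<omega> - G \<omega>) + (G \<omega> - P \<omega>)) \<le> 2 * nsq cellm (\<lambda>\<omega>. F \<omega> - G \<omega>) + 2 * nsq cellm (\<lambda>\<omega>. G \<omega> - P \<omega>)"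
    by (rule nsq_add_le[OF sq_int_diff[OF F trig_approx_sq_int[OF G(1)]]
          sq_int_diff[OF trig_approx_sq_int[OF G(1)] sq_int_trig[OF P(1)]]])
  then show "\<exists>P. trig P \<and> nsq cellm (\<lambda>\<omega>. F \<omega> - P \<omega>) < \<epsilon>"
    using G P by (auto intro!: exI[of _ P])
qed

lemma trig_approx_add:
  assumes "trig_approx F" "trig_approx G"
  shows "trig_approx (\<lambda>\<omega>. F \<omega> + G \<omega>)"
  unfolding trig_approx_def
proof (intro conjI allI impI)
  show "sq_int cellm (\<lambda>\<omega>. F \<omega> + G \<omega>)" using assms by (intro sq_int_add trig_approx_sq_int)
  fix \<epsilon> :: real assume "\<epsilon> > 0"
  then have e: "\<epsilon> / 4 > 0" by simp
  obtain P where P: "trig P" "nsq cellm (\<lambda>\<omega>. F \<omega> - P \<omega>) < \<epsilon> / 4"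
    using assms(1) e unfolding trig_approx_def by blast
  obtain Q where Q: "trig Q" "nsq cellm (\<lambda>\<omega>. G \<omega> - Q \<omega>) < \<epsilon> / 4"
    using assms(2) e unfolding trig_approx_def by blast
  have "nsq cellm (\<lambda>\<omega>. (F \<omega> - P \<omega>) + (G \<omega> - Q \<omega>)) \<le> 2 * nsq cellm (\<lambda>\<omega>. F \<omega> - P \<omega>) + 2 * nsq cellm (\<lambda>\<omega>. G \<omega> - Q \<omega>)"
    using assms P Q by (intro nsq_add_le sq_int_diff trig_approx_sq_int sq_int_trig)
  then have "nsq cellm (\<lambda>\<omega>. F \<omega> + G \<omega> - (P \<omega> + Q \<omega>)) < \<epsilon>"
    using P Q by (simp add: algebra_simps)
  then show "\<exists>P. trig P \<and> nsq cellm (\<lambda>\<omega>. F \<omega> + G \<omega> - P \<omega>) < \<epsilon>"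
    using trig_add[OF P(1) Q(1)] by blast
qed

lemma trig_approx_cmult:
  assumes "trig_approx F"
  shows "trig_approx (\<lambda>\<omega>. c * F \<omega>)"
  unfolding trig_approx_def
proof (intro conjI allI impI)
  show "sq_int cellm (\<lambda>\<omega>. c * F \<omega>)" using assms by (intro sq_int_cmult trig_approx_sq_int)
  fix \<epsilon> :: real assume "\<epsilon> > 0"
  have p: "(cmod c)\<^sup>2 + 1 > 0" by (simp add: add_nonneg_pos)
  with \<open>\<epsilon> > 0\<close> obtain P where P: "trig P" "nsq cellm (\<lambda>\<omega>. F \<omega> - P \<omega>) < \<epsilon> / ((cmod c)\<^sup>2 + 1)"
    using assms unfolding trig_approx_def by (meson divide_pos_pos)
  have "nsq cellm (\<lambda>\<omega>. c * F \<omega> - c * P \<omega>) = (cmod c)\<^sup>2 * nsq cellm (\<lambda>\<omega>. F \<omega> - P \<omega>)"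
    by (simp add: nsq_cmult[symmetric] right_diff_distrib)
  also have "\<dots> \<le> ((cmod c)\<^sup>2 + 1) * nsq cellm (\<lambda>\<omega>. F \<omega> - P \<omega>)"
    by (intro mult_right_mono) auto
  also have "\<dots> < \<epsilon>" using P(2) p by (simp add: pos_less_divide_eq mult.commute)
  finally show "\<exists>P. trig P \<and> nsq cellm (\<lambda>\<omega>. c * F \<omega> - P \<omega>) < \<epsilon>"
    using trig_cmult[OF P(1)] by blast
qed

lemma trig_approx_cong_AE:
  assumes "trig_approx F" "G \<in> borel_measurable borel" "AE \<omega> in cellm. F \<omega> = G \<omega>"
  shows "trig_approx G"
proof (rule trig_approx_closed)
  show G: "sq_int cellm G"
    using sq_int_cong_AE[OF trig_approx_sq_int[OF assms(1)] _ assms(3)] assms(2) by simp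
  fix \<epsilon> :: real assume "\<epsilon> > 0"
  have "nsq cellm (\<lambda>\<omega>. G \<omega> - F \<omega>) = nsq cellm (\<lambda>\<omega>. 0)"
    by (rule nsq_cong_AE) (use assms G trig_approx_sq_int[OF assms(1)] in auto)
  then show "\<exists>F. trig_approx F \<and> nsq cellm (\<lambda>\<omega>. G \<omega> - F \<omega>) < \<epsilon>"
    using assms(1) \<open>\<epsilon> > 0\<close> by (intro exI[of _ F]) (simp add: nsq_def)
qed

text \<open>Dominated convergence of the squared differences, which are at most 4 |G|^2. This is the
  limit step both for sets and for functions below.\<close>

lemma trig_approx_dominated:
  fixes F :: "nat \<Rightarrow> real^'d \<Rightarrow> complex"
  assumes F: "\<And>m. trig_approx (F m)" and f: "f \<in> borel_measurable borel" and G: "sq_int cellm G"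
    and dom: "\<And>m \<omega>. cmod (F m \<omega>) \<le> cmod (G \<omega>)" and lim: "\<And>\<omega>. (\<lambda>m. F m \<omega>) \<longlonglongrightarrow> f \<omega>"
  shows "trig_approx f"
proof (rule trig_approx_closed)
  have fG: "cmod (f \<omega>) \<le> cmod (G \<omega>)" for \<omega>
    by (rule Lim_norm_ubound[OF _ lim]) (use dom in auto)
  show sf: "sq_int cellm f"
    by (rule sq_int_bound[OF G, of _ 1]) (use fG f in auto)
  fix \<epsilon> :: real assume "\<epsilon> > 0"
  have "(\<lambda>m. nsq cellm (\<lambda>\<omega>. f \<omega> - F m \<omega>)) \<longlonglongrightarrow> (\<integral>\<omega>. 0 \<partial>cellm)"
    unfolding nsq_def
  proof (rule integral_dominated_convergence)
    show "integrable cellm (\<lambda>\<omega>. 4 * (cmod (G \<omega>))\<^sup>2)" using sq_int_integrable[OF G] by simp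
    show "(\<lambda>\<omega>. (cmod (f \<omega> - F m \<omega>))\<^sup>2) \<in> borel_measurable cellm" for m
      using sf trig_approx_sq_int[OF F[of m]] by measurable
    show "AE \<omega> in cellm. (\<lambda>m. (cmod (f \<omega> - F m \<omega>))\<^sup>2) \<longlonglongrightarrow> 0"
    proof (rule AE_I2)
      fix \<omega>
      have "(\<lambda>m. (cmod (f \<omega> - F m \<omega>))\<^sup>2) \<longlonglongrightarrow> (cmod (f \<omega> - f \<omega>))\<^sup>2"
        by (intro tendsto_intros lim)
      then show "(\<lambda>m. (cmod (f \<omega> - F m \<omega>))\<^sup>2) \<longlonglongrightarrow> 0" by simp
    qed
    show "AE \<omega> in cellm. norm ((cmod (f \<omega> - F m \<omega>))\<^sup>2) \<le> 4 * (cmod (G \<omega>))\<^sup>2" for m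
    proof (rule AE_I2)
      fix \<omega>
      have "cmod (f \<omega> - F m \<omega>) \<le> 2 * cmod (G \<omega>)"
        using norm_triangle_ineq4[of "f \<omega>" "F m \<omega>"] fG[of \<omega>] dom[of m \<omega>] by linarith
      then have "(cmod (f \<omega> - F m \<omega>))\<^sup>2 \<le> (2 * cmod (G \<omega>))\<^sup>2" by (rule power_mono) simp
      then show "norm ((cmod (f \<omega> - F m \<omega>))\<^sup>2) \<le> 4 * (cmod (G \<omega>))\<^sup>2"
        by (simp add: power_mult_distrib)
    qed
  qed simp
  then have "\<exists>m. nsq cellm (\<lambda>\<omega>. f \<omega> - F m \<omega>) < \<epsilon>"
    using order_tendstoD(2)[of _ 0 sequentially \<epsilon>] \<open>\<epsilon> > 0\<close> by (fastforce simp: eventually_sequentially)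
  then show "\<exists>H. trig_approx H \<and> nsq cellm (\<lambda>\<omega>. f \<omega> - H \<omega>) < \<epsilon>"
    using F by blast
qed

text \<open>The cell is identified with the torus \<open>range tor\<close>, where the Stone--Weierstrass theorem applies.\<close>

definition tor :: "real^'d \<Rightarrow> complex^'d" where "tor \<omega> = (\<chi> i. chr (axis i 1) \<omega>)"

lemma tor_continuous: "continuous_on A tor"
  unfolding tor_def[abs_def] by (intro continuous_intros chr_continuous)

lemma tor_measurable [measurable]: "tor \<in> borel_measurable borel"
  by (rule borel_measurable_continuous_onI[OF tor_continuous])

lemma per_tor: "per tor"
  by (simp add: per_def tor_def chr_add_arg)

lemma compact_torus: "compact (range tor)"
proof -
  have "range tor = tor ` ((*v) T ` cbox 0 1)"
  proof -
    have "tor \<omega> \<in> tor ` ((*v) T ` cbox 0 1)" for \<omega>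
      using per_red[OF per_tor, of \<omega>] cell_subset red_in_cell[of \<omega>] by (metis image_eqI subsetD)
    then show ?thesis by auto
  qed
  then show ?thesis
    by (simp only: compact_continuous_image[OF tor_continuous compact_fundamental])
qed

text \<open>The version of Stone--Weierstrass used concerns real functions, so the real and
  imaginary parts of the torus coordinates take the place of the characters as generators.\<close>

lemma trig_Re: "trig (\<lambda>\<omega>. of_real (Re (chr k \<omega>)))"
proof -
  have "(\<lambda>\<omega>. complex_of_real (Re (chr k \<omega>))) = (\<lambda>\<omega>. (1/2) * (chr k \<omega> + chr (- k) \<omega>))"
    by (simp add: chr_minus complex_add_cnj)
  then show ?thesis by (simp only: trig_cmult trig_add trig_chr)
qed

lemma trig_Im: "trig (\<lambda>\<omega>. of_real (Im (chr k \<omega>)))"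
proof -
  have "(\<lambda>\<omega>. complex_of_real (Im (chr k \<omega>))) = (\<lambda>\<omega>. (- \<i> / 2) * (chr k \<omega> + (-1) * chr (- k) \<omega>))"
    by (simp add: chr_minus complex_eq_iff fun_eq_iff)
  then show ?thesis by (simp only: trig_cmult trig_add trig_chr)
qed

text \<open>Two distinct points of the torus differ in some coordinate, hence in its real or
  imaginary part.\<close>

lemma torus_function_ring:
  "function_ring_on {h. continuous_on (range tor) h \<and> trig (\<lambda>\<omega>. of_real (h (tor \<omega>)))} (range tor)"
proof
  show "compact (range tor)" by (rule compact_torus)
  fix x y :: "complex^'d"
  assume "x \<in> range tor" "y \<in> range tor" "x \<noteq> y"
  then obtain \<omega> \<eta> i where xy: "x = tor \<omega>" "y = tor \<eta>" "x $ i \<noteq> y $ i" by (auto simp: vec_eq_iff)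
  let ?R = "{h. continuous_on (range tor) h \<and> trig (\<lambda>\<omega>. complex_of_real (h (tor \<omega>)))}"
  have "(\<lambda>z. Re (z $ i)) \<in> ?R" "(\<lambda>z. Im (z $ i)) \<in> ?R"
    using trig_Re[of "axis i 1"] trig_Im[of "axis i 1"] by (auto intro!: continuous_intros simp: tor_def)
  note R = this
  have "Re (x $ i) \<noteq> Re (y $ i) \<or> Im (x $ i) \<noteq> Im (y $ i)"
    using xy(3) by (auto simp: complex_eq_iff)
  then show "\<exists>h\<in>?R. h x \<noteq> h y"
  proof
    assume "Re (x $ i) \<noteq> Re (y $ i)"
    then show ?thesis by (rule bexI[OF _ R(1)])
  next
    assume "Im (x $ i) \<noteq> Im (y $ i)"
    then show ?thesis by (rule bexI[OF _ R(2)])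
  qed
next
  fix h k :: "complex^'d \<Rightarrow> real"
  let ?R = "{h. continuous_on (range tor) h \<and> trig (\<lambda>\<omega>. complex_of_real (h (tor \<omega>)))}"
  assume "h \<in> ?R" "k \<in> ?R"
  then show "(\<lambda>x. h x + k x) \<in> ?R" "(\<lambda>x. h x * k x) \<in> ?R"
    by (simp_all add: continuous_on_add continuous_on_mult trig_add trig_mult)
qed (simp_all add: trig_const)

lemma chr_0_fun: "chr 0 = (\<lambda>_. 1)"
  by auto

lemma sq_int_cellm_1: "sq_int cellm (\<lambda>\<omega>. 1)"
  using sq_int_chr[of 0] by (simp only: chr_0_fun)

lemma nsq_chr: "nsq cellm (chr k) = covol"
proof -
  have "complex_of_real (nsq cellm (chr k)) = of_real covol"
    by (simp add: nsq_ip ip_chr)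
  then show ?thesis by (simp only: of_real_eq_iff)
qed

lemma trig_approx_continuous:
  fixes h :: "complex^'d \<Rightarrow> real"
  assumes h: "continuous_on UNIV h"
  shows "trig_approx (\<lambda>\<omega>. of_real (h (tor \<omega>)))"
  unfolding trig_approx_def
proof (intro conjI allI impI)
  have h': "continuous_on (range tor) h" using h continuous_on_subset by blast
  have "bounded (h ` range tor)"
    by (intro compact_imp_bounded compact_continuous_image[OF h' compact_torus])
  then obtain C where C: "\<And>\<omega>. \<bar>h (tor \<omega>)\<bar> \<le> C" by (auto simp: bounded_iff)
  have hm: "h \<in> borel_measurable borel" using h by (rule borel_measurable_continuous_onI)
  show s: "sq_int cellm (\<lambda>\<omega>. of_real (h (tor \<omega>)))"
    by (rule sq_int_bounded_cellm[of _ C]) (use C hm in auto)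
  fix \<epsilon> :: real assume e: "\<epsilon> > 0"
  \<comment> \<open>A uniform error \<delta> costs \<delta>^2 times the volume of the cell, which is
    half of \<epsilon>.\<close>
  define \<delta> where "\<delta> = sqrt (\<epsilon> / (2 * covol))"
  have "\<delta> > 0" using e covol_pos by (simp add: \<delta>_def)
  then obtain k where k: "continuous_on (range tor) k" "trig (\<lambda>\<omega>. of_real (k (tor \<omega>)))"
    "\<forall>x\<in>range tor. \<bar>h x - k x\<bar> < \<delta>"
    using function_ring_on.Stone_Weierstrass_basic[OF torus_function_ring h'] by blast
  have "nsq cellm (\<lambda>\<omega>. of_real (h (tor \<omega>)) - of_real (k (tor \<omega>))) \<le> nsq cellm (\<lambda>\<omega>. of_real \<delta> * chr 0 \<omega>)"
  proof (rule nsq_mono)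
    show "sq_int cellm (\<lambda>\<omega>. of_real \<delta> * chr 0 \<omega>)" by (intro sq_int_cmult sq_int_chr)
    show "(\<lambda>\<omega>. complex_of_real (h (tor \<omega>)) - complex_of_real (k (tor \<omega>))) \<in> borel_measurable cellm"
      using sq_int_diff[OF s sq_int_trig[OF k(2)]] by measurable
    show "AE \<omega> in cellm. cmod (complex_of_real (h (tor \<omega>)) - complex_of_real (k (tor \<omega>))) \<le> cmod (of_real \<delta> * chr 0 \<omega>)"
      using k(3) \<open>\<delta> > 0\<close> by (auto simp: of_real_diff[symmetric] less_imp_le simp del: of_real_diff)
  qed
  also have "\<dots> = \<delta>\<^sup>2 * covol"
    by (simp only: nsq_cmult nsq_chr) simp
  also have "\<dots> = \<epsilon> / 2" using e covol_pos by (simp add: \<delta>_def)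
  also have "\<dots> < \<epsilon>" using e by simp
  finally show "\<exists>P. trig P \<and> nsq cellm (\<lambda>\<omega>. of_real (h (tor \<omega>)) - P \<omega>) < \<epsilon>"
    using k(2) by blast
qed

text \<open>Dynkin's argument from the open sets, whose indicators are increasing limits of
  continuous functions of the distance to the complement.\<close>

lemma trig_approx_tor_indicator:
  fixes Y :: "(complex^'d) set"
  assumes Y: "Y \<in> sets borel"
  shows "trig_approx (\<lambda>\<omega>. indicator Y (tor \<omega>))"
proof -
  have meas: "(\<lambda>\<omega>. indicator Y (tor \<omega>) :: complex) \<in> borel_measurable borel" if "Y \<in> sets borel" for Y
    using that by measurable
  have Y': "Y \<in> sigma_sets UNIV (Collect open)" using Y by (simp add: borel_def)
  show ?thesis
  proof (rule sigma_sets_induct_disjoint[OF _ _ Y'])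
    show "Int_stable (Collect (open :: (complex^'d) set \<Rightarrow> bool))" by (auto simp: Int_stable_def)
    show "Collect open \<subseteq> Pow (UNIV :: (complex^'d) set)" by simp
  next
    fix A :: "(complex^'d) set" assume "A \<in> Collect open"
    then have A: "open A" by simp
    show "trig_approx (\<lambda>\<omega>. indicator A (tor \<omega>))"
    \<comment> \<open>The distance to the empty set is 0 in HOL, so the approximants below would
      vanish identically for the whole space.\<close>
    proof (cases "A = UNIV")
      case True
      then show ?thesis using trig_approx_trig[OF trig_const[of 1]] by simp
    next
      case False
      define h where "h m z = min 1 (real m * infdist z (- A))" for m z
      have h0: "0 \<le> h m z" for m z by (simp add: h_def infdist_nonneg)
      show ?thesis
      proof (rule trig_approx_dominated[where F = "\<lambda>m \<omega>. of_real (h m (tor \<omega>))", OF _ _ sq_int_cellm_1])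
        show "trig_approx (\<lambda>\<omega>. of_real (h m (tor \<omega>)))" for m
          by (rule trig_approx_continuous) (auto simp: h_def[abs_def] intro!: continuous_intros)
        show "(\<lambda>\<omega>. indicator A (tor \<omega>) :: complex) \<in> borel_measurable borel"
          by (rule meas) (use A in auto)
        show "cmod (of_real (h m (tor \<omega>))) \<le> cmod 1" for m \<omega>
          using h0[of m "tor \<omega>"] by (simp add: h_def)
        show "(\<lambda>m. complex_of_real (h m (tor \<omega>))) \<longlonglongrightarrow> indicator A (tor \<omega>)" for \<omega>
        proof (cases "tor \<omega> \<in> A")
          case in_A: True
          have "infdist (tor \<omega>) (- A) \<noteq> 0"
            using in_A A False by (subst in_closed_iff_infdist_zero[symmetric]) auto
          then have p: "infdist (tor \<omega>) (- A) > 0" using infdist_nonneg[of "tor \<omega>" "- A"] by linarith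
          obtain N where N: "1 / infdist (tor \<omega>) (- A) < real N" using reals_Archimedean2 by blast
          have "h m (tor \<omega>) = 1" if "m \<ge> N" for m
          proof -
            have "1 / infdist (tor \<omega>) (- A) < real m" using N that by linarith
            then have "1 < real m * infdist (tor \<omega>) (- A)" using p by (simp add: pos_divide_less_eq)
            then show ?thesis by (simp add: h_def)
          qed
          then have "eventually (\<lambda>m. complex_of_real (h m (tor \<omega>)) = 1) sequentially"
            by (auto simp: eventually_sequentially)
          then show ?thesis using in_A by (simp add: tendsto_eventually)
        next
          case notin: False
          then have "h m (tor \<omega>) = 0" for m by (simp add: h_def)
          then show ?thesis using notin by simp
        qed
      qed
    qed
  next
    show "trig_approx (\<lambda>\<omega>. indicator {} (tor \<omega>))"
      using trig_approx_trig[OF trig_const[of 0]] by simp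
  next
    fix A :: "(complex^'d) set" assume "trig_approx (\<lambda>\<omega>. indicator A (tor \<omega>))"
    then have "trig_approx (\<lambda>\<omega>. 1 + (-1) * indicator A (tor \<omega>))"
      by (intro trig_approx_add trig_approx_cmult trig_approx_trig[OF trig_const])
    moreover have "(\<lambda>\<omega>. 1 + (-1) * indicator A (tor \<omega>)) = (\<lambda>\<omega>. indicator (UNIV - A) (tor \<omega>) :: complex)"
      by (auto simp: indicator_def)
    ultimately show "trig_approx (\<lambda>\<omega>. indicator (UNIV - A) (tor \<omega>))" by (simp only:)
  next
    fix A :: "nat \<Rightarrow> (complex^'d) set"
    assume dis: "disjoint_family A" and A: "range A \<subseteq> sigma_sets UNIV (Collect open)"
      and IH: "\<And>i. trig_approx (\<lambda>\<omega>. indicator (A i) (tor \<omega>))"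
    have eq: "(\<Sum>i<m. indicator (A i) z) = (indicator (\<Union>i<m. A i) z :: complex)" for m z
      by (rule indicator_UN_disjoint[symmetric])
        (use dis in \<open>auto simp: disjoint_family_on_def\<close>)
    show "trig_approx (\<lambda>\<omega>. indicator (\<Union>i. A i) (tor \<omega>))"
    proof (rule trig_approx_dominated[where F = "\<lambda>m \<omega>. indicator (\<Union>i<m. A i) (tor \<omega>)", OF _ _ sq_int_cellm_1])
      show "trig_approx (\<lambda>\<omega>. indicator (\<Union>i<m. A i) (tor \<omega>))" for m
      proof (induction m)
        case 0
        then show ?case using trig_approx_trig[OF trig_const[of 0]] by simp
      next
        case (Suc m)
        have "trig_approx (\<lambda>\<omega>. indicator (\<Union>i<m. A i) (tor \<omega>) + indicator (A m) (tor \<omega>))"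
          by (rule trig_approx_add[OF Suc IH])
        then show ?case by (simp only: eq[symmetric] sum.lessThan_Suc)
      qed
      have "A i \<in> sets borel" for i using A by (auto simp: borel_def)
      then show "(\<lambda>\<omega>. indicator (\<Union>i. A i) (tor \<omega>) :: complex) \<in> borel_measurable borel"
        by (intro meas) auto
      show "cmod (indicator (\<Union>i<m. A i) (tor \<omega>)) \<le> cmod 1" for m \<omega>
        by (simp add: indicator_def)
      show "(\<lambda>m. indicator (\<Union>i<m. A i) (tor \<omega>) :: complex) \<longlonglongrightarrow> indicator (\<Union>i. A i) (tor \<omega>)" for \<omega>
        by (rule LIMSEQ_indicator_UN)
    qed
  qed
qed

text \<open>Inverts \<open>tor\<close> on the cell. It jumps where \<open>Arg2pi\<close> does, but
  measurability is enough to see every Borel subset of the cell as the preimage of a Borel subset of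
  the torus.\<close>

definition untor :: "complex^'d \<Rightarrow> real^'d" where
  "untor z = T *v (\<chi> i. Arg2pi (z $ i) / (2 * pi))"

text \<open>The angle is continuous off the nonnegative real axis and constantly 0 on it.\<close>

lemma borel_measurable_Arg2pi [measurable]: "Arg2pi \<in> borel_measurable borel"
proof -
  have "(\<lambda>z. if z \<in> \<real>\<^sub>\<ge>\<^sub>0 then 0 else Arg2pi z) \<in> borel_measurable borel"
  proof (rule borel_measurable_continuous_on_if)
    show "continuous_on (- \<real>\<^sub>\<ge>\<^sub>0) Arg2pi"
      using continuous_at_Arg2pi continuous_at_imp_continuous_on by blast
  qed auto
  moreover have "(\<lambda>z. if z \<in> \<real>\<^sub>\<ge>\<^sub>0 then 0 else Arg2pi z) = Arg2pi"
    by (auto simp: fun_eq_iff complex_nonneg_Reals_iff Arg2pi_eq_0 complex_is_Real_iff)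
  ultimately show ?thesis by simp
qed

lemma untor_measurable: "untor \<in> borel_measurable borel"
  unfolding untor_def[abs_def]
  by (intro borel_measurable_mult_vec borel_measurable_vec_lambda) measurable

lemma untor_tor:
  assumes "\<omega> \<in> cell"
  shows "untor (tor \<omega>) = \<omega>"
proof -
  have "Arg2pi (chr (axis i 1) \<omega>) / (2 * pi) = (S *v \<omega>) $ i" for i
  proof -
    have "\<lfloor>(S *v \<omega>) $ i\<rfloor> = 0" using assms by (auto simp: cell_def fl_def vec_eq_iff)
    then have b: "0 \<le> (S *v \<omega>) $ i" "(S *v \<omega>) $ i < 1" by (auto simp: floor_eq_iff)
    have "Arg2pi (chr (axis i 1) \<omega>) = 2 * pi * (S *v \<omega>) $ i"
      by (rule Arg2pi_unique[of 1]) (use b in \<open>auto simp: chr_def rvec_axis inner_axis' cis_conv_exp\<close>)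
    then show ?thesis by simp
  qed
  then show ?thesis by (simp add: untor_def tor_def)
qed

lemma trig_approx_indicator:
  assumes A: "A \<in> sets borel"
  shows "trig_approx (indicator A)"
proof (rule trig_approx_cong_AE)
  show "trig_approx (\<lambda>\<omega>. indicator (untor -` A) (tor \<omega>))"
    using measurable_sets[OF untor_measurable A] by (intro trig_approx_tor_indicator) simp
  show "(indicator A :: _ \<Rightarrow> complex) \<in> borel_measurable borel" using A by measurable
  show "AE \<omega> in cellm. indicator (untor -` A) (tor \<omega>) = (indicator A \<omega> :: complex)"
    using AE_cellm_cell by eventually_elim (simp add: untor_tor indicator_def)
qed

lemma trig_approx_real:
  fixes u :: "real^'d \<Rightarrow> real"
  assumes u: "u \<in> borel_measurable borel" "\<And>\<omega>. 0 \<le> u \<omega>" and s: "sq_int cellm (\<lambda>\<omega>. of_real (u \<omega>))"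
  shows "trig_approx (\<lambda>\<omega>. of_real (u \<omega>))"
  using u s
proof (induction u rule: borel_measurable_induct_real)
  case (set A)
  have "(\<lambda>\<omega>. complex_of_real (indicator A \<omega>)) = indicator A" by (auto simp: indicator_def)
  then show ?case using trig_approx_indicator[of A] set by simp
next
  case (mult u c)
  show ?case
  \<comment> \<open>For c = 0 the square integrability of c u says nothing about u, and the
    induction hypothesis is out of reach.\<close>
  proof (cases "c = 0")
    case True
    then show ?thesis using trig_approx_trig[OF trig_const[of 0]] by simp
  next
    case False
    have "sq_int cellm (\<lambda>\<omega>. of_real (1 / c) * of_real (c * u \<omega>))"
      by (rule sq_int_cmult) (use mult in simp)
    then have "trig_approx (\<lambda>\<omega>. of_real (u \<omega>))" using mult False by simp
    then show ?thesis using trig_approx_cmult by fastforce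
  qed
next
  case (add u v)
  note [measurable] = add.hyps(1,3)
  have c: "cmod (complex_of_real (v \<omega> + u \<omega>)) = v \<omega> + u \<omega>" for \<omega>
    unfolding norm_of_real using add.hyps(2,4) by simp
  have "sq_int cellm (\<lambda>\<omega>. of_real (u \<omega>))" 
    by (rule sq_int_bound[OF add.prems, of _ 1]) (use add.hyps(2,4) c in \<open>auto simp: abs_of_nonneg\<close>)
  moreover have "sq_int cellm (\<lambda>\<omega>. of_real (v \<omega>))"
    by (rule sq_int_bound[OF add.prems, of _ 1]) (use add.hyps(2,4) c in \<open>auto simp: abs_of_nonneg\<close>)
  ultimately show ?case
    using trig_approx_add[OF add.IH(2) add.IH(1)] by simp
next
  case (seq U)
  note [measurable] = seq.hyps(1)
  have le: "U m \<omega> \<le> u \<omega>" for m \<omega>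
    using seq.hyps(3,4) by (intro incseq_le[where X = "\<lambda>m. U m \<omega>"]) (auto simp: incseq_def le_fun_def)
  have u0: "0 \<le> u \<omega>" for \<omega> using le[of 0 \<omega>] seq.hyps(2)[of 0 \<omega>] by simp
  show ?case
  proof (rule trig_approx_dominated[where F = "\<lambda>m \<omega>. of_real (U m \<omega>)", OF _ _ seq.prems])
    show "trig_approx (\<lambda>\<omega>. of_real (U m \<omega>))" for m
    proof (rule seq.IH)
      show "sq_int cellm (\<lambda>\<omega>. complex_of_real (U m \<omega>))"
        by (rule sq_int_bound[OF seq.prems, of _ 1]) (use le seq.hyps(2) u0 in auto)
    qed
    show "(\<lambda>\<omega>. complex_of_real (u \<omega>)) \<in> borel_measurable borel"
      using sq_int_measurable[OF seq.prems] by (simp cong: measurable_cong_sets)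
    show "(\<lambda>m. complex_of_real (U m \<omega>)) \<longlonglongrightarrow> of_real (u \<omega>)" for \<omega>
      using seq.hyps(4)[of \<omega>] by (intro tendsto_of_real) simp
  qed (use le seq.hyps(2) u0 in auto)
qed

lemma borel_cellm: "f \<in> borel_measurable cellm \<longleftrightarrow> f \<in> borel_measurable borel"
  by (simp cong: measurable_cong_sets)

text \<open>Positive and negative parts of the real and imaginary parts are each bounded by the
  modulus, hence square integrable.\<close>

lemma trig_dense:
  assumes F: "sq_int cellm F"
  shows "trig_approx F"
proof -
  have [measurable]: "F \<in> borel_measurable borel" using sq_int_measurable[OF F] by (simp add: borel_cellm)
  have *: "trig_approx (\<lambda>\<omega>. of_real (max 0 (h (F \<omega>))))"
    if h: "h \<in> borel_measurable borel" and hb: "\<And>z. \<bar>h z\<bar> \<le> cmod z" for h :: "complex \<Rightarrow> real"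
  proof (rule trig_approx_real)
    show "sq_int cellm (\<lambda>\<omega>. complex_of_real (max 0 (h (F \<omega>))))"
    proof (rule sq_int_bound[OF F, of _ 1])
      show "AE \<omega> in cellm. cmod (complex_of_real (max 0 (h (F \<omega>)))) \<le> 1 * cmod (F \<omega>)"
        using hb by (auto simp: max_def intro: order_trans[OF abs_ge_self])
    qed (use h in \<open>measurable\<close>)
  qed (use h in auto)
  have "trig_approx (\<lambda>\<omega>. (of_real (max 0 (Re (F \<omega>))) + (-1) * of_real (max 0 (- Re (F \<omega>))))
      + \<i> * (of_real (max 0 (Im (F \<omega>))) + (-1) * of_real (max 0 (- Im (F \<omega>)))))"
    by (intro trig_approx_add trig_approx_cmult *[of Re] *[of Im] *[of "\<lambda>z. - Re z"] *[of "\<lambda>z. - Im z"])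
       (auto simp: abs_Re_le_cmod abs_Im_le_cmod)
  moreover have "(of_real (max 0 (Re z)) + (-1) * of_real (max 0 (- Re z)))
      + \<i> * (of_real (max 0 (Im z)) + (-1) * of_real (max 0 (- Im z))) = z" for z :: complex
    by (auto simp: complex_eq_iff max_def)
  ultimately show ?thesis by simp
qed

section \<open>Fourier coefficients and Parseval's identity\<close>

definition fcoeff :: "(real^'d \<Rightarrow> complex) \<Rightarrow> int^'d \<Rightarrow> complex" where
  "fcoeff F k = ip cellm F (chr k) / of_real covol"

lemma ip_fcoeff: "ip cellm F (chr k) = of_real covol * fcoeff F k"
  using covol_pos by (simp add: fcoeff_def)

lemma ip_trig_sum_left:
  assumes "sq_int cellm G"
  shows "ip cellm (\<lambda>\<omega>. \<Sum>k\<in>K. d k * chr k \<omega>) G = (\<Sum>k\<in>K. d k * ip cellm (chr k) G)"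
  using ip_sum_left[of K cellm "\<lambda>k \<omega>. d k * chr k \<omega>", OF sq_int_cmult[OF sq_int_chr] assms]
  by (simp only: ip_cmult_left)

lemma ip_trig_sum_right:
  assumes "sq_int cellm G"
  shows "ip cellm G (\<lambda>\<omega>. \<Sum>k\<in>K. d k * chr k \<omega>) = (\<Sum>k\<in>K. cnj (d k) * ip cellm G (chr k))"
  using ip_sum_right[of K cellm "\<lambda>k \<omega>. d k * chr k \<omega>", OF sq_int_cmult[OF sq_int_chr] assms]
  by (simp only: ip_cmult_right)

lemma nsq_trig_sum:
  assumes "finite K"
  shows "nsq cellm (\<lambda>\<omega>. \<Sum>k\<in>K. d k * chr k \<omega>) = covol * (\<Sum>k\<in>K. (cmod (d k))\<^sup>2)"
proof -
  have "complex_of_real (nsq cellm (\<lambda>\<omega>. \<Sum>k\<in>K. d k * chr k \<omega>))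
      = (\<Sum>k\<in>K. \<Sum>l\<in>K. d k * (cnj (d l) * ip cellm (chr k) (chr l)))"
    by (simp only: nsq_ip ip_trig_sum_left[OF sq_int_trig_sum] ip_trig_sum_right[OF sq_int_chr] sum_distrib_left)
  also have "\<dots> = (\<Sum>k\<in>K. \<Sum>l\<in>K. if k = l then d k * cnj (d k) * covol else 0)"
    by (intro sum.cong) (auto simp: ip_chr)
  also have "\<dots> = (\<Sum>k\<in>K. d k * cnj (d k) * covol)"
    using assms by simp
  also have "\<dots> = complex_of_real (covol * (\<Sum>k\<in>K. (cmod (d k))\<^sup>2))"
    by (simp add: complex_norm_square[symmetric] sum_distrib_left mult.commute del: of_real_power)
  finally show ?thesis by (simp only: of_real_eq_iff)
qed

text \<open>Completing the square: the error is least when the coefficients are the Fourier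
  coefficients, and it then decreases as the frequency set grows.\<close>

lemma nsq_diff_trig_sum:
  assumes F: "sq_int cellm F" and K: "finite K"
  shows "nsq cellm (\<lambda>\<omega>. F \<omega> - (\<Sum>k\<in>K. d k * chr k \<omega>))
     = nsq cellm F - covol * (\<Sum>k\<in>K. (cmod (fcoeff F k))\<^sup>2) + covol * (\<Sum>k\<in>K. (cmod (d k - fcoeff F k))\<^sup>2)"
proof -
  have "ip cellm F (\<lambda>\<omega>. \<Sum>k\<in>K. d k * chr k \<omega>) = (\<Sum>k\<in>K. cnj (d k) * (of_real covol * fcoeff F k))"
    by (simp only: ip_trig_sum_right[OF F] ip_fcoeff)
  then have re: "Re (ip cellm F (\<lambda>\<omega>. \<Sum>k\<in>K. d k * chr k \<omega>)) = covol * (\<Sum>k\<in>K. Re (cnj (d k) * fcoeff F k))"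
    by (simp add: sum_distrib_left algebra_simps)
  have "(cmod (d k - fcoeff F k))\<^sup>2 = (cmod (d k))\<^sup>2 + (cmod (fcoeff F k))\<^sup>2 - 2 * Re (cnj (d k) * fcoeff F k)" for k
    by (simp only: cmod_power2) (simp add: power2_eq_square algebra_simps)
  then have "(\<Sum>k\<in>K. (cmod (d k - fcoeff F k))\<^sup>2)
      = (\<Sum>k\<in>K. (cmod (d k))\<^sup>2) + (\<Sum>k\<in>K. (cmod (fcoeff F k))\<^sup>2) - 2 * (\<Sum>k\<in>K. Re (cnj (d k) * fcoeff F k))"
    by (simp add: sum.distrib sum_subtractf sum_distrib_left)
  then show ?thesis
    by (simp only: nsq_diff[OF F sq_int_trig_sum] nsq_trig_sum[OF K] re) (simp add: algebra_simps)
qed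

text \<open>Density supplies one polynomial with small error; every Fourier partial sum over a
  larger frequency set does at least as well.\<close>

lemma fourier_tendsto:
  assumes F: "sq_int cellm F"
  shows "((\<lambda>K. nsq cellm (\<lambda>\<omega>. F \<omega> - (\<Sum>k\<in>K. fcoeff F k * chr k \<omega>))) \<longlongrightarrow> 0) (finite_subsets_at_top UNIV)"
proof (rule tendstoI)
  fix \<epsilon> :: real assume "\<epsilon> > 0"
  then obtain P where P: "trig P" "nsq cellm (\<lambda>\<omega>. F \<omega> - P \<omega>) < \<epsilon>"
    using trig_dense[OF F] unfolding trig_approx_def by blast
  obtain K0 c where K0: "finite K0" "P = (\<lambda>\<omega>. \<Sum>k\<in>K0. c k * chr k \<omega>)" using trig_sum[OF P(1)] by blast
  have "nsq cellm (\<lambda>\<omega>. F \<omega> - (\<Sum>k\<in>K. fcoeff F k * chr k \<omega>)) < \<epsilon>" if K: "finite K" "K0 \<subseteq> K" for K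
  proof -
    have "(\<Sum>k\<in>K0. (cmod (fcoeff F k))\<^sup>2) \<le> (\<Sum>k\<in>K. (cmod (fcoeff F k))\<^sup>2)"
      using K by (intro sum_mono2) auto
    then have "nsq cellm F - covol * (\<Sum>k\<in>K. (cmod (fcoeff F k))\<^sup>2)
        \<le> nsq cellm F - covol * (\<Sum>k\<in>K0. (cmod (fcoeff F k))\<^sup>2) + covol * (\<Sum>k\<in>K0. (cmod (c k - fcoeff F k))\<^sup>2)"
      using covol_pos by (simp add: add_increasing2 sum_nonneg)
    then show ?thesis
      using P(2) nsq_diff_trig_sum[OF F K(1), of "fcoeff F"] nsq_diff_trig_sum[OF F K0(1), of c] K0(2) by simp
  qed
  then show "\<forall>\<^sub>F K in finite_subsets_at_top UNIV.
      dist (nsq cellm (\<lambda>\<omega>. F \<omega> - (\<Sum>k\<in>K. fcoeff F k * chr k \<omega>))) 0 < \<epsilon>"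
    using K0(1) by (auto simp: eventually_finite_subsets_at_top)
qed

text \<open>For a Fourier partial sum the error is the squared norm minus \<open>covol\<close> times
  the partial sum of the squared coefficients.\<close>

lemma parseval:
  assumes F: "sq_int cellm F"
  shows "((\<lambda>k. (cmod (fcoeff F k))\<^sup>2) has_sum (nsq cellm F / covol)) UNIV"
proof -
  have "((\<lambda>K. nsq cellm F / covol - (1 / covol) * nsq cellm (\<lambda>\<omega>. F \<omega> - (\<Sum>k\<in>K. fcoeff F k * chr k \<omega>)))
     \<longlongrightarrow> nsq cellm F / covol - (1 / covol) * 0) (finite_subsets_at_top UNIV)"
    by (intro tendsto_intros fourier_tendsto[OF F])
  moreover have "\<forall>\<^sub>F K in finite_subsets_at_top UNIV.
      nsq cellm F / covol - (1 / covol) * nsq cellm (\<lambda>\<omega>. F \<omega> - (\<Sum>k\<in>K. fcoeff F k * chr k \<omega>))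
      = (\<Sum>k\<in>K. (cmod (fcoeff F k))\<^sup>2)"
    by (rule eventually_finite_subsets_at_top_weakI)
       (use covol_pos in \<open>simp add: nsq_diff_trig_sum[OF F] diff_divide_distrib\<close>)
  ultimately show ?thesis
    unfolding has_sum_def by (simp add: tendsto_cong)
qed

end

section \<open>Plancherel's formula\<close>

lemma borel_measurable_cis [measurable (raw)]:
  "f \<in> borel_measurable M \<Longrightarrow> (\<lambda>x. cis (f x)) \<in> borel_measurable M"
  by (rule borel_measurable_continuous_on[where f = cis]) (simp_all add: continuous_on_cis continuous_on_id)

lemma integral_lborel_translate:
  fixes c :: "'a::euclidean_space" and h :: "'a \<Rightarrow> 'b::{banach, second_countable_topology}"
  assumes "h \<in> borel_measurable borel"
  shows "(\<integral>x. h (x + c) \<partial>lborel) = (\<integral>x. h x \<partial>lborel)"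
proof -
  have "(\<integral>x. h x \<partial>lborel) = (\<integral>x. h x \<partial>distr lborel borel ((+) c))"
    by (simp only: lborel_distr_plus)
  also have "\<dots> = (\<integral>x. h (c + x) \<partial>lborel)"
    by (rule integral_distr) (use assms in auto)
  finally show ?thesis by (simp add: add.commute)
qed

abbreviation scal :: "real \<Rightarrow> real^'d^'d" where "scal t \<equiv> t *\<^sub>R mat 1"

lemma scal_mult: "scal t *v x = t *\<^sub>R x"
  by (simp add: scaleR_matrix_vector_assoc[symmetric])

lemma lattice_scal:
  assumes "t > 0"
  shows "lattice (scal t :: real^'d^'d) (scal (1 / t))"
  by unfold_locales
     (use assms in \<open>simp_all add: matrix_eq scal_mult matrix_vector_mul_assoc[symmetric]\<close>)

text \<open>The half-open cube lies between the open and the closed box of the same side. The exact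
  value is what produces the constant in Plancherel's formula.\<close>

lemma covol_scal:
  assumes t: "t > 0"
  shows "lattice.covol (scal (1 / t) :: real^'d^'d) = t ^ CARD('d)"
proof -
  interpret lattice "scal t :: real^'d^'d" "scal (1 / t)" by (rule lattice_scal[OF t])
  let ?v = "(\<chi> i. t) :: real^'d"
  have cell: "cell = {\<omega>. \<forall>i. 0 \<le> \<omega> $ i \<and> \<omega> $ i < t}"
    unfolding cell_def fl_def
    by (simp only: scal_mult) (use t in \<open>auto simp: vec_eq_iff floor_eq_iff field_simps\<close>)
  have p: "(\<Prod>b\<in>Basis. (?v - 0) \<bullet> b) = t ^ CARD('d)"
  proof -
    have "(\<Prod>b\<in>Basis. (?v - 0) \<bullet> b) = (\<Prod>b\<in>(Basis :: (real^'d) set). t)"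
      by (intro prod.cong) (auto simp: Basis_vec_def inner_axis)
    then show ?thesis by simp
  qed
  have b: "\<And>b. b \<in> (Basis :: (real^'d) set) \<Longrightarrow> 0 \<bullet> b \<le> ?v \<bullet> b"
    using t by (auto simp: Basis_vec_def inner_axis)
  have "ennreal (t ^ CARD('d)) = emeasure lborel (box 0 ?v)"
    using p b by (simp add: emeasure_lborel_box)
  also have "\<dots> \<le> emeasure lborel cell"
    by (rule emeasure_mono) (auto simp: cell mem_box_cart less_imp_le cell_sets[unfolded cell])
  finally have le: "t ^ CARD('d) \<le> covol"
    using covol_pos by (simp add: emeasure_cell)
  have "emeasure lborel cell \<le> emeasure lborel (cbox 0 ?v)"
    by (rule emeasure_mono) (auto simp: cell mem_box_cart less_imp_le)
  also have "\<dots> = ennreal (t ^ CARD('d))"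
    using p b by (simp add: emeasure_lborel_cbox)
  finally have "covol \<le> t ^ CARD('d)"
    using t by (simp add: emeasure_cell)
  with le show ?thesis by simp
qed

text \<open>Without the factor 1/(2 pi)^d, which is divided out only where
  \<open>L2_inv_fourier\<close> is concerned.\<close>

definition ift :: "(real^'d \<Rightarrow> complex) \<Rightarrow> real^'d \<Rightarrow> complex" where
  "ift F x = (\<integral>\<omega>. F \<omega> * cis (x \<bullet> \<omega>) \<partial>lborel)"

lemma ift_measurable [measurable]:
  assumes [measurable]: "F \<in> borel_measurable borel"
  shows "ift F \<in> borel_measurable borel"
  unfolding ift_def[abs_def]
  by (rule sigma_finite_measure.borel_measurable_lebesgue_integral[OF sigma_finite_lborel]) measurable

text \<open>
  The samples of the inverse transform of a function supported in one cell are, up to a phase, the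
  Fourier coefficients of that function, so Plancherel's formula for it is Parseval's identity
  integrated over a cell of the dual lattice.
\<close>

lemma plancherel_cell:
  fixes F :: "real^'d \<Rightarrow> complex"
  assumes F: "sq_int lborel F" and t: "t > 0"
    and supp: "\<And>\<omega>. \<not> (\<forall>i. 0 \<le> \<omega> $ i \<and> \<omega> $ i < t) \<Longrightarrow> F \<omega> = 0"
  shows "(\<integral>\<^sup>+x. ennreal ((cmod (ift F x))\<^sup>2) \<partial>lborel) = ennreal ((2 * pi) ^ CARD('d) * nsq lborel F)"
proof -
  \<comment> \<open>The spacing of the dual lattice: pairing \<open>B.pt k\<close> with a frequency
    gives exactly the phase of \<open>A.chr k\<close>, and t u = 2 pi yields the constant.\<close>
  define u where "u = 2 * pi / t"
  have t': "u > 0" using t by (simp add: u_def)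
  interpret A: lattice "scal t :: real^'d^'d" "scal (1 / t)" by (rule lattice_scal[OF t])
  interpret B: lattice "scal u :: real^'d^'d" "scal (1 / u)"
    by (rule lattice_scal[OF t'])
  have [measurable]: "F \<in> borel_measurable borel" using sq_int_measurable[OF F] by simp
  have cell: "\<omega> \<in> A.cell \<longleftrightarrow> (\<forall>i. 0 \<le> \<omega> $ i \<and> \<omega> $ i < t)" for \<omega>
    unfolding A.cell_def A.fl_def
    by (simp only: scal_mult) (use t in \<open>auto simp: vec_eq_iff floor_eq_iff field_simps\<close>)
  have F0: "indicator A.cell \<omega> *\<^sub>R F \<omega> = F \<omega>" for \<omega>
    using supp[of \<omega>] by (auto simp: cell[symmetric] indicator_def)
  have int_cell: "(\<integral>\<omega>. F \<omega> * h \<omega> \<partial>A.cellm) = (\<integral>\<omega>. F \<omega> * h \<omega> \<partial>lborel)"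
    if [measurable]: "h \<in> borel_measurable borel" for h
  proof -
    have "(\<integral>\<omega>. F \<omega> * h \<omega> \<partial>A.cellm) = (\<integral>\<omega>. indicator A.cell \<omega> *\<^sub>R (F \<omega> * h \<omega>) \<partial>lborel)"
    proof -
      have "A.cellm = density lborel (\<lambda>\<omega>. ennreal (indicator A.cell \<omega>))"
        by (simp add: A.cellm_def ennreal_indicator)
      then show ?thesis by (simp only:) (rule integral_density; simp)
    qed
    also have "\<dots> = (\<integral>\<omega>. F \<omega> * h \<omega> \<partial>lborel)"
      using F0 by (metis mult_scaleR_left)
    finally show ?thesis .
  qed
  define Fx where "Fx x \<omega> = F \<omega> * cis (x \<bullet> \<omega>)" for x \<omega>
  have [measurable]: "Fx x \<in> borel_measurable borel" for x unfolding Fx_def[abs_def] by measurable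
  have nn: "(\<integral>\<^sup>+\<omega>. ennreal ((cmod (Fx x \<omega>))\<^sup>2) \<partial>A.cellm) = ennreal (nsq lborel F)" for x
  proof -
    have "(\<integral>\<^sup>+\<omega>. ennreal ((cmod (Fx x \<omega>))\<^sup>2) \<partial>A.cellm)
        = (\<integral>\<^sup>+\<omega>. indicator A.cell \<omega> * ennreal ((cmod (Fx x \<omega>))\<^sup>2) \<partial>lborel)"
      by (rule A.nn_cellm) measurable
    also have "\<dots> = (\<integral>\<^sup>+\<omega>. ennreal ((cmod (F \<omega>))\<^sup>2) \<partial>lborel)"
    proof (rule nn_integral_cong)
      fix \<omega>
      show "indicator A.cell \<omega> * ennreal ((cmod (Fx x \<omega>))\<^sup>2) = ennreal ((cmod (F \<omega>))\<^sup>2)"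
        using supp[of \<omega>] by (auto simp: cell[symmetric] indicator_def Fx_def norm_mult)
    qed
    finally show ?thesis by (simp add: nn_nsq[OF F])
  qed
  have Fx: "sq_int A.cellm (Fx x)" for x
    by (subst sq_int_iff_nn) (simp_all add: nn A.borel_cellm)
  have nsqx: "nsq A.cellm (Fx x) = nsq lborel F" for x
    using nn[of x] nn_nsq[OF Fx, of x] by simp
  \<comment> \<open>The index is negated because a coefficient pairs with the conjugate character,
    whereas \<open>ift\<close> has the positive phase.\<close>
  have co: "A.fcoeff (Fx x) (- k) = ift F (x + B.pt k) / A.covol" for x k
  proof -
    have "ip A.cellm (Fx x) (A.chr (- k)) = (\<integral>\<omega>. F \<omega> * (cis (x \<bullet> \<omega>) * A.chr k \<omega>) \<partial>A.cellm)"
      by (simp add: ip_def Fx_def A.chr_minus mult.assoc)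
    also have "\<dots> = (\<integral>\<omega>. F \<omega> * (cis (x \<bullet> \<omega>) * A.chr k \<omega>) \<partial>lborel)"
      by (rule int_cell) measurable
    also have "\<dots> = ift F (x + B.pt k)"
      unfolding ift_def A.chr_def B.pt_def
      by (simp only: scal_mult) (simp add: cis_mult inner_add_left u_def mult_ac)
    finally show ?thesis by (simp add: A.fcoeff_def)
  qed
  have sum: "(\<integral>\<^sup>+k. ennreal ((cmod (ift F (x + B.pt k)))\<^sup>2) \<partial>count_space UNIV)
      = ennreal (A.covol * nsq lborel F)" for x
  proof -
    have "((\<lambda>k. (cmod (A.fcoeff (Fx x) k))\<^sup>2) has_sum (nsq lborel F / A.covol)) UNIV"
      using A.parseval[OF Fx[of x]] by (simp add: nsqx)
    then have "((\<lambda>k. (cmod (A.fcoeff (Fx x) (- k)))\<^sup>2) has_sum (nsq lborel F / A.covol)) UNIV"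
      by (subst has_sum_reindex_bij_betw[of uminus UNIV UNIV]) (auto simp: bij_uminus)
    then have "((\<lambda>k. A.covol\<^sup>2 * (cmod (A.fcoeff (Fx x) (- k)))\<^sup>2) has_sum (A.covol\<^sup>2 * (nsq lborel F / A.covol))) UNIV"
      by (rule has_sum_cmult_right)
    then have "((\<lambda>k. (cmod (ift F (x + B.pt k)))\<^sup>2) has_sum (A.covol * nsq lborel F)) UNIV"
      using A.covol_pos by (simp add: co norm_divide power_divide) (simp add: power2_eq_square)
    then show ?thesis
      by (subst nn_integral_count_space_infsum) (auto simp: has_sum_imp_summable infsumI)
  qed
  have "(\<integral>\<^sup>+x. 1 * ennreal ((cmod (ift F x))\<^sup>2) \<partial>lborel)
      = (\<integral>\<^sup>+x. 1 * (\<integral>\<^sup>+k. ennreal ((cmod (ift F (x + B.pt k)))\<^sup>2) \<partial>count_space UNIV) \<partial>B.cellm)"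
    by (rule B.periodize) (auto simp: B.per_def)
  also have "\<dots> = ennreal (A.covol * nsq lborel F) * ennreal B.covol"
    by (simp only: sum mult_1 nn_integral_const B.space_cellm B.emeasure_cellm)
  also have "\<dots> = ennreal (A.covol * B.covol * nsq lborel F)"
    using A.covol_pos B.covol_pos by (simp add: ennreal_mult[symmetric] mult_ac)
  also have "A.covol * B.covol = (2 * pi) ^ CARD('d)"
  proof -
    have "t * u = 2 * pi" using t by (simp add: u_def)
    then show ?thesis
      by (simp only: covol_scal[OF t] covol_scal[OF t'] power_mult_distrib[symmetric])
  qed
  finally show ?thesis by simp
qed

text \<open>Translating by \<open>b\<close> moves the ball into a cube with corner 0; on the
  transform side this is only a phase.\<close>

lemma plancherel_ball:
  fixes F :: "real^'d \<Rightarrow> complex"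
  assumes F: "sq_int lborel F" and supp: "\<And>\<omega>. \<omega> \<notin> cball 0 R \<Longrightarrow> F \<omega> = 0"
  shows "sq_int lborel (ift F)" "nsq lborel (ift F) = (2 * pi) ^ CARD('d) * nsq lborel F"
proof -
  define b where "b = ((\<chi> i. \<bar>R\<bar>) :: real^'d)"
  have [measurable]: "F \<in> borel_measurable borel" using sq_int_measurable[OF F] by simp
  have nnF: "(\<integral>\<^sup>+\<omega>. ennreal ((cmod (F (\<omega> - b)))\<^sup>2) \<partial>lborel) = (\<integral>\<^sup>+\<omega>. ennreal ((cmod (F \<omega>))\<^sup>2) \<partial>lborel)"
    using nn_integral_lborel_translate[of "\<lambda>\<omega>. ennreal ((cmod (F \<omega>))\<^sup>2)" "- b"] by simp
  have F': "sq_int lborel (\<lambda>\<omega>. F (\<omega> - b))"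
    using nnF nn_nsq[OF F] by (subst sq_int_iff_nn) simp_all
  have nF': "nsq lborel (\<lambda>\<omega>. F (\<omega> - b)) = nsq lborel F"
    using nnF by (simp add: nn_nsq[OF F] nn_nsq[OF F'])
  have "(\<integral>\<^sup>+x. ennreal ((cmod (ift (\<lambda>\<omega>. F (\<omega> - b)) x))\<^sup>2) \<partial>lborel)
      = ennreal ((2 * pi) ^ CARD('d) * nsq lborel (\<lambda>\<omega>. F (\<omega> - b)))"
  \<comment> \<open>The extra 1 makes the half-open cube contain its extreme points and keeps its
    side positive when R = 0.\<close>
  proof (rule plancherel_cell[OF F', of "2 * \<bar>R\<bar> + 1"])
    fix \<omega> :: "real^'d" assume *: "\<not> (\<forall>i. 0 \<le> \<omega> $ i \<and> \<omega> $ i < 2 * \<bar>R\<bar> + 1)"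
    show "F (\<omega> - b) = 0"
    proof (rule supp, rule notI)
      assume "\<omega> - b \<in> cball 0 R"
      then have "norm (\<omega> - b) \<le> \<bar>R\<bar>" by simp
      then have "\<bar>(\<omega> - b) $ i\<bar> \<le> \<bar>R\<bar>" for i using component_le_norm_cart[of "\<omega> - b" i] by linarith
      then have "\<bar>\<omega> $ i - \<bar>R\<bar>\<bar> \<le> \<bar>R\<bar>" for i by (simp add: b_def)
      moreover have "0 \<le> x \<and> x < 2 * \<bar>R\<bar> + 1" if "\<bar>x - \<bar>R\<bar>\<bar> \<le> \<bar>R\<bar>" for x :: real using that by linarith
      ultimately show False using * by blast
    qed
  qed simp
  moreover have "cmod (ift (\<lambda>\<omega>. F (\<omega> - b)) x) = cmod (ift F x)" for x
  proof -
    have "ift (\<lambda>\<omega>. F (\<omega> - b)) x = (\<integral>\<omega>. F (\<omega> + b - b) * cis (x \<bullet> (\<omega> + b)) \<partial>lborel)"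
      unfolding ift_def
      by (rule integral_lborel_translate[symmetric, of "\<lambda>\<omega>. F (\<omega> - b) * cis (x \<bullet> \<omega>)" b]) measurable
    also have "\<dots> = (\<integral>\<omega>. F \<omega> * cis (x \<bullet> \<omega>) * cis (x \<bullet> b) \<partial>lborel)"
      by (simp add: inner_add_right cis_mult[symmetric] mult_ac)
    also have "\<dots> = ift F x * cis (x \<bullet> b)" by (simp add: ift_def)
    finally show ?thesis by (simp add: norm_mult)
  qed
  ultimately have nn: "(\<integral>\<^sup>+x. ennreal ((cmod (ift F x))\<^sup>2) \<partial>lborel) = ennreal ((2 * pi) ^ CARD('d) * nsq lborel F)"
    by (simp add: nF')
  show s: "sq_int lborel (ift F)" by (subst sq_int_iff_nn) (simp_all add: nn)
  show "nsq lborel (ift F) = (2 * pi) ^ CARD('d) * nsq lborel F"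
    using nn by (simp add: nn_nsq[OF s])
qed

section \<open>The inverse transform of square-integrable functions\<close>

lemma L2_iff: "L2 f \<longleftrightarrow> sq_int lborel f"
  by (simp add: L2_def sq_int_def)

lemma L2_norm_nsq: "(L2_norm f)\<^sup>2 = nsq lborel f"
  by (simp add: L2_norm_def nsq_def[symmetric])

definition trunc :: "real \<Rightarrow> (real^'d \<Rightarrow> complex) \<Rightarrow> real^'d \<Rightarrow> complex" where
  "trunc R F \<omega> = indicator (cball 0 R) \<omega> * F \<omega>"

lemma sq_int_trunc: "sq_int lborel F \<Longrightarrow> sq_int lborel (trunc R F)"
  unfolding trunc_def[abs_def]
  by (rule sq_int_mult_bounded[where C = 1]) (auto simp: indicator_def)

lemma ift_trunc:
  "(LINT \<omega>:cball 0 R|lborel. F \<omega> * cis (x \<bullet> \<omega>)) = ift (trunc R F) x"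
  by (simp add: ift_def trunc_def set_lebesgue_integral_def scaleR_conv_of_real of_real_indicator mult.assoc)

text \<open>A product of two square-integrable functions, the ball having finite measure. Additivity
  of \<open>ift\<close> on truncations depends on it.\<close>

lemma integrable_trunc:
  fixes F :: "real^'d \<Rightarrow> complex"
  assumes F: "sq_int lborel F"
  shows "integrable lborel (\<lambda>\<omega>. trunc R F \<omega> * cis (x \<bullet> \<omega>))"
proof -
  have [measurable]: "(cball 0 R :: (real^'d) set) \<in> sets borel" by (intro borel_closed closed_cball)
  have 1: "sq_int lborel (\<lambda>\<omega>. indicator (cball 0 R) \<omega> * cis (- (x \<bullet> \<omega>)))"
  proof (rule sq_int_bound[of _ "indicator (cball 0 R)" _ 1])
    have "emeasure lborel (cball 0 R :: (real^'d) set) < \<infinity>"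
      by (rule emeasure_bounded_finite) simp
    then have "integrable lborel (indicator (cball 0 R) :: real^'d \<Rightarrow> real)"
      by (intro integrable_real_indicator) auto
    moreover have "(\<lambda>\<omega>. (cmod (indicator (cball 0 R) \<omega>))\<^sup>2) = (indicator (cball 0 R) :: real^'d \<Rightarrow> real)"
      by (auto simp: indicator_def)
    ultimately show "sq_int lborel (indicator (cball 0 R) :: real^'d \<Rightarrow> complex)"
      by (simp add: sq_int_def borel_measurable_indicator)
    show "(\<lambda>\<omega>. indicator (cball 0 R) \<omega> * cis (- (x \<bullet> \<omega>))) \<in> borel_measurable lborel"
      by measurable
  qed (auto simp: norm_mult)
  have "integrable lborel (\<lambda>\<omega>. F \<omega> * cnj (indicator (cball 0 R) \<omega> * cis (- (x \<bullet> \<omega>))))"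
    by (rule integrable_ip[OF F 1])
  moreover have "cnj (indicator A \<omega>) = (indicator A \<omega> :: complex)" for A and \<omega> :: "real^'d"
    by (simp add: indicator_def)
  ultimately show ?thesis by (simp add: trunc_def cis_cnj mult_ac)
qed

text \<open>Plancherel on balls makes the truncated transforms square integrable, so the nonnegative
  integral of the definition can be exchanged for \<open>nsq\<close> and its Hilbert space
  calculus.\<close>

lemma L2_inv_fourier_alt:
  fixes F f :: "real^'d \<Rightarrow> complex"
  shows "L2_inv_fourier F f \<longleftrightarrow> sq_int lborel F \<and> sq_int lborel f \<and>
    ((\<lambda>R. nsq lborel (\<lambda>x. ift (trunc R F) x / (2 * pi) ^ CARD('d) - f x)) \<longlongrightarrow> 0) at_top"
proof -
  have "((\<lambda>R. \<integral>\<^sup>+x. ennreal ((cmod (ift (trunc R F) x / (2 * pi) ^ CARD('d) - f x))\<^sup>2) \<partial>lborel) \<longlongrightarrow> 0) at_top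
     \<longleftrightarrow> ((\<lambda>R. nsq lborel (\<lambda>x. ift (trunc R F) x / (2 * pi) ^ CARD('d) - f x)) \<longlongrightarrow> 0) at_top"
    if "sq_int lborel F" "sq_int lborel f"
  proof -
    have "sq_int lborel (\<lambda>x. ift (trunc R F) x / (2 * pi) ^ CARD('d) - f x)" for R
      using sq_int_diff[OF sq_int_cmult[OF plancherel_ball(1)[OF sq_int_trunc[OF that(1)], of R R], of "1 / (2 * pi) ^ CARD('d)"] that(2)]
      by (simp add: trunc_def)
    then have "(\<integral>\<^sup>+x. ennreal ((cmod (ift (trunc R F) x / (2 * pi) ^ CARD('d) - f x))\<^sup>2) \<partial>lborel)
       = ennreal (nsq lborel (\<lambda>x. ift (trunc R F) x / (2 * pi) ^ CARD('d) - f x))" for R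
      by (rule nn_nsq)
    then show ?thesis
      by (simp add: tendsto_ennreal_iff[of _ _ 0, simplified])
  qed
  then show ?thesis
    unfolding L2_inv_fourier_def L2_iff L2_tendsto_def ift_trunc by blast
qed

lemma inv_fourier_sq_int:
  assumes "L2_inv_fourier F f"
  shows "sq_int lborel F" "sq_int lborel f"
  using assms by (auto simp: L2_inv_fourier_alt)

lemma sq_int_ift_trunc:
  fixes F :: "real^'d \<Rightarrow> complex"
  assumes "sq_int lborel F"
  shows "sq_int lborel (\<lambda>x. ift (trunc R F) x / (2 * pi) ^ CARD('d))"
  using sq_int_cmult[OF plancherel_ball(1)[OF sq_int_trunc[OF assms], of R R], of "1 / (2 * pi) ^ CARD('d)"]
  by (simp add: trunc_def)

lemma inv_fourier_add:
  assumes "L2_inv_fourier F f" "L2_inv_fourier G g"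
  shows "L2_inv_fourier (\<lambda>\<omega>. F \<omega> + G \<omega>) (\<lambda>x. f x + g x)"
  unfolding L2_inv_fourier_alt
proof (intro conjI)
  note s = inv_fourier_sq_int[OF assms(1)] inv_fourier_sq_int[OF assms(2)]
  show "sq_int lborel (\<lambda>\<omega>. F \<omega> + G \<omega>)" "sq_int lborel (\<lambda>x. f x + g x)"
    using s by (auto intro: sq_int_add)
  let ?c = "(2 * pi) ^ CARD('a) :: complex"
  have eq: "ift (trunc R (\<lambda>\<omega>. F \<omega> + G \<omega>)) x = ift (trunc R F) x + ift (trunc R G) x" for R x
    unfolding ift_def using integrable_trunc[OF s(1)] integrable_trunc[OF s(3)]
    by (simp add: trunc_def distrib_left distrib_right)
  have le: "nsq lborel (\<lambda>x. ift (trunc R (\<lambda>\<omega>. F \<omega> + G \<omega>)) x / ?c - (f x + g x))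
     \<le> 2 * nsq lborel (\<lambda>x. ift (trunc R F) x / ?c - f x) + 2 * nsq lborel (\<lambda>x. ift (trunc R G) x / ?c - g x)" for R
    using nsq_add_le[OF sq_int_diff[OF sq_int_ift_trunc[OF s(1)] s(2)] sq_int_diff[OF sq_int_ift_trunc[OF s(3)] s(4)], of R R]
    by (simp add: eq add_divide_distrib algebra_simps)
  have lim: "((\<lambda>R. 2 * nsq lborel (\<lambda>x. ift (trunc R F) x / ?c - f x)
      + 2 * nsq lborel (\<lambda>x. ift (trunc R G) x / ?c - g x)) \<longlongrightarrow> 2 * 0 + 2 * 0) at_top"
    using assms by (intro tendsto_intros) (auto simp: L2_inv_fourier_alt)
  show "((\<lambda>R. nsq lborel (\<lambda>x. ift (trunc R (\<lambda>\<omega>. F \<omega> + G \<omega>)) x / ?c - (f x + g x))) \<longlongrightarrow> 0) at_top"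
  proof (rule tendsto_sandwich[OF always_eventually always_eventually tendsto_const])
    show "\<forall>R. nsq lborel (\<lambda>x. ift (trunc R (\<lambda>\<omega>. F \<omega> + G \<omega>)) x / ?c - (f x + g x))
     \<le> 2 * nsq lborel (\<lambda>x. ift (trunc R F) x / ?c - f x) + 2 * nsq lborel (\<lambda>x. ift (trunc R G) x / ?c - g x)"
      by (intro allI le)
    show "((\<lambda>R. 2 * nsq lborel (\<lambda>x. ift (trunc R F) x / ?c - f x)
      + 2 * nsq lborel (\<lambda>x. ift (trunc R G) x / ?c - g x)) \<longlongrightarrow> 0) at_top"
      using lim by (simp only: mult_zero_right add_0)
  qed (intro allI nsq_nonneg)
qed

lemma inv_fourier_cmult:
  assumes "L2_inv_fourier F f"
  shows "L2_inv_fourier (\<lambda>\<omega>. c * F \<omega>) (\<lambda>x. c * f x)"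
  unfolding L2_inv_fourier_alt
proof (intro conjI)
  note s = inv_fourier_sq_int[OF assms(1)]
  show "sq_int lborel (\<lambda>\<omega>. c * F \<omega>)" "sq_int lborel (\<lambda>x. c * f x)"
    using s by (auto intro: sq_int_cmult)
  let ?c = "(2 * pi) ^ CARD('a) :: complex"
  have eq: "ift (trunc R (\<lambda>\<omega>. c * F \<omega>)) x / ?c - c * f x = c * (ift (trunc R F) x / ?c - f x)" for R x
  proof -
    have "ift (trunc R (\<lambda>\<omega>. c * F \<omega>)) x = (\<integral>\<omega>. c * (trunc R F \<omega> * cis (x \<bullet> \<omega>)) \<partial>lborel)"
      by (simp add: ift_def trunc_def mult_ac)
    then show ?thesis by (simp add: ift_def right_diff_distrib)
  qed
  have "((\<lambda>R. (cmod c)\<^sup>2 * nsq lborel (\<lambda>x. ift (trunc R F) x / ?c - f x)) \<longlongrightarrow> (cmod c)\<^sup>2 * 0) at_top"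
    using assms by (intro tendsto_intros) (auto simp: L2_inv_fourier_alt)
  then show "((\<lambda>R. nsq lborel (\<lambda>x. ift (trunc R (\<lambda>\<omega>. c * F \<omega>)) x / ?c - c * f x)) \<longlongrightarrow> 0) at_top"
    by (simp only: eq nsq_cmult) simp
qed

lemma inv_fourier_zero: "L2_inv_fourier (\<lambda>\<omega>. 0) (\<lambda>x. 0)"
  by (simp add: L2_inv_fourier_alt ift_def trunc_def nsq_def)

lemma inv_fourier_sum:
  assumes "\<And>i. i \<in> I \<Longrightarrow> L2_inv_fourier (F i) (f i)"
  shows "L2_inv_fourier (\<lambda>\<omega>. \<Sum>i\<in>I. F i \<omega>) (\<lambda>x. \<Sum>i\<in>I. f i x)"
  using assms
  by (induction I rule: infinite_finite_induct) (auto intro: inv_fourier_add inv_fourier_zero)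

lemma inv_fourier_diff:
  assumes "L2_inv_fourier F f" "L2_inv_fourier G g"
  shows "L2_inv_fourier (\<lambda>\<omega>. F \<omega> - G \<omega>) (\<lambda>x. f x - g x)"
  using inv_fourier_add[OF assms(1) inv_fourier_cmult[OF assms(2), of "-1"]] by simp

lemma inv_fourier_translate:
  fixes F f :: "real^'d \<Rightarrow> complex"
  assumes "L2_inv_fourier F f"
  shows "L2_inv_fourier (\<lambda>\<omega>. cis (- (a \<bullet> \<omega>)) * F \<omega>) (\<lambda>x. f (x - a))"
proof -
  note s = inv_fourier_sq_int[OF assms(1)]
  have [measurable]: "f \<in> borel_measurable borel" "F \<in> borel_measurable borel"
    using s[THEN sq_int_measurable] by auto
  let ?c = "(2 * pi) ^ CARD('d) :: complex"
  have nn: "(\<integral>\<^sup>+x. ennreal ((cmod (h (x - a)))\<^sup>2) \<partial>lborel) = (\<integral>\<^sup>+x. ennreal ((cmod (h x))\<^sup>2) \<partial>lborel)"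
    if [measurable]: "h \<in> borel_measurable borel" for h :: "real^'d \<Rightarrow> complex"
    using nn_integral_lborel_translate[of "\<lambda>x. ennreal ((cmod (h x))\<^sup>2)" "- a"] by simp
  have s1: "sq_int lborel (\<lambda>\<omega>. cis (- (a \<bullet> \<omega>)) * F \<omega>)"
    by (rule sq_int_mult_bounded[OF s(1), of _ 1]) auto
  have s2: "sq_int lborel (\<lambda>x. f (x - a))"
    using nn[of f] s(2) by (simp add: sq_int_iff_nn)
  have eq: "ift (trunc R (\<lambda>\<omega>. cis (- (a \<bullet> \<omega>)) * F \<omega>)) x = ift (trunc R F) (x - a)" for R x
    unfolding ift_def trunc_def
    by (intro Bochner_Integration.integral_cong) (auto simp: inner_diff_left cis_mult mult_ac)
  have m: "(\<lambda>x. ift (trunc R F) x / ?c - f x) \<in> borel_measurable borel" for R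
    using sq_int_measurable[OF sq_int_diff[OF sq_int_ift_trunc[OF s(1)] s(2)]] by simp
  have "nsq lborel (\<lambda>x. ift (trunc R F) (x - a) / ?c - f (x - a)) = nsq lborel (\<lambda>x. ift (trunc R F) x / ?c - f x)" for R
  proof -
    have m': "(\<lambda>x. ift (trunc R F) (x - a) / ?c - f (x - a)) \<in> borel_measurable borel"
      using measurable_compose[OF _ m[of R], of "\<lambda>x. x - a" borel] by simp
    show ?thesis using nn[OF m[of R]] m m' by (simp add: nsq_enn2real)
  qed
  then show ?thesis
    using assms s1 s2 by (simp add: L2_inv_fourier_alt eq)
qed

text \<open>The identity holds for truncations. Their norms converge to that of F by dominated
  convergence, and the norms of their transforms to that of f by the triangle inequality.\<close>

theorem inv_fourier_nsq:
  fixes F f :: "real^'d \<Rightarrow> complex"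
  assumes "L2_inv_fourier F f"
  shows "nsq lborel F = (2 * pi) ^ CARD('d) * nsq lborel f"
proof -
  note s = inv_fourier_sq_int[OF assms(1)]
  let ?c = "(2 * pi) ^ CARD('d) :: complex"
  let ?fR = "\<lambda>R x. ift (trunc R F) x / ?c"
  have c: "cmod ?c = (2 * pi) ^ CARD('d)" by (simp add: norm_power norm_mult)
  have nR: "nsq lborel (?fR R) = nsq lborel (trunc R F) / (2 * pi) ^ CARD('d)" for R
  proof -
    have "nsq lborel (\<lambda>x. (1 / ?c) * ift (trunc R F) x) = (cmod (1 / ?c))\<^sup>2 * nsq lborel (ift (trunc R F))"
      by (rule nsq_cmult)
    also have "nsq lborel (ift (trunc R F)) = (2 * pi) ^ CARD('d) * nsq lborel (trunc R F)"
      by (rule plancherel_ball(2)[OF sq_int_trunc[OF s(1)], of R]) (simp add: trunc_def)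
    finally show ?thesis
      by (simp only: norm_divide norm_one c) (simp add: power2_eq_square power_divide)
  qed
  have [measurable]: "F \<in> borel_measurable borel" using s[THEN sq_int_measurable] by auto
  have "((\<lambda>R. nsq lborel (trunc R F)) \<longlongrightarrow> nsq lborel F) at_top"
    unfolding nsq_def
  proof (rule integral_dominated_convergence_at_top)
    show "integrable lborel (\<lambda>\<omega>. (cmod (F \<omega>))\<^sup>2)" by (rule sq_int_integrable[OF s(1)])
    show "\<forall>\<^sub>F R in at_top. AE \<omega> in lborel. norm ((cmod (trunc R F \<omega>))\<^sup>2) \<le> (cmod (F \<omega>))\<^sup>2"
      by (auto simp: trunc_def indicator_def)
    show "AE \<omega> in lborel. ((\<lambda>R. (cmod (trunc R F \<omega>))\<^sup>2) \<longlongrightarrow> (cmod (F \<omega>))\<^sup>2) at_top"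
    proof (rule AE_I2)
      fix \<omega> :: "real^'d"
      have "\<forall>\<^sub>F R in at_top. (cmod (trunc R F \<omega>))\<^sup>2 = (cmod (F \<omega>))\<^sup>2"
        using eventually_ge_at_top[of "norm \<omega>"] by eventually_elim (simp add: trunc_def)
      then show "((\<lambda>R. (cmod (trunc R F \<omega>))\<^sup>2) \<longlongrightarrow> (cmod (F \<omega>))\<^sup>2) at_top"
        by (rule tendsto_eventually)
    qed
    show "(\<lambda>\<omega>. (cmod (trunc R F \<omega>))\<^sup>2) \<in> borel_measurable lborel" for R
      using sq_int_measurable[OF sq_int_trunc[OF s(1)]] by measurable
  qed measurable
  then have "((\<lambda>R. sqrt (nsq lborel (trunc R F) / (2 * pi) ^ CARD('d))) \<longlongrightarrow> sqrt (nsq lborel F / (2 * pi) ^ CARD('d))) at_top"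
    by (intro tendsto_intros) auto
  then have 1: "((\<lambda>R. sqrt (nsq lborel (?fR R))) \<longlongrightarrow> sqrt (nsq lborel F / (2 * pi) ^ CARD('d))) at_top"
    by (simp only: nR)
  have "((\<lambda>R. sqrt (nsq lborel (?fR R)) - sqrt (nsq lborel f)) \<longlongrightarrow> 0) at_top"
  proof (rule Lim_null_comparison)
    show "((\<lambda>R. sqrt (nsq lborel (\<lambda>x. ?fR R x - f x))) \<longlongrightarrow> 0) at_top"
      using assms tendsto_real_sqrt[of _ 0 at_top] by (auto simp: L2_inv_fourier_alt)
    have "\<bar>sqrt (nsq lborel (?fR R)) - sqrt (nsq lborel f)\<bar> \<le> sqrt (nsq lborel (\<lambda>x. ?fR R x - f x))" for R
    proof -
      have sf: "sq_int lborel (?fR R)" by (rule sq_int_ift_trunc[OF s(1)])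
      have "sqrt (nsq lborel (?fR R)) \<le> sqrt (nsq lborel (\<lambda>x. ?fR R x - f x)) + sqrt (nsq lborel f)"
        using sqrt_nsq_triangle[OF sq_int_diff[OF sf s(2)] s(2)] by simp
      moreover have "sqrt (nsq lborel f) \<le> sqrt (nsq lborel (\<lambda>x. f x - ?fR R x)) + sqrt (nsq lborel (?fR R))"
        using sqrt_nsq_triangle[OF sq_int_diff[OF s(2) sf] sf] by simp
      moreover have "nsq lborel (\<lambda>x. f x - ?fR R x) = nsq lborel (\<lambda>x. ?fR R x - f x)"
        by (simp add: nsq_def norm_minus_commute)
      ultimately show ?thesis by (simp add: abs_le_iff)
    qed
    then show "\<forall>\<^sub>F R in at_top. norm (sqrt (nsq lborel (?fR R)) - sqrt (nsq lborel f)) \<le> sqrt (nsq lborel (\<lambda>x. ?fR R x - f x))"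
      by simp
  qed
  then have "((\<lambda>R. sqrt (nsq lborel (?fR R))) \<longlongrightarrow> sqrt (nsq lborel f)) at_top"
    using Lim_null by blast
  then have "sqrt (nsq lborel f) = sqrt (nsq lborel F / (2 * pi) ^ CARD('d))"
    using 1 tendsto_unique trivial_limit_at_top_linorder by blast
  then show ?thesis by (simp add: field_simps)
qed

text \<open>Polarization: the norm identity for F + c G with c = 1 and c = i gives the real and the
  imaginary part.\<close>

theorem inv_fourier_ip:
  fixes F f G g :: "real^'d \<Rightarrow> complex"
  assumes "L2_inv_fourier F f" "L2_inv_fourier G g"
  shows "ip lborel F G = (2 * pi) ^ CARD('d) * ip lborel f g"
proof -
  note s = inv_fourier_sq_int[OF assms(1)] inv_fourier_sq_int[OF assms(2)]
  let ?c = "(2 * pi) ^ CARD('d) :: real"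
  have *: "Re (cnj c * ip lborel F G) = ?c * Re (cnj c * ip lborel f g)" for c
    using inv_fourier_nsq[OF inv_fourier_add[OF assms(1) inv_fourier_cmult[OF assms(2), of c]]]
      inv_fourier_nsq[OF assms(1)] inv_fourier_nsq[OF assms(2)]
    by (simp add: nsq_add s sq_int_cmult nsq_cmult ip_cmult_right algebra_simps del: complex_cnj_mult times_complex.sel)
  have "Re (ip lborel F G) = ?c * Re (ip lborel f g)" using *[of 1] by simp
  moreover have "Im (ip lborel F G) = ?c * Im (ip lborel f g)" using *[of \<i>] by simp
  moreover have "(2 * pi) ^ CARD('d) * ip lborel f g = complex_of_real ?c * ip lborel f g" by simp
  ultimately show ?thesis by (simp only: complex_eq_iff) simp
qed

section \<open>Dilations, cosets and characters\<close>

text \<open>As a simp rule it would turn products with a transposed matrix into row-vector products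
  and hide the dual lattices.\<close>

declare transpose_matrix_vector [simp del]

lemma rvec_mult: "rvec (D *v k) = rmat D *v rvec k"
  by (simp add: vec_eq_iff matrix_vector_mult_def rmat_def)

lemma rmat_transpose: "rmat (transpose D) = transpose (rmat D)"
  by (simp add: vec_eq_iff transpose_def rmat_def)

lemma inner_transpose_mult: "x \<bullet> (transpose A *v y) = (A *v x) \<bullet> (y :: real^'n)"
  by (metis dot_lmul_matrix inner_commute vector_transpose_matrix transpose_matrix_vector)

section \<open>Integer powers of matrices\<close>

definition mpow :: "real^'d^'d \<Rightarrow> nat \<Rightarrow> real^'d^'d" where
  "mpow A n = (((**) A) ^^ n) (mat 1)"

lemma mpow_0 [simp]: "mpow A 0 = mat 1" and mpow_Suc: "mpow A (Suc n) = A ** mpow A n"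
  by (simp_all add: mpow_def)

lemma mpow_Suc_right: "mpow A (Suc n) = mpow A n ** A"
  by (induction n) (simp_all add: mpow_Suc matrix_mul_assoc)

lemma mpow_inverse: "A ** B = mat 1 \<Longrightarrow> mpow A n ** mpow B n = mat 1"
proof (induction n)
  case (Suc n)
  have "mpow A (Suc n) ** mpow B (Suc n) = mpow A n ** (A ** B) ** mpow B n"
    by (simp only: mpow_Suc_right[of A] mpow_Suc[of B] matrix_mul_assoc)
  then show ?case using Suc by simp
qed simp

lemma transpose_mpow: "transpose (mpow A n) = mpow (transpose A) n"
proof (induction n)
  case (Suc n)
  then show ?case
    by (simp only: mpow_Suc[of A] mpow_Suc_right[of "transpose A"] matrix_transpose_mul)
qed simp

lemma matrix_inv_both:
  assumes "invertible (A :: real^'d^'d)"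
  shows "A ** matrix_inv A = mat 1" "matrix_inv A ** A = mat 1"
  using someI_ex[OF assms[unfolded invertible_def]] by (simp_all add: matrix_inv_def)

lemma inverse_matrix_unique:
  assumes "A ** B = mat 1" "A ** C = mat 1"
  shows "B = (C :: real^'d^'d)"
  by (metis assms matrix_left_right_inverse matrix_mul_assoc matrix_mul_lid matrix_mul_rid)

lemma invertible_transpose_real: "invertible (A :: real^'d^'d) \<Longrightarrow> invertible (transpose A)"
  unfolding invertible_def by (metis matrix_transpose_mul transpose_mat)

lemma transpose_matrix_inv:
  assumes "invertible (A :: real^'d^'d)"
  shows "transpose (matrix_inv A) = matrix_inv (transpose A)"
proof (rule inverse_matrix_unique)
  show "transpose A ** transpose (matrix_inv A) = mat 1"
    using matrix_inv_both[OF assms] by (metis matrix_transpose_mul transpose_mat)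
  show "transpose A ** matrix_inv (transpose A) = mat 1"
    by (rule matrix_inv_both[OF invertible_transpose_real[OF assms]])
qed

lemma mat_zpow_mpow:
  "mat_zpow A j = (if j \<ge> 0 then mpow A (nat j) else mpow (matrix_inv A) (nat (- j)))"
  by (simp add: mat_zpow_def mpow_def)

lemma mat_zpow_minus:
  assumes "invertible A"
  shows "mat_zpow A (- j) ** mat_zpow A j = mat 1"
  using matrix_inv_both[OF assms] by (auto simp: mat_zpow_mpow mpow_inverse)

lemma transpose_mat_zpow:
  assumes "invertible A"
  shows "transpose (mat_zpow A j) = mat_zpow (transpose A) j"
  by (simp add: mat_zpow_mpow transpose_mpow transpose_matrix_inv[OF assms])

lemma mat_zpow_add_1:
  assumes "invertible A"
  shows "mat_zpow A (j + 1) = mat_zpow A j ** A"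
proof (cases "j \<ge> 0")
  case True
  then have "nat (j + 1) = Suc (nat j)" by simp
  then show ?thesis using True by (simp add: mat_zpow_mpow mpow_Suc_right)
next
  case False
  then obtain m where m: "nat (- j) = Suc m" by (cases "nat (- j)") auto
  then have "mat_zpow A j ** A = mpow (matrix_inv A) m"
    using False matrix_inv_both[OF assms]
    by (simp add: mat_zpow_mpow mpow_Suc_right matrix_mul_assoc[symmetric])
  moreover have "mat_zpow A (j + 1) = mpow (matrix_inv A) m"
  \<comment> \<open>For j = -1 the exponent j + 1 falls under the other branch of the definition of
    \<open>mat_zpow\<close>.\<close>
  proof (cases "m = 0")
    case True
    then have "j = -1" using m by simp
    then show ?thesis using True by (simp add: mat_zpow_mpow)
  next
    case False
    then have "\<not> j + 1 \<ge> 0" "nat (- (j + 1)) = m" using m by auto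
    then show ?thesis by (simp add: mat_zpow_mpow)
  qed
  ultimately show ?thesis by simp
qed

lemma mat_zpow_diff_1:
  assumes "invertible A"
  shows "mat_zpow A (j - 1) = mat_zpow A j ** matrix_inv A"
  using mat_zpow_add_1[OF assms, of "j - 1"] matrix_inv_both[OF assms]
  by (simp add: matrix_mul_assoc[symmetric])

section \<open>Coset representatives\<close>

lemma coset_reps_unique:
  assumes "coset_reps D n e" "m < n" "m' < n" "e m - e m' = D *v l"
  shows "m = m'"
proof -
  have "\<exists>!m'. m' < n \<and> (\<exists>l. e m - e m' = D *v l)" using assms(1) by (simp add: coset_reps_def)
  moreover have "e m - e m = D *v 0" by simp
  ultimately show ?thesis using assms by metis
qed

lemma coset_reps_ex:
  assumes "coset_reps D n e"
  obtains m l where "m < n" "k = e m + D *v l"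
proof -
  obtain m l where "m < n" "k - e m = D *v l" using assms unfolding coset_reps_def by blast
  then show ?thesis by (intro that[of m l]) (auto simp: algebra_simps)
qed

text \<open>At most one weight is below \<open>\<delta> / 2\<close>, and its term is minus the sum of the others.\<close>

lemma weighted_sum_lower_bound:
  fixes w :: "nat \<Rightarrow> real" and a :: "nat \<Rightarrow> complex"
  assumes w: "\<And>l. l < n \<Longrightarrow> 0 \<le> w l" and \<delta>: "\<delta> > 0"
    and pairs: "\<And>l l'. l < n \<Longrightarrow> l' < n \<Longrightarrow> l \<noteq> l' \<Longrightarrow> \<delta> \<le> w l + w l'"
    and a: "(\<Sum>l<n. a l) = 0"
  shows "\<delta> / (2 * real n) * (\<Sum>l<n. (cmod (a l))\<^sup>2) \<le> (\<Sum>l<n. w l * (cmod (a l))\<^sup>2)"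
proof (cases "n = 0")
  case False
  then obtain l0 where l0: "l0 < n" "\<And>l. l < n \<Longrightarrow> w l0 \<le> w l"
    using ex_min_if_finite[of "w ` {..<n}"]
    by (metis (no_types, lifting) arg_min_if_finite(1) arg_min_least empty_iff finite_lessThan lessThan_iff not_gr_zero)
  let ?I = "{..<n} - {l0}"
  have big: "\<delta> / 2 \<le> w l" if "l \<in> ?I" for l
    using pairs[of l l0] l0(2)[of l] l0(1) that by fastforce
  have "a l0 = - (\<Sum>l\<in>?I. a l)"
    using a l0(1) by (simp add: sum.remove[of _ l0] eq_neg_iff_add_eq_0)
  then have "cmod (a l0) \<le> (\<Sum>l\<in>?I. cmod (a l))" by (simp add: norm_sum)
  then have "(cmod (a l0))\<^sup>2 \<le> (\<Sum>l\<in>?I. cmod (a l))\<^sup>2" by (rule power_mono) simp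
  also have "\<dots> \<le> (\<Sum>l\<in>?I. (cmod (a l))\<^sup>2) * (real n - 1)"
    using sum_squared_le_sum_of_squares[of "\<lambda>l. cmod (a l)" ?I] l0(1) by (simp add: of_nat_diff)
  finally have "(\<Sum>l<n. (cmod (a l))\<^sup>2) \<le> real n * (\<Sum>l\<in>?I. (cmod (a l))\<^sup>2)"
    using l0(1) by (simp add: sum.remove[of _ l0] algebra_simps)
  also have "\<dots> \<le> real n * (\<Sum>l\<in>?I. 2 / \<delta> * (w l * (cmod (a l))\<^sup>2))"
  proof (intro mult_left_mono sum_mono)
    fix l assume "l \<in> ?I"
    then have "\<delta> / 2 * (cmod (a l))\<^sup>2 \<le> w l * (cmod (a l))\<^sup>2" by (intro mult_right_mono big) auto
    then show "(cmod (a l))\<^sup>2 \<le> 2 / \<delta> * (w l * (cmod (a l))\<^sup>2)" using \<delta> by (simp add: field_simps)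
  qed simp
  also have "\<dots> \<le> real n * (\<Sum>l<n. 2 / \<delta> * (w l * (cmod (a l))\<^sup>2))"
    using w \<delta> by (intro mult_left_mono sum_mono2) auto
  also have "\<dots> = 2 * real n / \<delta> * (\<Sum>l<n. w l * (cmod (a l))\<^sup>2)"
    by (simp add: sum_distrib_left mult_ac)
  finally show ?thesis using \<delta> False by (simp add: field_simps)
qed simp

text \<open>\<open>B\<close> is the inverse of the transposed dilation, and \<open>lam\<close> below
  gives the points of the dual lattice of scale j + 1. The vectors \<open>e\<close> serve twice:
  modulo D they index the wavelets, modulo the transpose of D the cosets of the two dual
  lattices.\<close>

locale refinement = lattice T S for T S :: "real^'d^'d" +
  fixes D :: "int^'d^'d" and B :: "real^'d^'d" and e :: "nat \<Rightarrow> int^'d" and n :: nat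
  assumes DB: "transpose (rmat D) ** B = mat 1" and e_0: "e 0 = 0"
    and reps: "coset_reps D n e" and reps': "coset_reps (transpose D) n e"
begin

definition lam :: "int^'d \<Rightarrow> real^'d" where "lam v = T *v (B *v rvec v)"

lemma lam_add: "lam (v + w) = lam v + lam w" and lam_diff: "lam (v - w) = lam v - lam w"
  and lam_0 [simp]: "lam 0 = 0"
  by (simp_all add: lam_def rvec_add rvec_diff matrix_vector_right_distrib matrix_vector_mult_diff_distrib)

lemma BD: "B ** transpose (rmat D) = mat 1"
  using DB by (simp add: matrix_left_right_inverse)

lemma lam_transpose: "lam (transpose D *v l) = pt l"
  by (simp add: lam_def pt_def rvec_mult rmat_transpose matrix_vector_mul_assoc BD)

lemma n_pos: "n > 0"
  using coset_reps_ex[OF reps, of 0] by (metis gr_implies_not0 neq0_conv)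

lemma chr_lam: "chr k (lam v) = cis (2 * pi * (rvec k \<bullet> (B *v rvec v)))"
  by (simp add: chr_def lam_def)

lemma chr_lam_D [simp]: "chr (D *v k) (lam v) = 1"
proof -
  have "rvec (D *v k) \<bullet> (B *v rvec v) = rvec k \<bullet> rvec v"
    by (simp add: rvec_mult inner_transpose_mult[symmetric] matrix_vector_mul_assoc DB)
  then show ?thesis by (simp only: chr_lam cis_2pi_Ints[OF rvec_inner_Ints])
qed

text \<open>Adding y permutes the cosets; the induced map on indices is injective on a finite set,
  hence bijective, and \<open>F\<close> absorbs the lattice points left over.\<close>

lemma sum_lam_shift:
  assumes F: "per F"
  shows "(\<Sum>m<n. F (\<omega> + lam (e m) + lam y)) = (\<Sum>m<n. F (\<omega> + lam (e m)) :: 'b :: comm_monoid_add)"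
proof -
  define \<sigma> where "\<sigma> m = (SOME m'. m' < n \<and> (\<exists>l. e m + y = e m' + transpose D *v l))" for m
  have \<sigma>: "\<sigma> m < n \<and> (\<exists>l. e m + y = e (\<sigma> m) + transpose D *v l)" for m
  proof -
    have "\<exists>m'. m' < n \<and> (\<exists>l. e m + y = e m' + transpose D *v l)"
      using coset_reps_ex[OF reps', of "e m + y"] by metis
    then show ?thesis unfolding \<sigma>_def by (rule someI_ex)
  qed
  have inj: "inj_on \<sigma> {..<n}"
  proof (rule inj_onI)
    fix m m' assume m: "m \<in> {..<n}" "m' \<in> {..<n}" "\<sigma> m = \<sigma> m'"
    obtain l l' where l: "e m + y = e (\<sigma> m) + transpose D *v l" "e m' + y = e (\<sigma> m') + transpose D *v l'"
      using \<sigma> by blast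
    have "e m - e m' = (e m + y) - (e m' + y)" by simp
    also have "\<dots> = transpose D *v (l - l')"
      unfolding l m(3) by (simp add: matrix_vector_mult_diff_distrib)
    finally show "m = m'" using coset_reps_unique[OF reps'] m by simp
  qed
  then have bij: "bij_betw \<sigma> {..<n} {..<n}"
    using \<sigma> by (simp add: bij_betw_def endo_inj_surj image_subset_iff)
  have "F (\<omega> + lam (e m) + lam y) = F (\<omega> + lam (e (\<sigma> m)))" for m
  proof -
    obtain l where l: "e m + y = e (\<sigma> m) + transpose D *v l" using \<sigma> by blast
    have "lam (e m) + lam y = lam (e (\<sigma> m)) + pt l"
      by (simp only: lam_add[symmetric] l) (simp only: lam_add lam_transpose)
    then show ?thesis using perD[OF F, of "\<omega> + lam (e (\<sigma> m))" l] by (simp add: add.assoc)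
  qed
  then show ?thesis
    using sum.reindex_bij_betw[OF bij, of "\<lambda>m. F (\<omega> + lam (e m))"] by simp
qed

text \<open>Duality of the lattices: the values at the unit vectors show that k is carried to an
  integer vector by the transpose of \<open>B\<close>, and that vector is the required z.\<close>

lemma chr_lam_all_1:
  assumes "\<And>m. m < n \<Longrightarrow> chr k (lam (e m)) = 1"
  shows "\<exists>z. k = D *v z"
proof -
  have all: "chr k (lam v) = 1" for v
  proof -
    obtain m l where "m < n" "v = e m + transpose D *v l" by (rule coset_reps_ex[OF reps'])
    then show ?thesis using assms by (simp add: lam_add lam_transpose chr_add_arg)
  qed
  have "\<exists>z. (transpose B *v rvec k) $ i = real_of_int z" for i
  proof -
    have "(transpose B *v rvec k) $ i = rvec (axis i 1) \<bullet> (transpose B *v rvec k)"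
      by (simp add: rvec_axis inner_axis')
    also have "\<dots> = rvec k \<bullet> (B *v rvec (axis i 1))"
      by (simp add: inner_transpose_mult inner_commute)
    finally have "(transpose B *v rvec k) $ i \<in> \<int>"
      using all[of "axis i 1"] by (simp add: chr_lam cis_eq_1_imp_Ints)
    then show ?thesis by (auto elim: Ints_cases)
  qed
  then obtain z where "\<And>i. (transpose B *v rvec k) $ i = real_of_int (z i)" by metis
  then have z: "transpose B *v rvec k = rvec (\<chi> i. z i)" by (simp add: vec_eq_iff)
  have "rmat D ** transpose B = mat 1"
    using arg_cong[OF BD, of transpose] by (simp add: matrix_transpose_mul)
  then have "rvec k = rmat D *v (transpose B *v rvec k)"
    by (simp add: matrix_vector_mul_assoc)
  also have "\<dots> = rvec (D *v (\<chi> i. z i))" by (simp only: z rvec_mult)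
  finally show ?thesis by auto
qed

text \<open>Orthogonality on a finite group: by shift invariance the sum equals itself times a
  character value different from 1.\<close>

lemma chr_sum_lam:
  assumes "\<nexists>z. k = D *v z"
  shows "(\<Sum>m<n. chr k (lam (e m))) = 0"
proof -
  obtain m0 where "chr k (lam (e m0)) \<noteq> 1" using chr_lam_all_1[of k] assms by blast
  moreover have "(\<Sum>m<n. chr k (lam (e m))) * chr k (lam (e m0)) = (\<Sum>m<n. chr k (lam (e m)))"
    using sum_lam_shift[OF per_chr[of k], of 0 "e m0"] by (simp add: chr_add_arg sum_distrib_right)
  ultimately show ?thesis by simp
qed

text \<open>Chosen so that \<open>mat_zpow (rmat D) j\<close> maps \<open>freq (m, k)\<close> to the
  total translation of the wavelet with index (m, k).\<close>

definition freq :: "nat \<times> (int^'d) \<Rightarrow> int^'d" where "freq = (\<lambda>(m, k). D *v k + e m)"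

lemma rmat_D_inj: "D *v k = D *v k' \<Longrightarrow> k = k'"
proof -
  assume "D *v k = D *v k'"
  then have "rmat D *v rvec k = rmat D *v rvec k'" by (simp only: rvec_mult[symmetric])
  moreover have "transpose B ** rmat D = mat 1"
    using arg_cong[OF DB, of transpose] by (simp add: matrix_transpose_mul)
  ultimately have "rvec k = rvec k'" by (metis matrix_vector_mul_assoc matrix_vector_mul_lid)
  then show ?thesis by simp
qed

text \<open>With the next two lemmas, \<open>freq\<close> enumerates the integer vectors outside the
  image of D without repetition; m starts at 1 because e 0 = 0 represents the trivial coset.\<close>

lemma freq_inj: "inj_on freq ({1..n - 1} \<times> UNIV)"
proof (rule inj_onI)
  fix i i' :: "nat \<times> (int^'d)"
  obtain m k m' k' where i: "i = (m, k)" "i' = (m', k')" by (cases i, cases i')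
  assume "i \<in> {1..n - 1} \<times> UNIV" "i' \<in> {1..n - 1} \<times> UNIV" and eq: "freq i = freq i'"
  then have m: "m < n" "m' < n" using i n_pos by auto
  have "e m - e m' = D *v (k' - k)"
    using eq i by (simp add: freq_def matrix_vector_mult_diff_distrib algebra_simps)
  then have "m = m'" using coset_reps_unique[OF reps] m by blast
  moreover have "k = k'" using eq i \<open>m = m'\<close> by - (rule rmat_D_inj, simp add: freq_def)
  ultimately show "i = i'" using i by simp
qed

lemma freq_not_D:
  assumes "i \<in> {1..n - 1} \<times> UNIV"
  shows "\<nexists>z. freq i = D *v z"
proof
  assume "\<exists>z. freq i = D *v z"
  then obtain z where z: "freq i = D *v z" by blast
  obtain m k where i: "i = (m, k)" "m \<in> {1..n - 1}" using assms by (cases i) auto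
  have "e m - e 0 = D *v (z - k)" using z i by (simp add: freq_def e_0 matrix_vector_mult_diff_distrib algebra_simps)
  moreover have "m < n" using i n_pos by auto
  ultimately have "m = 0" using coset_reps_unique[OF reps, of m 0] n_pos by blast
  then show False using i by simp
qed

lemma freq_surj:
  assumes "\<nexists>z. k = D *v z"
  shows "k \<in> freq ` ({1..n - 1} \<times> UNIV)"
proof -
  obtain m l where m: "m < n" "k = e m + D *v l" by (rule coset_reps_ex[OF reps])
  then have "m \<noteq> 0" using assms by (metis add_0 e_0)
  then have "(m, l) \<in> {1..n - 1} \<times> UNIV" "k = freq (m, l)" using m by (auto simp: freq_def)
  then show ?thesis by blast
qed

text \<open>If the coordinate characters were all 1 there, \<open>B\<close> would map e m to an
  integer vector, putting e m in the coset of e 0. The separating character later keeps a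
  neighbourhood disjoint from its translate.\<close>

lemma lam_not_lattice:
  assumes "m \<in> {1..n - 1}"
  shows "\<exists>k. chr k (lam (e m)) \<noteq> 1"
proof (rule ccontr)
  assume "\<nexists>k. chr k (lam (e m)) \<noteq> 1"
  then have all: "chr (axis i 1) (lam (e m)) = 1" for i by blast
  have "\<exists>z. (B *v rvec (e m)) $ i = real_of_int z" for i
  proof -
    have "(B *v rvec (e m)) $ i \<in> \<int>"
      using all[of i] by (simp add: chr_lam rvec_axis inner_axis' cis_eq_1_imp_Ints)
    then show ?thesis by (auto elim: Ints_cases)
  qed
  then obtain z where "\<And>i. (B *v rvec (e m)) $ i = real_of_int (z i)" by metis
  then have z: "B *v rvec (e m) = rvec (\<chi> i. z i)" by (simp add: vec_eq_iff)
  have "rvec (e m) = transpose (rmat D) *v (B *v rvec (e m))"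
    by (simp add: matrix_vector_mul_assoc DB)
  also have "\<dots> = rvec (transpose D *v (\<chi> i. z i))" by (simp only: z rvec_mult rmat_transpose)
  finally have "e m - e 0 = transpose D *v (\<chi> i. z i)" by (simp add: e_0)
  moreover have "m < n" using assms n_pos by auto
  ultimately have "m = 0" using coset_reps_unique[OF reps', of m 0] n_pos by blast
  then show False using assms by simp
qed

text \<open>Reduces any pair of distinct cosets to the pair of 0 and e m, the only pairs that the
  condition on the zeros mentions.\<close>

lemma lam_diff_cosets:
  assumes "l < n" "l' < n" "l \<noteq> l'"
  shows "\<exists>m\<in>{1..n - 1}. \<exists>k. lam (e l') = lam (e l) + lam (e m) + pt k"
proof -
  obtain m k where m: "m < n" "e l' - e l = e m + transpose D *v k" by (rule coset_reps_ex[OF reps'])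
  have "m \<noteq> 0"
  proof
    assume "m = 0"
    then have "e l' - e l = transpose D *v k" using m by (simp add: e_0)
    then show False using coset_reps_unique[OF reps', of l' l] assms by auto
  qed
  moreover have "lam (e l') = lam (e l) + lam (e m) + pt k"
    using arg_cong[OF m(2), of lam] by (simp add: lam_diff lam_add lam_transpose algebra_simps)
  ultimately show ?thesis using m(1) by (intro bexI[of _ m] exI[of _ k]) auto
qed

lemma bij_cosets: "bij_betw (\<lambda>(m, k). e m + transpose D *v k) ({..<n} \<times> UNIV) UNIV"
proof (rule bij_betwI')
  fix i i' :: "nat \<times> (int^'d)"
  assume i: "i \<in> {..<n} \<times> UNIV" "i' \<in> {..<n} \<times> UNIV"
  obtain m k m' k' where i': "i = (m, k)" "i' = (m', k')" by (cases i, cases i')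
  show "((case i of (m, k) \<Rightarrow> e m + transpose D *v k) = (case i' of (m, k) \<Rightarrow> e m + transpose D *v k)) = (i = i')"
  proof
    assume "(case i of (m, k) \<Rightarrow> e m + transpose D *v k) = (case i' of (m, k) \<Rightarrow> e m + transpose D *v k)"
    then have eq: "e m + transpose D *v k = e m' + transpose D *v k'" by (simp add: i')
    then have "e m - e m' = transpose D *v (k' - k)"
      by (simp add: matrix_vector_mult_diff_distrib algebra_simps)
    then have "m = m'" using coset_reps_unique[OF reps'] i i' by simp
    with eq have "lam (transpose D *v k) = lam (transpose D *v k')" by simp
    then have "S *v pt k = S *v pt k'" by (simp only: lam_transpose)
    then show "i = i'" using \<open>m = m'\<close> i' by (simp add: pt_def)
  qed simp
next
  fix k :: "int^'d"
  obtain m l where "m < n" "k = e m + transpose D *v l" by (rule coset_reps_ex[OF reps'])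
  then show "\<exists>i\<in>{..<n} \<times> UNIV. k = (case i of (m, k) \<Rightarrow> e m + transpose D *v k)"
    by (intro bexI[of _ "(m, l)"]) auto
qed simp

end

section \<open>The weight of a symbol\<close>

text \<open>The device that turns almost-everywhere hypotheses on continuous functions into
  pointwise ones: a strict violation would hold on a nonempty open set.\<close>

lemma open_AE_ex:
  fixes U :: "'a::euclidean_space set"
  assumes "open U" "U \<noteq> {}" "AE x in lborel. P x"
  shows "\<exists>x\<in>U. P x"
proof (rule ccontr)
  assume *: "\<not> (\<exists>x\<in>U. P x)"
  have "AE x in lborel. x \<notin> U" using assms(3) by eventually_elim (use * in auto)
  then have "U \<in> null_sets lborel" using assms(1) by (simp add: AE_iff_null_sets)
  then have "negligible U" by (simp add: negligible_iff_null_sets null_sets_completionI)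
  then show False using open_not_negligible assms by blast
qed

section \<open>Summable majorants on the integer lattice\<close>

lemma summable_int_powr:
  fixes s :: real
  assumes "s > 1"
  shows "(\<lambda>n::int. (1 + \<bar>real_of_int n\<bar>) powr (- s)) summable_on UNIV"
proof -
  have "summable (\<lambda>n. real (Suc n) powr (- s))"
    using assms by (subst summable_Suc_iff) (simp add: summable_real_powr_iff)
  then have nat: "(\<lambda>n. (1 + real n) powr (- s)) summable_on UNIV"
    by (subst summable_on_UNIV_nonneg_real_iff) (auto simp: add.commute)
  have pos: "(\<lambda>n::int. (1 + \<bar>real_of_int n\<bar>) powr (- s)) summable_on range int"
    by (subst summable_on_reindex) (use nat in \<open>auto simp: o_def\<close>)
  have neg: "(\<lambda>n::int. (1 + \<bar>real_of_int n\<bar>) powr (- s)) summable_on range (\<lambda>n. - int n)"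
    by (subst summable_on_reindex) (use nat in \<open>auto simp: o_def inj_def\<close>)
  have "(UNIV :: int set) = range int \<union> (range (\<lambda>n. - int n) - range int)"
  proof -
    have "x \<in> range int \<or> x \<in> range (\<lambda>n. - int n)" for x
      by (cases x rule: int_cases2) auto
    then show ?thesis by auto
  qed
  moreover have "(\<lambda>n::int. (1 + \<bar>real_of_int n\<bar>) powr (- s)) summable_on (range int \<union> (range (\<lambda>n. - int n) - range int))"
    by (intro summable_on_Un_disjoint pos summable_on_subset_banach[OF neg]) auto
  ultimately show ?thesis by simp
qed

text \<open>A finite set of vectors lies in a box N^d, over which the sum of products factors into a
  product of sums.\<close>

lemma summable_prod_vec:
  fixes a :: "'k \<Rightarrow> real"
  assumes a: "a summable_on UNIV" "\<And>x. 0 \<le> a x"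
  shows "(\<lambda>k :: 'k^'d. \<Prod>i\<in>UNIV. a (k $ i)) summable_on UNIV"
proof (rule nonneg_bdd_above_summable_on)
  show "bdd_above (sum (\<lambda>k :: 'k^'d. \<Prod>i\<in>UNIV. a (k $ i)) ` {F. F \<subseteq> UNIV \<and> finite F})"
  proof (rule bdd_aboveI2)
    fix K :: "('k^'d) set" assume "K \<in> {F. F \<subseteq> UNIV \<and> finite F}"
    then have K: "finite K" by simp
    define N where "N = (\<Union>k\<in>K. range (($) k))"
    have N: "finite N" using K by (simp add: N_def)
    have "(\<Sum>k\<in>K. \<Prod>i\<in>UNIV. a (k $ i)) = (\<Sum>h\<in>($) ` K. \<Prod>i\<in>UNIV. a (h i))"
      by (subst sum.reindex) (auto simp: inj_on_def vec_nth_inject)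
    also have "\<dots> \<le> (\<Sum>h\<in>PiE (UNIV :: 'd set) (\<lambda>_. N). \<Prod>i\<in>UNIV. a (h i))"
      by (rule sum_mono2) (use N a(2) in \<open>auto simp: N_def intro!: finite_PiE prod_nonneg\<close>)
    also have "\<dots> = (\<Prod>i\<in>(UNIV :: 'd set). \<Sum>x\<in>N. a x)"
      by (rule prod_sum_PiE[symmetric]) (use N in auto)
    also have "\<dots> \<le> (\<Prod>i\<in>(UNIV :: 'd set). infsum a UNIV)"
      by (rule prod_mono) (use N a in \<open>auto intro!: sum_nonneg finite_sum_le_infsum\<close>)
    finally show "(\<Sum>k\<in>K. \<Prod>i\<in>UNIV. a (k $ i)) \<le> (\<Prod>i\<in>(UNIV :: 'd set). infsum a UNIV)" .
  qed
qed (use a(2) in \<open>auto intro: prod_nonneg\<close>)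

text \<open>
  A majorant of \<open>\<bar>k\<bar> powr (- 2 r)\<close> that is a product over the coordinates, and hence summable as soon
  as \<open>2 r / d > 1\<close>.
\<close>

definition lattice_weight :: "real \<Rightarrow> int^'d \<Rightarrow> real" where
  "lattice_weight r k = (\<Prod>i\<in>UNIV. (1 + \<bar>real_of_int (k $ i)\<bar>) powr (- (2 * r / real CARD('d))))"

lemma lattice_weight_summable:
  assumes "r > real CARD('d) / 2"
  shows "(lattice_weight r :: int^'d \<Rightarrow> real) summable_on UNIV"
proof -
  have "2 * r / real CARD('d) > 1" using assms by (simp add: field_simps)
  from summable_prod_vec[OF summable_int_powr[OF this]] show ?thesis
    unfolding lattice_weight_def[abs_def] by simp
qed

text \<open>A nonzero integer vector has norm at least 1, so 1 plus the modulus of any coordinate is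
  at most twice the norm; the d exponents 2r/d add up to 2r.\<close>

lemma norm_powr_le_lattice_weight:
  fixes k :: "int^'d"
  assumes r: "r > 0" and k: "k \<noteq> 0"
  shows "norm (rvec k) powr (- (2 * r)) \<le> 2 powr (2 * r) * lattice_weight r k"
proof -
  let ?d = "real CARD('d)"
  obtain i where "k $ i \<noteq> 0" using k by (auto simp: vec_eq_iff)
  then have "1 \<le> \<bar>real_of_int (k $ i)\<bar>" by linarith
  then have n1: "1 \<le> norm (rvec k)" using component_le_norm_cart[of "rvec k" i] by simp
  have "1 + \<bar>real_of_int (k $ i)\<bar> \<le> 2 * norm (rvec k)" for i
    using component_le_norm_cart[of "rvec k" i] n1 by simp
  then have "(2 * norm (rvec k)) powr (- (2 * r / ?d)) \<le> (1 + \<bar>real_of_int (k $ i)\<bar>) powr (- (2 * r / ?d))" for i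
    using r by (intro powr_mono2') (auto simp: divide_nonneg_pos)
  then have "(\<Prod>i\<in>(UNIV :: 'd set). (2 * norm (rvec k)) powr (- (2 * r / ?d))) \<le> lattice_weight r k"
    unfolding lattice_weight_def by (intro prod_mono) auto
  also have "(\<Prod>i\<in>(UNIV :: 'd set). (2 * norm (rvec k)) powr (- (2 * r / ?d))) = (2 * norm (rvec k)) powr (- (2 * r))"
  proof -
    have "0 < (2 * norm (rvec k)) powr (- (2 * r / ?d))" using n1 by (subst powr_gt_zero) linarith
    from powr_realpow[OF this, of "CARD('d)"] show ?thesis by (simp add: powr_powr)
  qed
  finally have "(2 * norm (rvec k)) powr (- (2 * r)) \<le> lattice_weight r k" .
  then have "2 powr (2 * r) * (2 * norm (rvec k)) powr (- (2 * r)) \<le> 2 powr (2 * r) * lattice_weight r k"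
    by (intro mult_left_mono) auto
  moreover have "2 powr (2 * r) * (2 * norm (rvec k)) powr (- (2 * r)) = norm (rvec k) powr (- (2 * r))"
    by (simp add: powr_mult mult.assoc[symmetric] powr_add[symmetric])
  ultimately show ?thesis by simp
qed

text \<open>The assumption \<open>lower\<close> is what the localization condition says about the
  symbol once the bounded filter has been divided out.\<close>

locale symbol_lattice = lattice T S for T S :: "real^'d^'d" +
  fixes f g :: "real^'d \<Rightarrow> complex" and r C c :: real
  assumes cont_f: "continuous_on UNIV f" and cont_g: "continuous_on UNIV g"
    and null_fg: "{\<omega>. f \<omega> * g \<omega> = 0} \<in> null_sets lborel"
    and disj_fg: "{\<omega>. f \<omega> = 0} \<inter> {\<omega>. g \<omega> = 0} = {}"
    and r: "r > real CARD('d) / 2" and C: "C > 0"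
    and growth: "AE \<omega> in lborel. norm \<omega> powr (2 * r) \<le> C * (1 + (cmod (symbol f g \<omega>))\<^sup>2)"
    and c: "c > 0"
    and lower: "AE \<omega> in lborel. c \<le> (\<Sum>\<^sub>\<infinity>k\<in>UNIV. (cmod (g (\<omega> + pt k) / f (\<omega> + pt k)))\<^sup>2)"
begin

definition u :: "real^'d \<Rightarrow> complex" where "u \<omega> = g \<omega> / f \<omega>"

definition M :: "real^'d \<Rightarrow> real" where "M \<omega> = (\<Sum>\<^sub>\<infinity>k\<in>UNIV. (cmod (u (\<omega> + pt k)))\<^sup>2)"

definition Z :: "(real^'d) set" where "Z = {\<omega>. \<exists>k. f (\<omega> + pt k) = 0}"

text \<open>On \<open>Z\<close> the series M omits poles, since division by zero gives 0 in HOL; the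
  value 0 prescribed there is the limit of 1/M.\<close>

definition w :: "real^'d \<Rightarrow> real" where "w \<omega> = (if \<omega> \<in> Z then 0 else 1 / M \<omega>)"

section \<open>Decay of the inverse symbol\<close>

lemma r_pos: "r > 0"
proof -
  have "0 < real CARD('d) / 2" by simp
  then show ?thesis using r by linarith
qed

lemma f_measurable [measurable]: "f \<in> borel_measurable borel"
  and g_measurable [measurable]: "g \<in> borel_measurable borel"
  by (rule borel_measurable_continuous_onI; rule cont_f cont_g)+

lemma u_measurable [measurable]: "u \<in> borel_measurable borel"
  unfolding u_def[abs_def] by measurable

text \<open>Multiplied by |g|^2 the growth condition compares continuous functions, so its failure
  at one point would persist on an open set. Staying outside the unit ball keeps the base of the
  power away from 0.\<close>

lemma growth_everywhere:
  assumes "norm \<omega> > 1"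
  shows "norm \<omega> powr (2 * r) * (cmod (g \<omega>))\<^sup>2 \<le> C * ((cmod (g \<omega>))\<^sup>2 + (cmod (f \<omega>))\<^sup>2)"
proof (rule ccontr)
  assume neg: "\<not> ?thesis"
  let ?h = "\<lambda>\<omega>. norm \<omega> powr (2 * r) * (cmod (g \<omega>))\<^sup>2 - C * ((cmod (g \<omega>))\<^sup>2 + (cmod (f \<omega>))\<^sup>2)"
  define V where "V = (- cball 0 1 :: (real^'d) set)"
  have V: "open V" unfolding V_def by (intro open_Compl closed_cball)
  have "continuous_on V ?h"
    by (intro continuous_intros continuous_on_subset[OF cont_f] continuous_on_subset[OF cont_g])
       (auto simp: V_def)
  from continuous_open_preimage[OF this V open_greaterThan[of 0]]
  have op: "open (V \<inter> ?h -` {0<..})" .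
  have "\<omega> \<in> V \<inter> ?h -` {0<..}" using neg assms by (auto simp: V_def)
  then have ne: "V \<inter> ?h -` {0<..} \<noteq> {}" by blast
  have "AE \<omega> in lborel. norm \<omega> powr (2 * r) \<le> C * (1 + (cmod (symbol f g \<omega>))\<^sup>2) \<and> f \<omega> * g \<omega> \<noteq> 0"
    using growth AE_not_in[OF null_fg] by eventually_elim auto
  from open_AE_ex[OF op ne this] obtain \<eta> where \<eta>: "0 < ?h \<eta>" "norm \<eta> powr (2 * r) \<le> C * (1 + (cmod (symbol f g \<eta>))\<^sup>2)"
    "f \<eta> * g \<eta> \<noteq> 0"
    by (auto simp only: Int_iff vimage_eq greaterThan_iff)
  have "norm \<eta> powr (2 * r) * (cmod (g \<eta>))\<^sup>2 \<le> C * (1 + (cmod (symbol f g \<eta>))\<^sup>2) * (cmod (g \<eta>))\<^sup>2"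
    using \<eta>(2) by (rule mult_right_mono) simp
  also have "\<dots> = C * ((cmod (g \<eta>))\<^sup>2 + (cmod (f \<eta>))\<^sup>2)"
    using \<eta>(3) by (simp add: symbol_def norm_divide field_simps)
  finally show False using \<eta>(1) by simp
qed

lemma decay:
  obtains R where "R \<ge> 1" "\<And>\<omega>. norm \<omega> \<ge> R \<Longrightarrow> f \<omega> \<noteq> 0"
    "\<And>\<omega>. norm \<omega> \<ge> R \<Longrightarrow> (cmod (u \<omega>))\<^sup>2 \<le> 2 * C * norm \<omega> powr (- (2 * r))"
proof -
  \<comment> \<open>From this radius on |\<omega>|^(2r) is at least 2C, so that half of the left
    side of the growth condition absorbs C |g|^2.\<close>
  define R where "R = max 2 ((2 * C) powr (1 / (2 * r)))"
  have *: "f \<omega> \<noteq> 0 \<and> (cmod (u \<omega>))\<^sup>2 \<le> 2 * C * norm \<omega> powr (- (2 * r))" if "norm \<omega> \<ge> R" for \<omega>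
  proof -
    have n: "norm \<omega> > 1" "(2 * C) powr (1 / (2 * r)) \<le> norm \<omega>" using that by (auto simp: R_def)
    have "((2 * C) powr (1 / (2 * r))) powr (2 * r) \<le> norm \<omega> powr (2 * r)"
      using n r_pos by (intro powr_mono2) auto
    then have big: "2 * C \<le> norm \<omega> powr (2 * r)" using r_pos C by (simp add: powr_powr)
    let ?p = "norm \<omega> powr (2 * r)"
    have "norm \<omega> > 0" using n by linarith
    then have p: "?p > 0" by simp
    have "C * (cmod (g \<omega>))\<^sup>2 \<le> ?p / 2 * (cmod (g \<omega>))\<^sup>2"
      using big by (intro mult_right_mono) auto
    then have le: "?p / 2 * (cmod (g \<omega>))\<^sup>2 \<le> C * (cmod (f \<omega>))\<^sup>2"
      using growth_everywhere[OF n(1)] by (simp add: algebra_simps)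
    \<comment> \<open>A zero of f would force a zero of g, which admissibility excludes.\<close>
    have f: "f \<omega> \<noteq> 0"
    proof
      assume f0: "f \<omega> = 0"
      then have "?p / 2 * (cmod (g \<omega>))\<^sup>2 \<le> 0" using le by simp
      then have "g \<omega> = 0" using p by (simp add: mult_le_0_iff)
      then show False using f0 disj_fg by blast
    qed
    have "(cmod (u \<omega>))\<^sup>2 \<le> 2 * C / ?p"
      using le f p by (simp add: u_def norm_divide power_divide field_simps)
    then show ?thesis using f by (simp add: powr_minus divide_inverse)
  qed
  show ?thesis by (rule that[of R]) (use * in \<open>auto simp: R_def\<close>)
qed

lemma pt_norm_lower: obtains b where "b > 0" "\<And>k. b * norm (rvec k) \<le> norm (pt k)"
proof -
  have "inj ((*v) T)" by (metis injI ST_v)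
  then obtain b where "b > 0" "\<And>x. b * norm x \<le> norm (T *v x)"
    using linear_inj_bounded_below_pos[of "(*v) T"] by auto
  then show ?thesis by (intro that[of b]) (auto simp: pt_def)
qed

lemma finite_rvec_ball: "finite {k :: int^'d. norm (rvec k) \<le> b}"
proof (rule finite_subset)
  let ?N = "{- \<lceil>b\<rceil>..\<lceil>b\<rceil>}"
  show "{k :: int^'d. norm (rvec k) \<le> b} \<subseteq> vec_lambda ` PiE UNIV (\<lambda>_. ?N)"
  proof
    fix k :: "int^'d" assume "k \<in> {k. norm (rvec k) \<le> b}"
    then have "\<bar>real_of_int (k $ i)\<bar> \<le> b" for i using component_le_norm_cart[of "rvec k" i] by simp
    then have "k $ i \<in> ?N" for i by (auto simp: abs_le_iff) (smt (verit) le_of_int_ceiling of_int_le_iff of_int_minus)+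
    then show "k \<in> vec_lambda ` PiE UNIV (\<lambda>_. ?N)"
      by (intro image_eqI[of _ _ "($) k"]) auto
  qed
  show "finite (vec_lambda ` PiE (UNIV :: 'd set) (\<lambda>_. ?N))" by (intro finite_imageI finite_PiE) auto
qed

text \<open>Outside finitely many k, the translates of a whole ball lie where \<open>decay\<close>
  applies; this gives one Weierstrass majorant per ball.\<close>

lemma tail_bound:
  obtains K b where "finite K" "b summable_on UNIV"
    "\<And>k \<omega>. k \<notin> K \<Longrightarrow> norm \<omega> \<le> \<rho> \<Longrightarrow> f (\<omega> + pt k) \<noteq> 0"
    "\<And>k \<omega>. k \<notin> K \<Longrightarrow> norm \<omega> \<le> \<rho> \<Longrightarrow> (cmod (u (\<omega> + pt k)))\<^sup>2 \<le> b k"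
proof -
  obtain R where R: "R \<ge> 1" "\<And>\<omega>. norm \<omega> \<ge> R \<Longrightarrow> f \<omega> \<noteq> 0"
    "\<And>\<omega>. norm \<omega> \<ge> R \<Longrightarrow> (cmod (u \<omega>))\<^sup>2 \<le> 2 * C * norm \<omega> powr (- (2 * r))" using decay by blast
  obtain b where b: "b > 0" "\<And>k. b * norm (rvec k) \<le> norm (pt k)" using pt_norm_lower by blast
  \<comment> \<open>Beyond this radius half of b |k| exceeds R + |\<rho>|, and the other half
    remains as a lower bound for the norm of the translated point.\<close>
  define K where "K = {k :: int^'d. norm (rvec k) \<le> 2 / b * (R + \<bar>\<rho>\<bar>)}"
  define s where "s k = 2 * C * (b / 2) powr (- (2 * r)) * (2 powr (2 * r)) * lattice_weight r k" for k :: "int^'d"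
  have *: "f (\<omega> + pt k) \<noteq> 0 \<and> (cmod (u (\<omega> + pt k)))\<^sup>2 \<le> s k"
    if k: "k \<notin> K" and \<omega>: "norm \<omega> \<le> \<rho>" for k \<omega>
  proof -
    have "2 / b * (R + \<bar>\<rho>\<bar>) < norm (rvec k)" using k by (simp add: K_def)
    then have big: "R + \<bar>\<rho>\<bar> < b / 2 * norm (rvec k)" using b(1) by (simp add: field_simps)
    have "norm (\<omega> + pt k) \<ge> norm (pt k) - norm \<omega>"
      by (metis add.commute norm_diff_ineq)
    then have lo: "b / 2 * norm (rvec k) \<le> norm (\<omega> + pt k)" "R \<le> norm (\<omega> + pt k)"
      using b(2)[of k] big \<omega> R(1) by (simp_all add: algebra_simps)
    have k0: "k \<noteq> 0" using big R(1) by auto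
    have "0 < b / 2 * norm (rvec k)" using big R(1) by linarith
    then have "norm (\<omega> + pt k) powr (- (2 * r)) \<le> (b / 2 * norm (rvec k)) powr (- (2 * r))"
      using lo r_pos by (intro powr_mono2') auto
    also have "\<dots> = (b / 2) powr (- (2 * r)) * norm (rvec k) powr (- (2 * r))"
      using b(1) by (simp only: powr_mult)
    also have "\<dots> \<le> (b / 2) powr (- (2 * r)) * (2 powr (2 * r) * lattice_weight r k)"
      by (intro mult_left_mono norm_powr_le_lattice_weight r_pos k0) auto
    finally have "2 * C * norm (\<omega> + pt k) powr (- (2 * r)) \<le> s k"
      using C by (simp add: s_def)
    then show ?thesis using R(2,3)[OF lo(2)] by auto
  qed
  show ?thesis
  proof (rule that[of K s])
    show "finite K" unfolding K_def by (rule finite_rvec_ball)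
    show "s summable_on UNIV" unfolding s_def[abs_def]
      by (intro summable_on_cmult_right lattice_weight_summable r)
  qed (use * in auto)
qed

section \<open>Regularity of the periodized weight\<close>

lemma M_summable: "(\<lambda>k. (cmod (u (\<omega> + pt k)))\<^sup>2) summable_on UNIV"
proof -
  obtain K b where K: "finite K" "b summable_on UNIV"
    "\<And>k \<eta>. k \<notin> K \<Longrightarrow> norm \<eta> \<le> norm \<omega> \<Longrightarrow> (cmod (u (\<eta> + pt k)))\<^sup>2 \<le> b k"
    using tail_bound[of "norm \<omega>"] by metis
  have "(\<lambda>k. (cmod (u (\<omega> + pt k)))\<^sup>2) summable_on (- K)"
    by (rule summable_on_comparison_test[OF summable_on_subset_banach[OF K(2)]]) (use K(3) in auto)
  then have "(\<lambda>k. (cmod (u (\<omega> + pt k)))\<^sup>2) summable_on (K \<union> - K)"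
    by (intro summable_on_Un_disjoint) (use K(1) in auto)
  then show ?thesis by simp
qed

lemma M_nonneg: "0 \<le> M \<omega>"
  unfolding M_def by (rule infsum_nonneg) simp

lemma M_ge_term: "(cmod (u (\<omega> + pt k)))\<^sup>2 \<le> M \<omega>"
proof -
  have "(\<Sum>k\<in>{k}. (cmod (u (\<omega> + pt k)))\<^sup>2) \<le> M \<omega>"
    unfolding M_def by (rule finite_sum_le_infsum[OF M_summable]) auto
  then show ?thesis by simp
qed

lemma infsum_shift:
  fixes h :: "int^'d \<Rightarrow> real"
  shows "(\<Sum>\<^sub>\<infinity>k\<in>UNIV. h (k + l)) = (\<Sum>\<^sub>\<infinity>k\<in>UNIV. h k)"
  by (rule infsum_reindex_bij_betw[of "\<lambda>k. k + l"])
     (auto simp: bij_betw_def inj_def intro!: image_eqI[of _ _ "_ - l"])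

lemma per_M: "per M"
  unfolding per_def M_def
  using infsum_shift[of "\<lambda>k. (cmod (u (_ + pt k)))\<^sup>2"] by (simp add: pt_add add_ac)

lemma Z_iff_shift: "\<omega> + pt l \<in> Z \<longleftrightarrow> \<omega> \<in> Z"
  unfolding Z_def
proof safe
  fix k assume "f (\<omega> + pt l + pt k) = 0"
  then show "\<exists>k. f (\<omega> + pt k) = 0" by (intro exI[of _ "l + k"]) (simp add: pt_add add_ac)
next
  fix k assume "f (\<omega> + pt k) = 0"
  then show "\<exists>k. f (\<omega> + pt l + pt k) = 0" by (intro exI[of _ "k - l"]) (simp add: pt_diff)
qed

lemma per_w: "per w"
  unfolding per_def w_def using per_M by (simp add: Z_iff_shift perD)

lemma f_isCont: "isCont f \<omega>" and g_isCont: "isCont g \<omega>"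
  using cont_f cont_g by (simp_all add: continuous_on_eq_continuous_at)

text \<open>Near the point, finitely many terms are continuous because their denominators do not
  vanish, and the tail converges uniformly.\<close>

lemma M_isCont:
  assumes "\<omega> \<notin> Z"
  shows "isCont M \<omega>"
proof -
  let ?\<rho> = "norm \<omega> + 1"
  obtain K b where K: "finite K" "b summable_on UNIV"
    "\<And>k \<eta>. k \<notin> K \<Longrightarrow> norm \<eta> \<le> ?\<rho> \<Longrightarrow> f (\<eta> + pt k) \<noteq> 0"
    "\<And>k \<eta>. k \<notin> K \<Longrightarrow> norm \<eta> \<le> ?\<rho> \<Longrightarrow> (cmod (u (\<eta> + pt k)))\<^sup>2 \<le> b k"
    using tail_bound[of ?\<rho>] by metis
  define tl where "tl \<eta> = (\<Sum>\<^sub>\<infinity>k\<in>- K. (cmod (u (\<eta> + pt k)))\<^sup>2)" for \<eta>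
  have shift: "continuous_on A (\<lambda>\<eta>. h (\<eta> + pt k))" if "continuous_on UNIV h" for h :: "real^'d \<Rightarrow> complex" and A k
    by (rule continuous_on_compose2[OF that]) (auto intro!: continuous_intros)
  have "continuous_on (ball 0 ?\<rho>) tl"
    unfolding tl_def[abs_def]
  proof (rule uniform_limit_theorem)
    show "uniform_limit (ball 0 ?\<rho>) (\<lambda>X \<eta>. \<Sum>k\<in>X. (cmod (u (\<eta> + pt k)))\<^sup>2)
       (\<lambda>\<eta>. \<Sum>\<^sub>\<infinity>k\<in>- K. (cmod (u (\<eta> + pt k)))\<^sup>2) (finite_subsets_at_top (- K))"
      by (rule Weierstrass_m_test_general[where M = b])
         (use K(4) summable_on_subset_banach[OF K(2)] in auto)
    show "\<forall>\<^sub>F X in finite_subsets_at_top (- K). continuous_on (ball 0 ?\<rho>) (\<lambda>\<eta>. \<Sum>k\<in>X. (cmod (u (\<eta> + pt k)))\<^sup>2)"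
      unfolding u_def
      by (rule eventually_finite_subsets_at_top_weakI)
         (use K(3) in \<open>auto intro!: continuous_intros shift[OF cont_f] shift[OF cont_g] simp: less_imp_le subset_iff\<close>)
  qed simp
  then have tl: "isCont tl \<omega>" by (rule continuous_on_interior) simp
  have M: "M \<eta> = (\<Sum>k\<in>K. (cmod (u (\<eta> + pt k)))\<^sup>2) + tl \<eta>" for \<eta>
  proof -
    have "M \<eta> = (\<Sum>\<^sub>\<infinity>k\<in>K \<union> - K. (cmod (u (\<eta> + pt k)))\<^sup>2)" by (simp add: M_def)
    also have "\<dots> = (\<Sum>\<^sub>\<infinity>k\<in>K. (cmod (u (\<eta> + pt k)))\<^sup>2) + tl \<eta>"
      unfolding tl_def by (rule infsum_Un_disjoint) (auto intro: summable_on_subset_banach[OF M_summable])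
    finally show ?thesis using K(1) by simp
  qed
  have "isCont (\<lambda>\<eta>. \<Sum>k\<in>K. (cmod (u (\<eta> + pt k)))\<^sup>2) \<omega>"
    unfolding u_def
    using assms by (auto intro!: continuous_intros isCont_o2[of _ "\<lambda>\<eta>. \<eta> + _", OF _ f_isCont]
        isCont_o2[of _ "\<lambda>\<eta>. \<eta> + _", OF _ g_isCont] simp: Z_def)
  from isCont_add[OF this tl]
  have "isCont (\<lambda>\<eta>. (\<Sum>k\<in>K. (cmod (u (\<eta> + pt k)))\<^sup>2) + tl \<eta>) \<omega>" .
  then show ?thesis by (simp only: M[abs_def])
qed

text \<open>A union of infinitely many translated zero sets, but only finitely many of them meet a
  given ball.\<close>

lemma Z_closed_at:
  assumes "\<omega> \<notin> Z"
  shows "\<forall>\<^sub>F \<eta> in nhds \<omega>. \<eta> \<notin> Z"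
proof -
  let ?\<rho> = "norm \<omega> + 1"
  obtain K where K: "finite K" "\<And>k \<eta>. k \<notin> K \<Longrightarrow> norm \<eta> \<le> ?\<rho> \<Longrightarrow> f (\<eta> + pt k) \<noteq> 0"
    using tail_bound[of ?\<rho>] by metis
  have "\<forall>\<^sub>F \<eta> in nhds \<omega>. f (\<eta> + pt k) \<noteq> 0" for k
  proof -
    have "isCont (\<lambda>\<eta>. f (\<eta> + pt k)) \<omega>"
      by (intro isCont_o2[of _ "\<lambda>\<eta>. \<eta> + _", OF _ f_isCont] continuous_intros)
    then have "((\<lambda>\<eta>. f (\<eta> + pt k)) \<longlongrightarrow> f (\<omega> + pt k)) (nhds \<omega>)"
      using tendsto_at_iff_tendsto_nhds[of "\<lambda>\<eta>. f (\<eta> + pt k)" \<omega>] by (simp add: isCont_def)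
    moreover have "f (\<omega> + pt k) \<noteq> 0" using assms by (auto simp: Z_def)
    ultimately show ?thesis by (rule tendsto_imp_eventually_ne)
  qed
  then have "\<forall>\<^sub>F \<eta> in nhds \<omega>. \<forall>k\<in>K. f (\<eta> + pt k) \<noteq> 0"
    using K(1) by (simp add: eventually_ball_finite)
  moreover have "\<forall>\<^sub>F \<eta> in nhds \<omega>. norm \<eta> < ?\<rho>"
    by (rule eventually_nhds_in_open[of "ball 0 ?\<rho>" \<omega>, simplified])
  ultimately show ?thesis
    by eventually_elim (use K(2) in \<open>force simp: Z_def\<close>)
qed

text \<open>Off \<open>Z\<close> the function M is continuous, so the almost-everywhere bound holds
  at each point.\<close>

lemma M_lower:
  assumes "\<omega> \<notin> Z"
  shows "c \<le> M \<omega>"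
proof (rule ccontr)
  assume "\<not> c \<le> M \<omega>"
  moreover have "(M \<longlongrightarrow> M \<omega>) (nhds \<omega>)"
    using M_isCont[OF assms] by (simp add: tendsto_at_iff_tendsto_nhds isCont_def)
  ultimately have "\<forall>\<^sub>F \<eta> in nhds \<omega>. M \<eta> < c" by (intro order_tendstoD(2)) auto
  then obtain U where U: "open U" "\<omega> \<in> U" "\<forall>\<eta>\<in>U. M \<eta> < c" by (auto simp: eventually_nhds)
  have "AE \<omega> in lborel. c \<le> M \<omega>" using lower by (simp add: M_def u_def)
  then show False using open_AE_ex[OF U(1), of "\<lambda>\<omega>. c \<le> M \<omega>"] U by force
qed

lemma w_nonneg: "0 \<le> w \<omega>" by (simp add: w_def M_nonneg)

lemma w_le: "w \<omega> \<le> 1 / c"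
  using M_lower[of \<omega>] c by (auto simp: w_def intro!: divide_left_mono mult_pos_pos)

lemma w_M: "\<omega> \<notin> Z \<Longrightarrow> w \<omega> * M \<omega> = 1"
  using M_lower[of \<omega>] c by (simp add: w_def)

lemma w_eq_0: "w \<omega> = 0 \<longleftrightarrow> \<omega> \<in> Z"
  using M_lower[of \<omega>] c by (auto simp: w_def)

text \<open>At a zero of f translated by \<open>pt k\<close>, the single term of index k bounds M
  from below, so w is squeezed under |f/g|^2; g does not vanish there by admissibility.\<close>

lemma w_isCont: "isCont w \<omega>"
proof (cases "\<omega> \<in> Z")
  case False
  have "(M \<longlongrightarrow> M \<omega>) (nhds \<omega>)"
    using M_isCont[OF False] by (simp add: tendsto_at_iff_tendsto_nhds isCont_def)
  then have "((\<lambda>\<eta>. 1 / M \<eta>) \<longlongrightarrow> 1 / M \<omega>) (nhds \<omega>)"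
    using M_lower[OF False] c by (intro tendsto_intros) auto
  moreover have "\<forall>\<^sub>F \<eta> in nhds \<omega>. 1 / M \<eta> = w \<eta>"
    using Z_closed_at[OF False] by eventually_elim (simp add: w_def)
  ultimately have "(w \<longlongrightarrow> 1 / M \<omega>) (nhds \<omega>)" by (rule Lim_transform_eventually)
  then have "(w \<longlongrightarrow> w \<omega>) (nhds \<omega>)" using False by (simp add: w_def[of \<omega>])
  then show ?thesis by (simp only: isCont_def tendsto_at_iff_tendsto_nhds)
next
  case True
  then obtain k where k: "f (\<omega> + pt k) = 0" by (auto simp: Z_def)
  then have gk: "g (\<omega> + pt k) \<noteq> 0" using disj_fg by blast
  let ?h = "\<lambda>\<eta>. (cmod (f (\<eta> + pt k) / g (\<eta> + pt k)))\<^sup>2"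
  have "isCont ?h \<omega>"
    using gk by (intro continuous_intros isCont_o2[of _ "\<lambda>\<eta>. \<eta> + _", OF _ f_isCont]
        isCont_o2[of _ "\<lambda>\<eta>. \<eta> + _", OF _ g_isCont])
  then have h0: "(?h \<longlongrightarrow> 0) (at \<omega>)" using k by (simp add: isCont_def)
  have "isCont (\<lambda>\<eta>. g (\<eta> + pt k)) \<omega>"
    by (intro isCont_o2[of _ "\<lambda>\<eta>. \<eta> + _", OF _ g_isCont] continuous_intros)
  then have "\<forall>\<^sub>F \<eta> in at \<omega>. g (\<eta> + pt k) \<noteq> 0"
    using gk unfolding isCont_def by (rule tendsto_imp_eventually_ne)
  then have le: "\<forall>\<^sub>F \<eta> in at \<omega>. norm (w \<eta>) \<le> ?h \<eta>"
  proof eventually_elim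
    case (elim \<eta>)
    show ?case
    proof (cases "\<eta> \<in> Z")
      case True
      then show ?thesis by (simp add: w_def)
    next
      case False
      then have "f (\<eta> + pt k) \<noteq> 0" by (auto simp: Z_def)
      then have "0 < (cmod (u (\<eta> + pt k)))\<^sup>2" using elim by (simp add: u_def)
      then have "1 / M \<eta> \<le> 1 / (cmod (u (\<eta> + pt k)))\<^sup>2"
        using M_ge_term[of \<eta> k] by (intro frac_le) simp_all
      also have "\<dots> = ?h \<eta>" by (simp add: u_def norm_divide power_divide)
      finally show ?thesis using False by (simp add: w_def M_nonneg)
    qed
  qed
  have "(w \<longlongrightarrow> 0) (at \<omega>)" by (rule Lim_null_comparison[OF le h0])
  then show ?thesis using True by (simp add: isCont_def w_def)
qed

lemma w_measurable [measurable]: "w \<in> borel_measurable borel"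
  by (rule borel_measurable_continuous_onI) (simp add: continuous_on_eq_continuous_at w_isCont)

lemma AE_not_Z: "AE \<omega> in lborel. \<omega> \<notin> Z"
proof -
  have "AE \<omega> in lborel. f \<omega> \<noteq> 0"
    using AE_not_in[OF null_fg] by eventually_elim auto
  then have "AE \<omega> in lborel. f (\<omega> + pt k) \<noteq> 0" for k by (rule AE_lborel_translate)
  then have "AE \<omega> in lborel. \<forall>k. f (\<omega> + pt k) \<noteq> 0" by (simp add: AE_all_countable)
  then show ?thesis by eventually_elim (auto simp: Z_def)
qed

lemma nn_M: "(\<integral>\<^sup>+k. ennreal ((cmod (u (\<omega> + pt k)))\<^sup>2) \<partial>count_space UNIV) = ennreal (M \<omega>)"
  unfolding M_def by (rule nn_integral_count_space_infsum[OF M_summable]) simp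

lemma M_measurable [measurable]: "M \<in> borel_measurable borel"
proof -
  have "(\<lambda>\<omega>. enn2real (\<integral>\<^sup>+k. ennreal ((cmod (u (\<omega> + pt k)))\<^sup>2) \<partial>count_space UNIV)) \<in> borel_measurable borel"
    by (intro measurable_compose[OF borel_measurable_nn_count_space]) measurable
  then show ?thesis by (simp add: nn_M M_nonneg)
qed

end

section \<open>Wavelets on the Fourier side\<close>

locale wavelet_fourier = refinement T S D B e n + symbol_lattice T S f g r C c
  for T S :: "real^'d^'d" and D B e n f g r C c
begin

text \<open>A spline with periodic factor q has its norm in L2 of \<open>nuM\<close>; writing q = s
  w turns it into the norm of s in L2 of \<open>nuw\<close>.\<close>

definition nuM :: "(real^'d) measure" where "nuM = density cellm (\<lambda>\<omega>. ennreal (M \<omega>))"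

definition nuw :: "(real^'d) measure" where "nuw = density cellm (\<lambda>\<omega>. ennreal (w \<omega>))"

lemma sets_nu [simp, measurable_cong]: "sets nuM = sets borel" "sets nuw = sets borel"
  by (simp_all add: nuM_def nuw_def)

lemma borel_nu: "h \<in> borel_measurable nuM \<longleftrightarrow> h \<in> borel_measurable borel"
  "h \<in> borel_measurable nuw \<longleftrightarrow> h \<in> borel_measurable borel"
  by (simp_all cong: measurable_cong_sets)

lemma M_borel': "M \<in> borel_measurable cellm" and w_borel': "w \<in> borel_measurable cellm"
  by (simp_all add: borel_cellm)

lemma AE_nuM: "AE \<omega> in cellm. P \<omega> \<Longrightarrow> AE \<omega> in nuM. P \<omega>"
  unfolding nuM_def using M_borel' by (subst AE_density) auto

lemma nn_nuM:
  assumes "h \<in> borel_measurable borel"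
  shows "(\<integral>\<^sup>+\<omega>. h \<omega> \<partial>nuM) = (\<integral>\<^sup>+\<omega>. ennreal (M \<omega>) * h \<omega> \<partial>cellm)"
  unfolding nuM_def by (rule nn_integral_density) (use M_borel' assms in \<open>auto simp: borel_cellm\<close>)

lemma nn_nuw:
  assumes "h \<in> borel_measurable borel"
  shows "(\<integral>\<^sup>+\<omega>. h \<omega> \<partial>nuw) = (\<integral>\<^sup>+\<omega>. ennreal (w \<omega>) * h \<omega> \<partial>cellm)"
  unfolding nuw_def by (rule nn_integral_density) (use w_borel' assms in \<open>auto simp: borel_cellm\<close>)

lemma AE_wM: "AE \<omega> in cellm. w \<omega> * M \<omega> = 1"
  using AE_cellm[OF AE_not_Z] by eventually_elim (rule w_M)

text \<open>As an image of |u|^2 times Lebesgue measure under reduction to the cell,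
  \<open>nuM\<close> gives access to complex integrals.\<close>

lemma nuM_distr: "nuM = distr (density lborel (\<lambda>\<omega>. ennreal ((cmod (u \<omega>))\<^sup>2))) borel red"
  by (subst distr_red) (simp_all add: nn_M nuM_def)

text \<open>Multiplication by \<open>u\<close> identifies periodic functions in \<open>L\<^sub>2(nuM)\<close> with Fourier transforms of splines.\<close>

lemma ip_u:
  assumes [measurable]: "q1 \<in> borel_measurable borel" "q2 \<in> borel_measurable borel" and "per q1" "per q2"
  shows "ip lborel (\<lambda>\<omega>. q1 \<omega> * u \<omega>) (\<lambda>\<omega>. q2 \<omega> * u \<omega>) = ip nuM q1 q2"
proof -
  have "ip nuM q1 q2 = (\<integral>\<omega>. q1 (red \<omega>) * cnj (q2 (red \<omega>)) \<partial>density lborel (\<lambda>\<omega>. ennreal ((cmod (u \<omega>))\<^sup>2)))"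
    unfolding ip_def nuM_distr by (rule integral_distr) measurable
  also have "\<dots> = (\<integral>\<omega>. q1 \<omega> * cnj (q2 \<omega>) \<partial>density lborel (\<lambda>\<omega>. ennreal ((cmod (u \<omega>))\<^sup>2)))"
    using assms(3,4) by (simp add: per_red)
  also have "\<dots> = (\<integral>\<omega>. (cmod (u \<omega>))\<^sup>2 *\<^sub>R (q1 \<omega> * cnj (q2 \<omega>)) \<partial>lborel)"
    by (rule integral_density) auto
  also have "\<dots> = ip lborel (\<lambda>\<omega>. q1 \<omega> * u \<omega>) (\<lambda>\<omega>. q2 \<omega> * u \<omega>)"
    unfolding ip_def
  proof (rule Bochner_Integration.integral_cong[OF refl])
    fix \<omega>
    have "complex_of_real ((cmod (u \<omega>))\<^sup>2) = u \<omega> * cnj (u \<omega>)" by (simp only: complex_norm_square)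
    then show "(cmod (u \<omega>))\<^sup>2 *\<^sub>R (q1 \<omega> * cnj (q2 \<omega>)) = q1 \<omega> * u \<omega> * cnj (q2 \<omega> * u \<omega>)"
      by (simp only: scaleR_conv_of_real complex_cnj_mult) (simp only: mult_ac)
  qed
  finally show ?thesis by simp
qed

lemma nsq_u:
  assumes "q \<in> borel_measurable borel" "per q"
  shows "nsq lborel (\<lambda>\<omega>. q \<omega> * u \<omega>) = nsq nuM q"
proof -
  have "complex_of_real (nsq lborel (\<lambda>\<omega>. q \<omega> * u \<omega>)) = of_real (nsq nuM q)"
    unfolding nsq_ip by (rule ip_u[OF assms(1,1,2,2)])
  then show ?thesis by (simp only: of_real_eq_iff)
qed

lemma nn_u:
  assumes [measurable]: "q \<in> borel_measurable borel" and q: "per q"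
  shows "(\<integral>\<^sup>+\<omega>. ennreal ((cmod (q \<omega> * u \<omega>))\<^sup>2) \<partial>lborel) = (\<integral>\<^sup>+\<omega>. ennreal ((cmod (q \<omega>))\<^sup>2) \<partial>nuM)"
proof -
  have "(\<integral>\<^sup>+\<omega>. ennreal ((cmod (q \<omega> * u \<omega>))\<^sup>2) \<partial>lborel)
      = (\<integral>\<^sup>+\<omega>. ennreal ((cmod (q \<omega>))\<^sup>2) * ennreal ((cmod (u \<omega>))\<^sup>2) \<partial>lborel)"
    by (simp add: norm_mult power_mult_distrib ennreal_mult)
  also have "\<dots> = (\<integral>\<^sup>+\<omega>. ennreal ((cmod (q \<omega>))\<^sup>2) * ennreal (M \<omega>) \<partial>cellm)"
    by (subst periodize) (use q in \<open>auto simp: per_def nn_M\<close>)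
  also have "\<dots> = (\<integral>\<^sup>+\<omega>. ennreal ((cmod (q \<omega>))\<^sup>2) \<partial>nuM)"
    by (subst nn_nuM) (auto simp: mult.commute)
  finally show ?thesis .
qed

lemma sq_int_u:
  assumes [measurable]: "q \<in> borel_measurable borel" and q: "per q"
  shows "sq_int lborel (\<lambda>\<omega>. q \<omega> * u \<omega>) \<longleftrightarrow> sq_int nuM q"
  using nn_u[OF assms] by (simp add: sq_int_iff_nn borel_nu)

text \<open>Almost everywhere w M = 1, hence M |s w|^2 = w |s|^2.\<close>

lemma nn_w:
  assumes [measurable]: "s \<in> borel_measurable borel"
  shows "(\<integral>\<^sup>+\<omega>. ennreal ((cmod (s \<omega> * of_real (w \<omega>)))\<^sup>2) \<partial>nuM) = (\<integral>\<^sup>+\<omega>. ennreal ((cmod (s \<omega>))\<^sup>2) \<partial>nuw)"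
proof -
  have "(\<integral>\<^sup>+\<omega>. ennreal (M \<omega>) * ennreal ((cmod (s \<omega> * of_real (w \<omega>)))\<^sup>2) \<partial>cellm)
      = (\<integral>\<^sup>+\<omega>. ennreal (w \<omega>) * ennreal ((cmod (s \<omega>))\<^sup>2) \<partial>cellm)"
  proof (rule nn_integral_cong_AE, use AE_wM in eventually_elim)
    fix \<omega> assume wM: "w \<omega> * M \<omega> = 1"
    have "M \<omega> * (cmod (s \<omega> * of_real (w \<omega>)))\<^sup>2 = (w \<omega> * M \<omega>) * w \<omega> * (cmod (s \<omega>))\<^sup>2"
      by (simp add: norm_mult power_mult_distrib power2_eq_square mult_ac)
    then show "ennreal (M \<omega>) * ennreal ((cmod (s \<omega> * of_real (w \<omega>)))\<^sup>2) = ennreal (w \<omega>) * ennreal ((cmod (s \<omega>))\<^sup>2)"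
      by (simp add: ennreal_mult[symmetric] M_nonneg w_nonneg wM)
  qed
  then show ?thesis by (simp add: nn_nuM nn_nuw)
qed

lemma nsq_w:
  assumes [measurable]: "s \<in> borel_measurable borel"
  shows "nsq nuM (\<lambda>\<omega>. s \<omega> * of_real (w \<omega>)) = nsq nuw s"
  using nn_w[OF assms] by (simp add: nsq_enn2real borel_nu)

lemma sq_int_w:
  assumes [measurable]: "s \<in> borel_measurable borel"
  shows "sq_int nuM (\<lambda>\<omega>. s \<omega> * of_real (w \<omega>)) \<longleftrightarrow> sq_int nuw s"
  using nn_w[OF assms] by (simp add: sq_int_iff_nn borel_nu)

lemma nn_nuw_le:
  assumes [measurable]: "s \<in> borel_measurable borel"
  shows "(\<integral>\<^sup>+\<omega>. ennreal ((cmod (s \<omega>))\<^sup>2) \<partial>nuw) \<le> ennreal (1 / c) * (\<integral>\<^sup>+\<omega>. ennreal ((cmod (s \<omega>))\<^sup>2) \<partial>cellm)"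
proof -
  have "(\<integral>\<^sup>+\<omega>. ennreal (w \<omega>) * ennreal ((cmod (s \<omega>))\<^sup>2) \<partial>cellm)
      \<le> (\<integral>\<^sup>+\<omega>. ennreal (1 / c) * ennreal ((cmod (s \<omega>))\<^sup>2) \<partial>cellm)"
    by (intro nn_integral_mono mult_right_mono ennreal_leI w_le) auto
  then show ?thesis by (simp add: nn_nuw nn_integral_cmult borel_cellm)
qed

lemma sq_int_nuw: "sq_int cellm s \<Longrightarrow> sq_int nuw s"
  using nn_nuw_le[of s] nn_nsq[of cellm s] sq_int_measurable[of cellm s]
  by (simp add: sq_int_iff_nn borel_nu borel_cellm ennreal_mult_less_top less_top[symmetric]
      ennreal_mult_eq_top_iff top_unique) (metis ennreal_mult_eq_top_iff ennreal_neq_top neq_top_trans)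

lemma nsq_nuw_le:
  assumes "sq_int cellm s"
  shows "nsq nuw s \<le> nsq cellm s / c"
proof -
  have "ennreal (nsq nuw s) \<le> ennreal (1 / c) * ennreal (nsq cellm s)"
    using nn_nuw_le[of s] nn_nsq[OF assms] nn_nsq[OF sq_int_nuw[OF assms]] sq_int_measurable[OF assms]
    by (simp add: borel_cellm)
  also have "\<dots> = ennreal (nsq cellm s / c)" using c by (simp add: ennreal_mult[symmetric])
  finally show ?thesis using c by (simp add: divide_nonneg_pos)
qed

section \<open>Sums over the cosets of the two dual lattices\<close>

lemma nn_sum_lam:
  fixes q :: "real^'d \<Rightarrow> ennreal"
  assumes [measurable]: "q \<in> borel_measurable borel" and q: "per q"
  shows "(\<integral>\<^sup>+\<omega>. (\<Sum>l<n. q (\<omega> + lam (e l))) \<partial>cellm) = of_nat n * (\<integral>\<^sup>+\<omega>. q \<omega> \<partial>cellm)"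
proof -
  have "(\<integral>\<^sup>+\<omega>. (\<Sum>l<n. q (\<omega> + lam (e l))) \<partial>cellm) = (\<Sum>l<n. \<integral>\<^sup>+\<omega>. q (\<omega> + lam (e l)) \<partial>cellm)"
    by (rule nn_integral_sum) simp
  then show ?thesis by (simp add: nn_cellm_translate[OF assms])
qed

definition lam_sum :: "(real^'d \<Rightarrow> 'b) \<Rightarrow> real^'d \<Rightarrow> 'b::comm_monoid_add" where
  "lam_sum F \<omega> = (\<Sum>l<n. F (\<omega> + lam (e l)))"

definition per_lam :: "(real^'d \<Rightarrow> 'b) \<Rightarrow> bool" where
  "per_lam F \<longleftrightarrow> (\<forall>\<omega> v. F (\<omega> + lam v) = F \<omega>)"

lemma per_lamD: "per_lam F \<Longrightarrow> F (\<omega> + lam v) = F \<omega>"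
  by (simp add: per_lam_def)

lemma per_lam_per: "per_lam F \<Longrightarrow> per F"
  unfolding per_lam_def per_def by (metis lam_transpose)

lemma per_lam_lam_sum: "per F \<Longrightarrow> per_lam (lam_sum F)"
  unfolding per_lam_def lam_sum_def
proof (intro allI)
  fix \<omega> v assume F: "per F"
  have "\<omega> + lam v + lam (e l) = \<omega> + lam (e l) + lam v" for l by (simp add: add_ac)
  then show "(\<Sum>l<n. F (\<omega> + lam v + lam (e l))) = (\<Sum>l<n. F (\<omega> + lam (e l)))"
    by (simp only: sum_lam_shift[OF F])
qed

lemma per_lam_chr: "per_lam (chr (D *v k))"
  by (simp add: per_lam_def chr_add_arg)

text \<open>Each of the n translates has the same integral over the cell, so n times the integral is
  the integral of the coset sum.\<close>

lemma integral_lam_sum_0: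
  fixes h :: "real^'d \<Rightarrow> complex"
  assumes [measurable]: "h \<in> borel_measurable borel" and p: "per h" and i: "integrable cellm h"
    and z: "AE \<omega> in cellm. lam_sum h \<omega> = 0"
  shows "(\<integral>\<omega>. h \<omega> \<partial>cellm) = 0"
proof -
  have "of_nat n * (\<integral>\<omega>. h \<omega> \<partial>cellm) = (\<Sum>l<n. \<integral>\<omega>. h (\<omega> + lam (e l)) \<partial>cellm)"
    by (subst integral_cellm_translate[OF _ p]) auto
  also have "\<dots> = (\<integral>\<omega>. lam_sum h \<omega> \<partial>cellm)"
    unfolding lam_sum_def
    by (rule Bochner_Integration.integral_sum[symmetric])
       (use integrable_cellm_translate[OF _ p] i in auto)
  also have "\<dots> = (\<integral>\<omega>. 0 \<partial>cellm)"
    by (rule integral_cong_AE) (use z in \<open>auto simp: lam_sum_def borel_cellm\<close>)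
  finally show ?thesis using n_pos by simp
qed

text \<open>The characters with frequency in the image of D are constant on cosets and come out of
  the coset sum.\<close>

lemma fcoeff_lam_sum_0:
  assumes s: "sq_int cellm s" and p: "per s" and z: "AE \<omega> in cellm. lam_sum s \<omega> = 0"
  shows "fcoeff s (D *v k) = 0"
proof -
  have [measurable]: "s \<in> borel_measurable borel" using sq_int_measurable[OF s] by (simp add: borel_cellm)
  have "(\<integral>\<omega>. s \<omega> * cnj (chr (D *v k) \<omega>) \<partial>cellm) = 0"
  proof (rule integral_lam_sum_0)
    show "per (\<lambda>\<omega>. s \<omega> * cnj (chr (D *v k) \<omega>))" using p perD[OF per_chr] by (simp add: per_def)
    show "integrable cellm (\<lambda>\<omega>. s \<omega> * cnj (chr (D *v k) \<omega>))" by (rule integrable_ip[OF s sq_int_chr])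
    show "AE \<omega> in cellm. lam_sum (\<lambda>\<omega>. s \<omega> * cnj (chr (D *v k) \<omega>)) \<omega> = 0"
      using z by eventually_elim (simp add: lam_sum_def chr_add_arg sum_distrib_right[symmetric])
  qed measurable
  then show ?thesis by (simp add: fcoeff_def ip_def)
qed

text \<open>The counterpart of \<open>fcoeff_lam_sum_0\<close>: a suitable translation by
  \<open>lam (e m)\<close> leaves b alone but multiplies the character by a value different from
  1.\<close>

lemma ip_per_lam_chr_0:
  assumes b: "per_lam b" "b \<in> borel_measurable borel" and k: "\<nexists>z. k = D *v z"
  shows "ip cellm b (chr k) = 0"
proof -
  obtain m where m: "chr k (lam (e m)) \<noteq> 1" using chr_lam_all_1[of k] k by blast
  note [measurable] = b(2)
  let ?h = "\<lambda>\<omega>. b \<omega> * cnj (chr k \<omega>)"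
  have ph: "per ?h" using perD[OF per_lam_per[OF b(1)]] perD[OF per_chr] by (simp add: per_def)
  have "ip cellm b (chr k) = (\<integral>\<omega>. ?h (\<omega> + lam (e m)) \<partial>cellm)"
    unfolding ip_def by (rule integral_cellm_translate[OF _ ph, symmetric]) measurable
  also have "\<dots> = (\<integral>\<omega>. cnj (chr k (lam (e m))) * ?h \<omega> \<partial>cellm)"
    by (simp add: per_lamD[OF b(1)] chr_add_arg mult_ac)
  also have "\<dots> = cnj (chr k (lam (e m))) * ip cellm b (chr k)"
    by (simp add: ip_def)
  finally have "(1 - cnj (chr k (lam (e m)))) * ip cellm b (chr k) = 0" by (simp add: algebra_simps)
  moreover have "cnj (chr k (lam (e m))) \<noteq> 1" using m by (metis complex_cnj_cnj complex_cnj_one)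
  ultimately show ?thesis by auto
qed

section \<open>Separation of the zeros of the weight\<close>

lemma w_continuous: "continuous_on A w"
  by (simp add: continuous_at_imp_continuous_on w_isCont)

lemma w_shift_continuous: "continuous_on A (\<lambda>\<omega>. w (\<omega> + a))"
  by (rule continuous_on_compose2[OF w_continuous[of UNIV]]) (auto intro!: continuous_intros)

definition separated :: "real \<Rightarrow> bool" where
  "separated \<delta> \<longleftrightarrow> \<delta> > 0 \<and> (\<forall>m\<in>{1..n - 1}. \<forall>\<omega>. \<delta> \<le> w \<omega> + w (\<omega> + lam (e m)))"

text \<open>By periodicity the sum of the two weights attains its minimum on the closed cell, and
  the hypothesis makes this minimum positive.\<close>

lemma separated_ex:
  assumes "\<And>m \<omega>. m \<in> {1..n - 1} \<Longrightarrow> w \<omega> \<noteq> 0 \<or> w (\<omega> + lam (e m)) \<noteq> 0"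
  shows "\<exists>\<delta>. separated \<delta>"
proof -
  let ?Q = "(*v) T ` cbox 0 1"
  have ex: "\<exists>\<delta>>0. \<forall>\<omega>. \<delta> \<le> w \<omega> + w (\<omega> + lam (e m))" if m: "m \<in> {1..n - 1}" for m
  proof -
    have cont: "continuous_on ?Q (\<lambda>\<omega>. w \<omega> + w (\<omega> + lam (e m)))"
      by (rule continuous_on_add[OF w_continuous w_shift_continuous])
    have "T *v 0 \<in> ?Q" by (intro imageI) (simp add: mem_box_cart)
    then have ne: "?Q \<noteq> {}" by blast
    obtain \<omega>0 where \<omega>0: "\<And>\<omega>. \<omega> \<in> ?Q \<Longrightarrow> w \<omega>0 + w (\<omega>0 + lam (e m)) \<le> w \<omega> + w (\<omega> + lam (e m))"
      using continuous_attains_inf[OF compact_fundamental ne cont] by (auto simp only:)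
    have "w \<omega>0 + w (\<omega>0 + lam (e m)) > 0"
      using assms[OF m, of \<omega>0] w_nonneg[of \<omega>0] w_nonneg[of "\<omega>0 + lam (e m)"] by linarith
    moreover have "w \<omega>0 + w (\<omega>0 + lam (e m)) \<le> w \<omega> + w (\<omega> + lam (e m))" for \<omega>
    proof -
      have "w (red \<omega> + lam (e m)) = w (\<omega> + lam (e m))"
        using per_minus[OF per_w, of "\<omega> + lam (e m)" "fl \<omega>"] by (simp add: red_def algebra_simps)
      moreover have "red \<omega> \<in> ?Q" using red_in_cell cell_subset by blast
      ultimately show ?thesis using \<omega>0[of "red \<omega>"] by (simp add: per_red[OF per_w])
    qed
    ultimately show ?thesis by blast
  qed
  then obtain d where d: "\<And>m. m \<in> {1..n - 1} \<Longrightarrow> d m > 0 \<and> (\<forall>\<omega>. d m \<le> w \<omega> + w (\<omega> + lam (e m)))"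
    by metis
  \<comment> \<open>The inserted 1 keeps the set nonempty in the case n = 1.\<close>
  let ?\<delta> = "Min (insert 1 (d ` {1..n - 1}))"
  have "?\<delta> > 0" using d by simp
  moreover have "?\<delta> \<le> d m" if "m \<in> {1..n - 1}" for m using that by (intro Min_le) auto
  ultimately have "separated ?\<delta>"
    unfolding separated_def using d by (meson order_trans)
  then show ?thesis by blast
qed

lemma separated_pairs:
  assumes "separated \<delta>" "l < n" "l' < n" "l \<noteq> l'"
  shows "\<delta> \<le> w (\<omega> + lam (e l)) + w (\<omega> + lam (e l'))"
proof -
  obtain m k where m: "m \<in> {1..n - 1}" "lam (e l') = lam (e l) + lam (e m) + pt k"
    using lam_diff_cosets[OF assms(2-4)] by blast
  have "w (\<omega> + lam (e l')) = w (\<omega> + lam (e l) + lam (e m))"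
    using perD[OF per_w, of "\<omega> + lam (e l) + lam (e m)" k] m(2) by (simp add: add.assoc)
  then show ?thesis using assms(1) m(1) unfolding separated_def by simp
qed

text \<open>The elementary inequality \<open>weighted_sum_lower_bound\<close> holds on each coset,
  and integration over the cell adds up the cosets. No square integrability is presupposed, so the
  bound can also establish it.\<close>

lemma separated_lower:
  assumes \<delta>: "separated \<delta>" and [measurable]: "s \<in> borel_measurable borel" and p: "per s"
    and z: "AE \<omega> in cellm. lam_sum s \<omega> = 0"
  shows "ennreal (\<delta> / (2 * real n)) * (\<integral>\<^sup>+\<omega>. ennreal ((cmod (s \<omega>))\<^sup>2) \<partial>cellm)
    \<le> (\<integral>\<^sup>+\<omega>. ennreal ((cmod (s \<omega>))\<^sup>2) \<partial>nuw)"
proof -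
  have \<delta>0: "\<delta> > 0" using \<delta> by (simp add: separated_def)
  let ?a = "\<delta> / (2 * real n)"
  have "of_nat n * (\<integral>\<^sup>+\<omega>. ennreal (?a * (cmod (s \<omega>))\<^sup>2) \<partial>cellm)
      = (\<integral>\<^sup>+\<omega>. (\<Sum>l<n. ennreal (?a * (cmod (s (\<omega> + lam (e l))))\<^sup>2)) \<partial>cellm)"
    by (rule nn_sum_lam[symmetric]) (use p in \<open>auto simp: per_def\<close>)
  also have "\<dots> \<le> (\<integral>\<^sup>+\<omega>. (\<Sum>l<n. ennreal (w (\<omega> + lam (e l)) * (cmod (s (\<omega> + lam (e l))))\<^sup>2)) \<partial>cellm)"
  proof (rule nn_integral_mono_AE, use z in eventually_elim)
    fix \<omega> assume "lam_sum s \<omega> = 0"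
    then have "?a * (\<Sum>l<n. (cmod (s (\<omega> + lam (e l))))\<^sup>2) \<le> (\<Sum>l<n. w (\<omega> + lam (e l)) * (cmod (s (\<omega> + lam (e l))))\<^sup>2)"
      using \<delta>0 by (intro weighted_sum_lower_bound w_nonneg separated_pairs[OF \<delta>]) (auto simp: lam_sum_def)
    then show "(\<Sum>l<n. ennreal (?a * (cmod (s (\<omega> + lam (e l))))\<^sup>2))
        \<le> (\<Sum>l<n. ennreal (w (\<omega> + lam (e l)) * (cmod (s (\<omega> + lam (e l))))\<^sup>2))"
      using \<delta>0 by (simp add: sum_ennreal w_nonneg sum_distrib_left ennreal_leI)
  qed
  also have "\<dots> = of_nat n * (\<integral>\<^sup>+\<omega>. ennreal (w \<omega> * (cmod (s \<omega>))\<^sup>2) \<partial>cellm)"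
    by (rule nn_sum_lam) (use p per_w in \<open>auto simp: per_def\<close>)
  finally have "of_nat n * (\<integral>\<^sup>+\<omega>. ennreal (?a * (cmod (s \<omega>))\<^sup>2) \<partial>cellm)
      \<le> of_nat n * (\<integral>\<^sup>+\<omega>. ennreal (w \<omega> * (cmod (s \<omega>))\<^sup>2) \<partial>cellm)" .
  then have "(\<integral>\<^sup>+\<omega>. ennreal (?a * (cmod (s \<omega>))\<^sup>2) \<partial>cellm) \<le> (\<integral>\<^sup>+\<omega>. ennreal (w \<omega> * (cmod (s \<omega>))\<^sup>2) \<partial>cellm)"
    using n_pos by (subst (asm) ennreal_mult_le_mult_iff) auto
  moreover have "(\<integral>\<^sup>+\<omega>. ennreal (?a * (cmod (s \<omega>))\<^sup>2) \<partial>cellm)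
      = ennreal ?a * (\<integral>\<^sup>+\<omega>. ennreal ((cmod (s \<omega>))\<^sup>2) \<partial>cellm)"
  proof -
    have "ennreal (?a * x) = ennreal ?a * ennreal x" if "x \<ge> 0" for x
      using \<delta>0 that by (intro ennreal_mult) auto
    then show ?thesis by (simp only: zero_le_power2) (rule nn_integral_cmult; simp add: borel_cellm)
  qed
  ultimately show ?thesis
    by (simp add: nn_nuw ennreal_mult w_nonneg)
qed

section \<open>Combinations of wavelet characters\<close>

lemma nsq_trig_sum_reindex:
  assumes "finite J" "inj_on h J"
  shows "nsq cellm (\<lambda>\<omega>. \<Sum>i\<in>J. a i * chr (h i) \<omega>) = covol * (\<Sum>i\<in>J. (cmod (a i))\<^sup>2)"
  using nsq_trig_sum[of "h ` J" "\<lambda>k. a (inv_into J h k)"] assms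
  by (simp add: sum.reindex)

abbreviation "wavelet_index \<equiv> ({1..n - 1} \<times> UNIV :: (nat \<times> (int^'d)) set)"

lemma D_image_minus:
  assumes "- k = D *v z"
  shows "k = D *v (- z)"
proof -
  have "D *v (0 - z) = - (D *v z)" by (simp only: matrix_vector_mult_diff_distrib) simp
  then show ?thesis using assms by (metis diff_0 minus_minus)
qed

lemma minus_freq_not_D: "i \<in> wavelet_index \<Longrightarrow> \<nexists>z. - freq i = D *v z"
  using freq_not_D D_image_minus by blast

lemma lam_sum_wavelet:
  assumes "J \<subseteq> wavelet_index"
  shows "lam_sum (\<lambda>\<omega>. \<Sum>i\<in>J. a i * chr (- freq i) \<omega>) \<omega> = 0"
proof -
  have "lam_sum (\<lambda>\<omega>. \<Sum>i\<in>J. a i * chr (- freq i) \<omega>) \<omega>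
      = (\<Sum>i\<in>J. a i * chr (- freq i) \<omega> * (\<Sum>l<n. chr (- freq i) (lam (e l))))"
    unfolding lam_sum_def by (subst sum.swap) (simp add: chr_add_arg sum_distrib_left mult.assoc)
  also have "\<dots> = 0"
  proof (rule sum.neutral, rule ballI)
    fix i assume "i \<in> J"
    then have "\<nexists>z. - freq i = D *v z" using assms by (intro minus_freq_not_D) auto
    then show "a i * chr (- freq i) \<omega> * (\<Sum>l<n. chr (- freq i) (lam (e l))) = 0"
      by (simp add: chr_sum_lam)
  qed
  finally show ?thesis .
qed

lemma minus_freq_inj: "J \<subseteq> wavelet_index \<Longrightarrow> inj_on (\<lambda>i. - freq i) J"
  using inj_on_subset[OF freq_inj] by (auto simp: inj_on_def)

lemma per_trig_sum: "per (\<lambda>\<omega>. \<Sum>i\<in>J. a i * chr (h i) \<omega>)"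
  using perD[OF per_chr] by (simp add: per_def)

lemma wavelet_sum_upper:
  assumes "finite J" "J \<subseteq> wavelet_index"
  shows "nsq nuw (\<lambda>\<omega>. \<Sum>i\<in>J. a i * chr (- freq i) \<omega>) \<le> covol / c * (\<Sum>i\<in>J. (cmod (a i))\<^sup>2)"
proof -
  have "sq_int cellm (\<lambda>\<omega>. \<Sum>i\<in>J. a i * chr (- freq i) \<omega>)"
    by (intro sq_int_sum sq_int_cmult sq_int_chr)
  from nsq_nuw_le[OF this] show ?thesis
    using nsq_trig_sum_reindex[OF assms(1) minus_freq_inj[OF assms(2)], of a] by simp
qed

lemma wavelet_sum_lower:
  assumes \<delta>: "separated \<delta>" and J: "finite J" "J \<subseteq> wavelet_index"
  shows "\<delta> / (2 * real n) * covol * (\<Sum>i\<in>J. (cmod (a i))\<^sup>2) \<le> nsq nuw (\<lambda>\<omega>. \<Sum>i\<in>J. a i * chr (- freq i) \<omega>)"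
proof -
  let ?s = "\<lambda>\<omega>. \<Sum>i\<in>J. a i * chr (- freq i) \<omega>"
  have s: "sq_int cellm ?s" by (intro sq_int_sum sq_int_cmult sq_int_chr)
  have "ennreal (\<delta> / (2 * real n)) * ennreal (nsq cellm ?s) \<le> ennreal (nsq nuw ?s)"
    using separated_lower[OF \<delta> _ per_trig_sum, of a "\<lambda>i. - freq i" J]
      nn_nsq[OF s] nn_nsq[OF sq_int_nuw[OF s]] by (simp add: lam_sum_wavelet[OF J(2)])
  then have "\<delta> / (2 * real n) * nsq cellm ?s \<le> nsq nuw ?s"
    using \<delta> by (subst (asm) ennreal_mult[symmetric]) (auto simp: separated_def)
  then show ?thesis
    using nsq_trig_sum_reindex[OF J(1) minus_freq_inj[OF J(2)], of a] by (simp add: mult.assoc)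
qed

text \<open>The Fourier coefficients at frequencies in the image of D vanish, so a Fourier partial
  sum of s is already a combination of wavelet characters.\<close>

lemma wavelet_approx:
  assumes s: "sq_int cellm s" and p: "per s" and z: "AE \<omega> in cellm. lam_sum s \<omega> = 0" and "\<epsilon> > 0"
  shows "\<exists>J a. finite J \<and> J \<subseteq> wavelet_index \<and> nsq cellm (\<lambda>\<omega>. s \<omega> - (\<Sum>i\<in>J. a i * chr (- freq i) \<omega>)) < \<epsilon>"
proof -
  have "\<forall>\<^sub>F K in finite_subsets_at_top UNIV. nsq cellm (\<lambda>\<omega>. s \<omega> - (\<Sum>k\<in>K. fcoeff s k * chr k \<omega>)) < \<epsilon>"
    by (rule order_tendstoD(2)[OF fourier_tendsto[OF s] \<open>\<epsilon> > 0\<close>])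
  then obtain K where K: "finite K" "nsq cellm (\<lambda>\<omega>. s \<omega> - (\<Sum>k\<in>K. fcoeff s k * chr k \<omega>)) < \<epsilon>"
    unfolding eventually_finite_subsets_at_top by blast
  define J where "J = {i \<in> wavelet_index. - freq i \<in> K}"
  have inj: "inj_on (\<lambda>i. - freq i) J" by (rule minus_freq_inj) (auto simp: J_def)
  have im: "(\<lambda>i. - freq i) ` J = {k \<in> K. \<nexists>z. k = D *v z}"
  proof (intro equalityI subsetI)
    fix k assume k: "k \<in> {k \<in> K. \<nexists>z. k = D *v z}"
    have "\<nexists>z. - k = D *v z" using k D_image_minus by blast
    then obtain i where i: "i \<in> wavelet_index" "- k = freq i" using freq_surj by blast
    have ki: "k = - freq i" using i(2) by (metis minus_minus)
    moreover have "i \<in> J" using i(1) k by (simp add: J_def ki[symmetric])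
    ultimately show "k \<in> (\<lambda>i. - freq i) ` J" by (rule image_eqI)
  qed (use minus_freq_not_D in \<open>auto simp: J_def\<close>)
  have fin: "finite J" using im K(1) inj by (metis (no_types, lifting) finite_imageD finite_subset mem_Collect_eq subsetI)
  have "(\<Sum>i\<in>J. fcoeff s (- freq i) * chr (- freq i) \<omega>) = (\<Sum>k\<in>K. fcoeff s k * chr k \<omega>)" for \<omega>
  proof -
    have "(\<Sum>i\<in>J. fcoeff s (- freq i) * chr (- freq i) \<omega>) = (\<Sum>k\<in>(\<lambda>i. - freq i) ` J. fcoeff s k * chr k \<omega>)"
      using inj by (simp add: sum.reindex)
    also have "\<dots> = (\<Sum>k\<in>K. fcoeff s k * chr k \<omega>)"
      unfolding im using K(1) fcoeff_lam_sum_0[OF s p z] by (intro sum.mono_neutral_left) auto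
    finally show ?thesis .
  qed
  then show ?thesis
    using K(2) fin by (intro exI[of _ J] exI[of _ "\<lambda>i. fcoeff s (- freq i)"]) (auto simp: J_def)
qed

text \<open>
  The lower bound is violated by the difference of the indicators of a small periodic neighbourhood
  of \<open>\<omega>0\<close> and of its translate by \<open>lam (e m)\<close>.
\<close>

lemma wavelet_lower_imp_disjoint:
  assumes \<alpha>: "\<alpha> > 0"
    and lower: "\<And>J a. finite J \<Longrightarrow> J \<subseteq> wavelet_index \<Longrightarrow>
      \<alpha> * (\<Sum>i\<in>J. (cmod (a i))\<^sup>2) \<le> nsq nuw (\<lambda>\<omega>. \<Sum>i\<in>J. a i * chr (- freq i) \<omega>)"
    and m: "m \<in> {1..n - 1}"
  shows "w \<omega>0 \<noteq> 0 \<or> w (\<omega>0 + lam (e m)) \<noteq> 0"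
proof (rule ccontr)
  assume "\<not> ?thesis"
  then have w0: "w \<omega>0 = 0" "w (\<omega>0 + lam (e m)) = 0" by auto
  \<comment> \<open>By Parseval the assumed bound says that \<beta> times the plain norm is at most
    the weighted norm on combinations of wavelet characters.\<close>
  define \<beta> where "\<beta> = \<alpha> / covol"
  have \<beta>: "\<beta> > 0" using \<alpha> covol_pos by (simp add: \<beta>_def)
  \<comment> \<open>The bound extends by density to all s with vanishing coset sums; the factor 4
    comes from two uses of \<open>nsq_add_le\<close>.\<close>
  have main: "nsq cellm s \<le> 4 / \<beta> * nsq nuw s"
    if s: "sq_int cellm s" and p: "per s" and z: "AE \<omega> in cellm. lam_sum s \<omega> = 0" for s
  proof (rule field_le_epsilon)
    fix \<epsilon> :: real assume "\<epsilon> > 0"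
    define \<eta> where "\<eta> = \<epsilon> / (4 / \<beta> * (1 / c) + 2)"
    have den: "4 / \<beta> * (1 / c) + 2 > 0" using \<beta> c by (simp add: add_pos_pos)
    then have "\<eta> > 0" using \<open>\<epsilon> > 0\<close> by (simp add: \<eta>_def)
    from wavelet_approx[OF s p z this] obtain J a where J: "finite J" "J \<subseteq> wavelet_index"
      and ap: "nsq cellm (\<lambda>\<omega>. s \<omega> - (\<Sum>i\<in>J. a i * chr (- freq i) \<omega>)) < \<eta>"
      by (elim exE conjE) (rule that)
    let ?P = "\<lambda>\<omega>. \<Sum>i\<in>J. a i * chr (- freq i) \<omega>"
    have P: "sq_int cellm ?P" by (intro sq_int_sum sq_int_cmult sq_int_chr)
    have d: "sq_int cellm (\<lambda>\<omega>. s \<omega> - ?P \<omega>)" by (rule sq_int_diff[OF s P])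
    have "\<beta> * nsq cellm ?P \<le> nsq nuw ?P"
      using lower[OF J, of a] nsq_trig_sum_reindex[OF J(1) minus_freq_inj[OF J(2)], of a] covol_pos
      by (simp add: \<beta>_def)
    then have 1: "nsq cellm ?P \<le> nsq nuw ?P / \<beta>" using \<beta> by (simp add: pos_le_divide_eq mult.commute)
    have "nsq nuw (\<lambda>\<omega>. (s \<omega> - ?P \<omega>)) \<le> nsq cellm (\<lambda>\<omega>. s \<omega> - ?P \<omega>) / c" by (rule nsq_nuw_le[OF d])
    also have "\<dots> \<le> \<eta> / c" using ap c by (simp add: divide_right_mono)
    finally have 2: "nsq nuw (\<lambda>\<omega>. s \<omega> - ?P \<omega>) \<le> \<eta> / c" .
    have "nsq nuw ?P \<le> 2 * nsq nuw s + 2 * nsq nuw (\<lambda>\<omega>. (-1) * (s \<omega> - ?P \<omega>))"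
      using nsq_add_le[OF sq_int_nuw[OF s] sq_int_cmult[OF sq_int_nuw[OF d]], of "-1"] by simp
    also have "\<dots> \<le> 2 * nsq nuw s + 2 * (\<eta> / c)" using 2 by (simp only: nsq_cmult) simp
    finally have 3: "nsq nuw ?P / \<beta> \<le> (2 * nsq nuw s + 2 * (\<eta> / c)) / \<beta>"
      using \<beta> by (simp add: divide_right_mono)
    have "nsq cellm s \<le> 2 * nsq cellm (\<lambda>\<omega>. s \<omega> - ?P \<omega>) + 2 * nsq cellm ?P"
      using nsq_add_le[OF d P] by simp
    also have "\<dots> \<le> 2 * \<eta> + 2 * ((2 * nsq nuw s + 2 * (\<eta> / c)) / \<beta>)" using ap 1 3 by linarith
    also have "\<dots> = 4 / \<beta> * nsq nuw s + \<eta> * (4 / \<beta> * (1 / c) + 2)" using \<beta> c by (simp add: field_simps)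
    also have "\<eta> * (4 / \<beta> * (1 / c) + 2) = \<epsilon>" using den by (simp add: \<eta>_def)
    finally show "nsq cellm s \<le> 4 / \<beta> * nsq nuw s + \<epsilon>" .
  qed
  obtain k where k: "chr k (lam (e m)) \<noteq> 1" using lam_not_lattice[OF m] by blast
  \<comment> \<open>Half the distance between the two character values, so that U and its translate
    by \<open>lam (e m)\<close> cannot meet.\<close>
  define \<rho> where "\<rho> = cmod (chr k (lam (e m)) - 1) / 2"
  have \<rho>: "\<rho> > 0" using k by (simp add: \<rho>_def)
  \<comment> \<open>The second condition controls w on the translate of U. With \<beta>/8 the factor
    4/\<beta> of the extended bound leaves 1/2, so that the norm of s must vanish.\<close>
  define U where "U = {\<omega>. w \<omega> < \<beta> / 8 \<and> w (\<omega> + lam (e m)) < \<beta> / 8 \<and> cmod (chr k \<omega> - chr k \<omega>0) < \<rho>}"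
  have U: "open U" unfolding U_def
    by (intro open_Collect_conj open_Collect_less w_continuous w_shift_continuous continuous_intros chr_continuous)
  have "\<omega>0 \<in> U" using w0 \<beta> \<rho> by (simp add: U_def)
  have Uper: "\<omega> + pt l \<in> U \<longleftrightarrow> \<omega> \<in> U" for \<omega> l
    using perD[OF per_w, of "\<omega> + lam (e m)" l] perD[OF per_w, of \<omega> l] perD[OF per_chr, of k \<omega> l]
    by (simp add: U_def add_ac)
  have disj: "\<omega> \<notin> U \<or> \<omega> - lam (e m) \<notin> U" for \<omega>
  proof (rule ccontr)
    assume "\<not> ?thesis"
    then have "cmod (chr k \<omega> - chr k \<omega>0) < \<rho>" "cmod (chr k (\<omega> - lam (e m)) - chr k \<omega>0) < \<rho>"
      by (auto simp: U_def)
    then have "cmod (chr k \<omega> - chr k (\<omega> - lam (e m))) < 2 * \<rho>"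
      using norm_triangle_ineq4[of "chr k \<omega> - chr k \<omega>0" "chr k (\<omega> - lam (e m)) - chr k \<omega>0"] by simp
    moreover have "chr k \<omega> - chr k (\<omega> - lam (e m)) = chr k (\<omega> - lam (e m)) * (chr k (lam (e m)) - 1)"
      using chr_add_arg[of k "\<omega> - lam (e m)" "lam (e m)"] by (simp add: algebra_simps)
    ultimately show False by (simp add: norm_mult \<rho>_def)
  qed
  define b :: "real^'d \<Rightarrow> complex" where "b = indicator U"
  define s where "s \<omega> = b \<omega> - b (\<omega> - lam (e m))" for \<omega>
  have bm [measurable]: "b \<in> borel_measurable borel" using U by (simp add: b_def borel_measurable_indicator)
  have sm [measurable]: "s \<in> borel_measurable borel" unfolding s_def[abs_def] by measurable
  have pb: "per b" by (simp add: per_def b_def indicator_def Uper)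
  have ps: "per s"
    unfolding per_def s_def using perD[OF pb] by (metis add_diff_eq diff_add_eq)
  have ssq: "sq_int cellm s"
    by (rule sq_int_bounded_cellm[OF sm, of 2]) (auto simp: s_def b_def indicator_def)
  have ls: "lam_sum s \<omega> = 0" for \<omega>
  proof -
    have "lam_sum s \<omega> = (\<Sum>l<n. b (\<omega> + lam (e l))) - (\<Sum>l<n. b (\<omega> - lam (e m) + lam (e l)))"
      unfolding lam_sum_def s_def by (simp add: sum_subtractf algebra_simps)
    also have "(\<Sum>l<n. b (\<omega> + lam (e l))) = (\<Sum>l<n. b (\<omega> - lam (e m) + lam (e l)))"
      using sum_lam_shift[OF pb, of "\<omega> - lam (e m)" "e m"] by (simp add: algebra_simps)
    finally show ?thesis by simp
  qed
  have small: "w \<omega> * (cmod (s \<omega>))\<^sup>2 \<le> \<beta> / 8 * (cmod (s \<omega>))\<^sup>2" for \<omega>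
  proof (cases "s \<omega> = 0")
    case False
    then have "\<omega> \<in> U \<or> \<omega> - lam (e m) \<in> U" by (auto simp: s_def b_def indicator_def)
    then have "w \<omega> < \<beta> / 8" by (auto simp: U_def)
    then show ?thesis by (intro mult_right_mono) auto
  qed simp
  have "ennreal (nsq nuw s) \<le> ennreal (\<beta> / 8 * nsq cellm s)"
  proof -
    have "ennreal (nsq nuw s) = (\<integral>\<^sup>+\<omega>. ennreal (w \<omega> * (cmod (s \<omega>))\<^sup>2) \<partial>cellm)"
      by (simp add: nn_nsq[OF sq_int_nuw[OF ssq], symmetric] nn_nuw ennreal_mult w_nonneg)
    also have "\<dots> \<le> (\<integral>\<^sup>+\<omega>. ennreal (\<beta> / 8 * (cmod (s \<omega>))\<^sup>2) \<partial>cellm)"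
      by (intro nn_integral_mono ennreal_leI small)
    also have "\<dots> = ennreal (\<integral>\<omega>. \<beta> / 8 * (cmod (s \<omega>))\<^sup>2 \<partial>cellm)"
      by (rule nn_integral_eq_integral)
         (use \<beta> in \<open>auto intro!: Bochner_Integration.integrable_mult_right sq_int_integrable[OF ssq]\<close>)
    also have "\<dots> = ennreal (\<beta> / 8 * nsq cellm s)"
      unfolding nsq_def by (simp only: integral_mult_right_zero)
    finally show ?thesis .
  qed
  then have "nsq nuw s \<le> \<beta> / 8 * nsq cellm s" using \<beta> by simp
  then have "4 / \<beta> * nsq nuw s \<le> 1 / 2 * nsq cellm s" using \<beta> by (simp add: field_simps)
  moreover have "nsq cellm s \<le> 4 / \<beta> * nsq nuw s" by (rule main[OF ssq ps]) (simp add: ls)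
  ultimately have "nsq cellm s = 0" using nsq_nonneg[of cellm s] by linarith
  then have "(\<integral>\<^sup>+\<omega>. ennreal ((cmod (s \<omega>))\<^sup>2) \<partial>cellm) = 0" by (simp add: nn_nsq[OF ssq])
  then have "AE \<omega> in cellm. ennreal ((cmod (s \<omega>))\<^sup>2) = 0"
    by (subst (asm) nn_integral_0_iff_AE) (auto simp: borel_cellm)
  \<comment> \<open>Being periodic, s vanishes almost everywhere on the whole space, where it meets
    the open set U; but s is 1 on U.\<close>
  then have AE0: "AE \<omega> in cellm. ennreal ((cmod (s \<omega>))\<^sup>2) * (\<integral>\<^sup>+k. 1 \<partial>count_space (UNIV :: (int^'d) set)) = 0"
    by eventually_elim simp
  have "(\<integral>\<^sup>+\<omega>. ennreal ((cmod (s \<omega>))\<^sup>2) * 1 \<partial>lborel)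
      = (\<integral>\<^sup>+\<omega>. ennreal ((cmod (s \<omega>))\<^sup>2) * (\<integral>\<^sup>+k. 1 \<partial>count_space (UNIV :: (int^'d) set)) \<partial>cellm)"
    by (rule periodize) (use ps in \<open>auto simp: per_def\<close>)
  also have "\<dots> = (\<integral>\<^sup>+\<omega>. 0 \<partial>cellm)" by (rule nn_integral_cong_AE[OF AE0])
  finally have "(\<integral>\<^sup>+\<omega>. ennreal ((cmod (s \<omega>))\<^sup>2) \<partial>lborel) = 0" by simp
  then have "AE \<omega> in lborel. ennreal ((cmod (s \<omega>))\<^sup>2) = 0"
    by (subst (asm) nn_integral_0_iff_AE) auto
  then obtain \<omega> where "\<omega> \<in> U" "ennreal ((cmod (s \<omega>))\<^sup>2) = 0"
    using open_AE_ex[OF U, of "\<lambda>\<omega>. ennreal ((cmod (s \<omega>))\<^sup>2) = 0"] \<open>\<omega>0 \<in> U\<close> by blast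
  then have "s \<omega> = 0" "\<omega> \<in> U" by auto
  then show False using disj[of \<omega>] by (auto simp: s_def b_def indicator_def split: if_splits)
qed

end

section \<open>Spline spaces and their orthogonal complements\<close>

lemma L2_tendsto_nsq:
  assumes "\<And>i. sq_int lborel (s i)" "sq_int lborel h"
  shows "L2_tendsto s h F \<longleftrightarrow> ((\<lambda>i. nsq lborel (\<lambda>x. s i x - h x)) \<longlongrightarrow> 0) F"
proof -
  have "(\<integral>\<^sup>+x. ennreal ((cmod (s i x - h x))\<^sup>2) \<partial>lborel) = ennreal (nsq lborel (\<lambda>x. s i x - h x))" for i
    by (rule nn_nsq[OF sq_int_diff[OF assms]])
  then show ?thesis
    unfolding L2_tendsto_def by (simp add: tendsto_ennreal_iff[of _ _ 0, simplified])
qed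

lemma nsq_minus_commute: "nsq N (\<lambda>x. f x - g x) = nsq N (\<lambda>x. g x - f x)"
  by (simp add: nsq_def norm_minus_commute)

text \<open>Orthogonality passes to L2 limits by Cauchy--Schwarz.\<close>

lemma ip_limit_0:
  assumes s: "\<And>i. sq_int lborel (s i)" "sq_int lborel v" and h: "sq_int lborel h"
    and lim: "L2_tendsto s v F" and F: "F \<noteq> bot" and 0: "\<And>i. ip lborel h (s i) = 0"
  shows "ip lborel h v = 0"
proof -
  have le: "(cmod (ip lborel h v))\<^sup>2 \<le> nsq lborel h * nsq lborel (\<lambda>x. s i x - v x)" for i
  proof -
    have "ip lborel h (\<lambda>x. s i x - v x) = - ip lborel h v"
      using 0 by (simp add: ip_diff_right s h)
    then show ?thesis
      using ip_Cauchy_Schwarz[OF h sq_int_diff[OF s(1)[of i] s(2)]] by simp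
  qed
  have "((\<lambda>i. nsq lborel h * nsq lborel (\<lambda>x. s i x - v x)) \<longlongrightarrow> nsq lborel h * 0) F"
    using lim by (intro tendsto_intros) (simp add: L2_tendsto_nsq s)
  then have "(cmod (ip lborel h v))\<^sup>2 \<le> nsq lborel h * 0"
    by (rule tendsto_lowerbound[OF _ always_eventually F]) (use le in blast)
  then show ?thesis by simp
qed

text \<open>The spline spaces of both scales, with the translates of the B-spline regarded as an
  arbitrary family.\<close>

definition l2_span :: "('k \<Rightarrow> real^'d \<Rightarrow> complex) \<Rightarrow> (real^'d \<Rightarrow> complex) set" where
  "l2_span \<phi> = {h. L2 h \<and> (\<exists>c. (\<lambda>k. (cmod (c k))\<^sup>2) summable_on UNIV \<and>
     L2_tendsto (\<lambda>K x. \<Sum>k\<in>K. c k * \<phi> k x) h (finite_subsets_at_top UNIV))}"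

lemma l2_span_generator:
  assumes "sq_int lborel (\<phi> k)"
  shows "\<phi> k \<in> l2_span \<phi>"
proof -
  let ?c = "\<lambda>l. if l = k then 1 else 0 :: complex"
  have "(\<lambda>l. (cmod (?c l))\<^sup>2) summable_on UNIV"
  proof -
    have "(\<lambda>l. (cmod (?c l))\<^sup>2) summable_on {k}" by simp
    then show ?thesis by (rule summable_on_cong_neutral[THEN iffD1, rotated -1]) auto
  qed
  moreover have "L2_tendsto (\<lambda>K x. \<Sum>l\<in>K. ?c l * \<phi> l x) (\<phi> k) (finite_subsets_at_top UNIV)"
  proof -
    have "\<forall>\<^sub>F K in finite_subsets_at_top UNIV.
        (\<integral>\<^sup>+x. ennreal ((cmod ((\<Sum>l\<in>K. ?c l * \<phi> l x) - \<phi> k x))\<^sup>2) \<partial>lborel) = 0"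
      unfolding eventually_finite_subsets_at_top
    proof (intro exI[of _ "{k}"] conjI allI impI)
      fix K assume K: "finite K \<and> {k} \<subseteq> K \<and> K \<subseteq> UNIV"
      have "(\<Sum>l\<in>K. ?c l * \<phi> l x) = \<phi> k x" for x
      proof -
        have "(\<Sum>l\<in>K. ?c l * \<phi> l x) = (\<Sum>l\<in>K. if l = k then \<phi> l x else 0)" by (rule sum.cong) auto
        then show ?thesis using K by simp
      qed
      then show "(\<integral>\<^sup>+x. ennreal ((cmod ((\<Sum>l\<in>K. ?c l * \<phi> l x) - \<phi> k x))\<^sup>2) \<partial>lborel) = 0" by simp
    qed auto
    then show ?thesis unfolding L2_tendsto_def by (rule tendsto_eventually)
  qed
  ultimately show ?thesis
    using assms by (auto simp: l2_span_def L2_iff)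
qed

text \<open>All that is used of the spline data: \<open>Ld\<close> and \<open>Ld'\<close> are the
  filters of scales j and j + 1, periodic under the respective dual lattice, and the translates of
  B-splines and wavelets enter through their transforms. Translation by a vector gives the conjugate
  character, whence the negated indices.\<close>

locale wavelet_system = wavelet_fourier T S D B e n f g r C c
  for T S :: "real^'d^'d" and D B e n f g r C c +
  fixes Ld Ld' :: "real^'d \<Rightarrow> complex" and \<kappa> a b a' b' :: real
    and \<phi> \<phi>' :: "int^'d \<Rightarrow> real^'d \<Rightarrow> complex" and \<psi> :: "nat \<times> (int^'d) \<Rightarrow> real^'d \<Rightarrow> complex"
  assumes Ld_measurable [measurable]: "Ld \<in> borel_measurable borel" and per_Ld: "per Ld"
    and Ld'_measurable [measurable]: "Ld' \<in> borel_measurable borel" and per_Ld': "per_lam Ld'"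
    and \<kappa>: "\<kappa> > 0" and a: "a > 0" and a': "a' > 0"
    and bounds: "AE \<omega> in lborel. a \<le> (cmod (Ld \<omega>))\<^sup>2 * M \<omega> \<and> (cmod (Ld \<omega>))\<^sup>2 * M \<omega> \<le> b"
    and bounds': "AE \<omega> in lborel. a' \<le> (cmod (Ld' \<omega>))\<^sup>2 * lam_sum M \<omega> \<and> (cmod (Ld' \<omega>))\<^sup>2 * lam_sum M \<omega> \<le> b'"
    and \<phi>: "\<And>k. L2_inv_fourier (\<lambda>\<omega>. chr (- k) \<omega> * Ld \<omega> * u \<omega>) (\<phi> k)"
    and \<phi>': "\<And>k. L2_inv_fourier (\<lambda>\<omega>. chr (- (D *v k)) \<omega> * Ld' \<omega> * u \<omega>) (\<phi>' k)"
    and \<psi>: "\<And>i. i \<in> wavelet_index \<Longrightarrow>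
      L2_inv_fourier (\<lambda>\<omega>. of_real \<kappa> * chr (- freq i) \<omega> * of_real (w \<omega>) * u \<omega>) (\<psi> i)"
begin

abbreviation "W \<equiv> {h \<in> l2_span \<phi>. \<forall>v \<in> l2_span \<phi>'. L2_inner h v = 0}"

section \<open>Riesz bounds for the filters of the two scales\<close>

lemma nn_Ld:
  assumes [measurable]: "F \<in> borel_measurable borel"
  shows "(\<integral>\<^sup>+\<omega>. ennreal ((cmod (F \<omega> * Ld \<omega>))\<^sup>2) \<partial>nuM)
    = (\<integral>\<^sup>+\<omega>. ennreal ((cmod (F \<omega>))\<^sup>2 * ((cmod (Ld \<omega>))\<^sup>2 * M \<omega>)) \<partial>cellm)"
  by (subst nn_nuM) (auto simp: norm_mult power_mult_distrib ennreal_mult[symmetric] M_nonneg mult_ac)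

lemma b_nonneg: "0 \<le> b" and b'_nonneg: "0 \<le> b'"
proof -
  obtain \<omega> :: "real^'d" where "a \<le> (cmod (Ld \<omega>))\<^sup>2 * M \<omega> \<and> (cmod (Ld \<omega>))\<^sup>2 * M \<omega> \<le> b"
    using open_AE_ex[OF open_UNIV UNIV_not_empty bounds] by blast
  then show "0 \<le> b" using a by linarith
  obtain \<omega> :: "real^'d" where "a' \<le> (cmod (Ld' \<omega>))\<^sup>2 * lam_sum M \<omega> \<and> (cmod (Ld' \<omega>))\<^sup>2 * lam_sum M \<omega> \<le> b'"
    using open_AE_ex[OF open_UNIV UNIV_not_empty bounds'] by blast
  then show "0 \<le> b'" using a' by linarith
qed

lemma nn_cmult_cellm:
  assumes "F \<in> borel_measurable borel" "0 \<le> t"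
  shows "(\<integral>\<^sup>+\<omega>. ennreal (t * (cmod (F \<omega>))\<^sup>2) \<partial>cellm) = ennreal t * (\<integral>\<^sup>+\<omega>. ennreal ((cmod (F \<omega>))\<^sup>2) \<partial>cellm)"
proof -
  have "ennreal (t * x) = ennreal t * ennreal x" if "x \<ge> 0" for x
    using assms(2) that by (intro ennreal_mult) auto
  then show ?thesis
    using assms(1) by (simp only: zero_le_power2) (rule nn_integral_cmult; simp add: borel_cellm)
qed

text \<open>With \<open>nn_Ld_lower\<close>: multiplication by \<open>Ld\<close> is bounded above
  and below from L2 of the cell to L2 of \<open>nuM\<close>, which is the Riesz property of the fine
  B-splines.\<close>

lemma nn_Ld_upper:
  assumes [measurable]: "F \<in> borel_measurable borel"
  shows "(\<integral>\<^sup>+\<omega>. ennreal ((cmod (F \<omega> * Ld \<omega>))\<^sup>2) \<partial>nuM) \<le> ennreal b * (\<integral>\<^sup>+\<omega>. ennreal ((cmod (F \<omega>))\<^sup>2) \<partial>cellm)"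
proof -
  have "(\<integral>\<^sup>+\<omega>. ennreal ((cmod (F \<omega> * Ld \<omega>))\<^sup>2) \<partial>nuM) \<le> (\<integral>\<^sup>+\<omega>. ennreal (b * (cmod (F \<omega>))\<^sup>2) \<partial>cellm)"
    unfolding nn_Ld[OF assms]
  proof (rule nn_integral_mono_AE, use AE_cellm[OF bounds] in eventually_elim)
    case (elim \<omega>)
    then show ?case
      using mult_right_mono[of "(cmod (Ld \<omega>))\<^sup>2 * M \<omega>" b "(cmod (F \<omega>))\<^sup>2"] by (intro ennreal_leI) (simp add: mult_ac)
  qed
  then show ?thesis by (simp only: nn_cmult_cellm[OF assms b_nonneg])
qed

lemma nn_Ld_lower:
  assumes [measurable]: "F \<in> borel_measurable borel"
  shows "ennreal a * (\<integral>\<^sup>+\<omega>. ennreal ((cmod (F \<omega>))\<^sup>2) \<partial>cellm) \<le> (\<integral>\<^sup>+\<omega>. ennreal ((cmod (F \<omega> * Ld \<omega>))\<^sup>2) \<partial>nuM)"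
proof -
  have "(\<integral>\<^sup>+\<omega>. ennreal (a * (cmod (F \<omega>))\<^sup>2) \<partial>cellm) \<le> (\<integral>\<^sup>+\<omega>. ennreal ((cmod (F \<omega> * Ld \<omega>))\<^sup>2) \<partial>nuM)"
    unfolding nn_Ld[OF assms]
  proof (rule nn_integral_mono_AE, use AE_cellm[OF bounds] in eventually_elim)
    case (elim \<omega>)
    then show ?case
      using mult_right_mono[of a "(cmod (Ld \<omega>))\<^sup>2 * M \<omega>" "(cmod (F \<omega>))\<^sup>2"] by (intro ennreal_leI) (simp add: mult_ac)
  qed
  then show ?thesis using a by (simp only: nn_cmult_cellm[OF assms less_imp_le])
qed

text \<open>Translating by each \<open>lam (e l)\<close> leaves F and the integral over the cell
  unchanged; adding the n copies replaces M by the coset sum, which the coarse localization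
  condition controls.\<close>

lemma nn_lam_sum_M:
  assumes [measurable]: "F \<in> borel_measurable borel" and F: "per_lam F"
  shows "of_nat n * (\<integral>\<^sup>+\<omega>. ennreal ((cmod (F \<omega>))\<^sup>2) \<partial>nuM)
    = (\<integral>\<^sup>+\<omega>. ennreal ((cmod (F \<omega>))\<^sup>2 * lam_sum M \<omega>) \<partial>cellm)"
proof -
  have "of_nat n * (\<integral>\<^sup>+\<omega>. ennreal ((cmod (F \<omega>))\<^sup>2) \<partial>nuM)
      = of_nat n * (\<integral>\<^sup>+\<omega>. ennreal ((cmod (F \<omega>))\<^sup>2 * M \<omega>) \<partial>cellm)"
    by (subst nn_nuM) (auto simp: ennreal_mult[symmetric] M_nonneg mult.commute)
  also have "\<dots> = (\<integral>\<^sup>+\<omega>. (\<Sum>l<n. ennreal ((cmod (F (\<omega> + lam (e l))))\<^sup>2 * M (\<omega> + lam (e l)))) \<partial>cellm)"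
    by (rule nn_sum_lam[symmetric]) (use perD[OF per_lam_per[OF F]] perD[OF per_M] in \<open>auto simp: per_def\<close>)
  also have "\<dots> = (\<integral>\<^sup>+\<omega>. ennreal ((cmod (F \<omega>))\<^sup>2 * lam_sum M \<omega>) \<partial>cellm)"
    by (simp add: per_lamD[OF F] lam_sum_def sum_distrib_left sum_ennreal M_nonneg)
  finally show ?thesis .
qed

lemma nn_Ld'_upper:
  assumes [measurable]: "F \<in> borel_measurable borel" and F: "per_lam F"
  shows "of_nat n * (\<integral>\<^sup>+\<omega>. ennreal ((cmod (F \<omega> * Ld' \<omega>))\<^sup>2) \<partial>nuM) \<le> ennreal b' * (\<integral>\<^sup>+\<omega>. ennreal ((cmod (F \<omega>))\<^sup>2) \<partial>cellm)"
proof -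
  have "of_nat n * (\<integral>\<^sup>+\<omega>. ennreal ((cmod (F \<omega> * Ld' \<omega>))\<^sup>2) \<partial>nuM)
      = (\<integral>\<^sup>+\<omega>. ennreal ((cmod (F \<omega> * Ld' \<omega>))\<^sup>2 * lam_sum M \<omega>) \<partial>cellm)"
    by (rule nn_lam_sum_M) (use F per_Ld' in \<open>auto simp: per_lam_def\<close>)
  also have "\<dots> \<le> (\<integral>\<^sup>+\<omega>. ennreal (b' * (cmod (F \<omega>))\<^sup>2) \<partial>cellm)"
  proof (rule nn_integral_mono_AE, use AE_cellm[OF bounds'] in eventually_elim)
    case (elim \<omega>)
    then show ?case
      using mult_right_mono[of "(cmod (Ld' \<omega>))\<^sup>2 * lam_sum M \<omega>" b' "(cmod (F \<omega>))\<^sup>2"]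
      by (intro ennreal_leI) (simp add: norm_mult power_mult_distrib mult_ac)
  qed
  finally show ?thesis by (simp only: nn_cmult_cellm[OF assms(1) b'_nonneg])
qed

lemma nn_Ld'_lower:
  assumes [measurable]: "F \<in> borel_measurable borel" and F: "per_lam F"
  shows "ennreal a' * (\<integral>\<^sup>+\<omega>. ennreal ((cmod (F \<omega>))\<^sup>2) \<partial>cellm) \<le> of_nat n * (\<integral>\<^sup>+\<omega>. ennreal ((cmod (F \<omega> * Ld' \<omega>))\<^sup>2) \<partial>nuM)"
proof -
  have "of_nat n * (\<integral>\<^sup>+\<omega>. ennreal ((cmod (F \<omega> * Ld' \<omega>))\<^sup>2) \<partial>nuM)
      = (\<integral>\<^sup>+\<omega>. ennreal ((cmod (F \<omega> * Ld' \<omega>))\<^sup>2 * lam_sum M \<omega>) \<partial>cellm)"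
    by (rule nn_lam_sum_M) (use F per_Ld' in \<open>auto simp: per_lam_def\<close>)
  moreover have "(\<integral>\<^sup>+\<omega>. ennreal (a' * (cmod (F \<omega>))\<^sup>2) \<partial>cellm)
      \<le> (\<integral>\<^sup>+\<omega>. ennreal ((cmod (F \<omega> * Ld' \<omega>))\<^sup>2 * lam_sum M \<omega>) \<partial>cellm)"
  proof (rule nn_integral_mono_AE, use AE_cellm[OF bounds'] in eventually_elim)
    case (elim \<omega>)
    then show ?case
      using mult_right_mono[of a' "(cmod (Ld' \<omega>))\<^sup>2 * lam_sum M \<omega>" "(cmod (F \<omega>))\<^sup>2"]
      by (intro ennreal_leI) (simp add: norm_mult power_mult_distrib mult_ac)
  qed
  ultimately show ?thesis using a' by (simp only: nn_cmult_cellm[OF assms(1) less_imp_le])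
qed

lemma sq_int_of_nn_le:
  assumes "F \<in> borel_measurable borel" "0 < t"
    and "ennreal t * (\<integral>\<^sup>+\<omega>. ennreal ((cmod (F \<omega>))\<^sup>2) \<partial>cellm) \<le> X" "X < \<infinity>"
  shows "sq_int cellm F"
proof -
  have "ennreal t * (\<integral>\<^sup>+\<omega>. ennreal ((cmod (F \<omega>))\<^sup>2) \<partial>cellm) < \<infinity>"
    using assms(3,4) by (rule le_less_trans)
  then have "(\<integral>\<^sup>+\<omega>. ennreal ((cmod (F \<omega>))\<^sup>2) \<partial>cellm) < \<infinity>"
    using assms(2) by (auto simp: ennreal_mult_less_top)
  then show ?thesis using assms(1) by (simp add: sq_int_iff_nn borel_cellm)
qed

lemma AE_Ld: "AE \<omega> in cellm. Ld \<omega> \<noteq> 0" and AE_Ld': "AE \<omega> in cellm. Ld' \<omega> \<noteq> 0 \<and> lam_sum M \<omega> > 0"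
proof -
  show "AE \<omega> in cellm. Ld \<omega> \<noteq> 0"
    using AE_cellm[OF bounds] by eventually_elim (use a in auto)
  have nn: "lam_sum M \<omega> \<ge> 0" for \<omega> by (simp add: lam_sum_def sum_nonneg M_nonneg)
  show "AE \<omega> in cellm. Ld' \<omega> \<noteq> 0 \<and> lam_sum M \<omega> > 0"
    using AE_cellm[OF bounds'] by eventually_elim (use a' nn in \<open>auto simp: order_less_le\<close>)
qed

section \<open>Splines and wavelets through their periodic factors\<close>

lemma inv_fourier_q:
  assumes "L2_inv_fourier (\<lambda>\<omega>. q \<omega> * u \<omega>) h" "q \<in> borel_measurable borel" "per q"
  shows "sq_int nuM q" "nsq nuM q = ((2 * pi) ^ CARD('d)) * nsq lborel h"
  using inv_fourier_sq_int(1)[OF assms(1)] inv_fourier_nsq[OF assms(1)] assms(2,3)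
  by (simp_all add: sq_int_u nsq_u)

lemma inv_fourier_q_ip:
  assumes "L2_inv_fourier (\<lambda>\<omega>. q \<omega> * u \<omega>) h" "q \<in> borel_measurable borel" "per q"
    and "L2_inv_fourier (\<lambda>\<omega>. q' \<omega> * u \<omega>) h'" "q' \<in> borel_measurable borel" "per q'"
  shows "ip nuM q q' = ((2 * pi) ^ CARD('d)) * ip lborel h h'"
  using inv_fourier_ip[OF assms(1,4)] assms by (simp add: ip_u)

lemma per_trig_Ld: "per (\<lambda>\<omega>. (\<Sum>k\<in>K. t k * chr (h k) \<omega>) * Ld \<omega>)"
  using perD[OF per_chr] perD[OF per_Ld] by (simp add: per_def)

lemma sum_\<phi>: "L2_inv_fourier (\<lambda>\<omega>. (\<Sum>k\<in>K. t k * chr (- k) \<omega>) * Ld \<omega> * u \<omega>) (\<lambda>x. \<Sum>k\<in>K. t k * \<phi> k x)"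
proof -
  have "L2_inv_fourier (\<lambda>\<omega>. \<Sum>k\<in>K. t k * (chr (- k) \<omega> * Ld \<omega> * u \<omega>)) (\<lambda>x. \<Sum>k\<in>K. t k * \<phi> k x)"
    by (intro inv_fourier_sum inv_fourier_cmult \<phi>)
  then show ?thesis by (simp add: sum_distrib_right mult.assoc)
qed

lemma sum_\<psi>:
  assumes "J \<subseteq> wavelet_index"
  shows "L2_inv_fourier (\<lambda>\<omega>. of_real \<kappa> * (\<Sum>i\<in>J. t i * chr (- freq i) \<omega>) * of_real (w \<omega>) * u \<omega>) (\<lambda>x. \<Sum>i\<in>J. t i * \<psi> i x)"
proof -
  have "L2_inv_fourier (\<lambda>\<omega>. \<Sum>i\<in>J. t i * (of_real \<kappa> * chr (- freq i) \<omega> * of_real (w \<omega>) * u \<omega>)) (\<lambda>x. \<Sum>i\<in>J. t i * \<psi> i x)"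
    by (intro inv_fourier_sum inv_fourier_cmult \<psi>) (use assms in auto)
  then show ?thesis by (simp add: sum_distrib_right sum_distrib_left mult_ac)
qed

lemma nsq_sum_\<psi>:
  assumes "J \<subseteq> wavelet_index"
  shows "nsq lborel (\<lambda>x. \<Sum>i\<in>J. t i * \<psi> i x) = \<kappa>\<^sup>2 / ((2 * pi) ^ CARD('d)) * nsq nuw (\<lambda>\<omega>. \<Sum>i\<in>J. t i * chr (- freq i) \<omega>)"
proof -
  let ?s = "\<lambda>\<omega>. \<Sum>i\<in>J. t i * chr (- freq i) \<omega>"
  have "((2 * pi) ^ CARD('d)) * nsq lborel (\<lambda>x. \<Sum>i\<in>J. t i * \<psi> i x) = nsq nuM (\<lambda>\<omega>. of_real \<kappa> * ?s \<omega> * of_real (w \<omega>))"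
    by (rule inv_fourier_q(2)[OF sum_\<psi>[OF assms], symmetric])
       (use perD[OF per_chr] perD[OF per_w] in \<open>auto simp: per_def\<close>)
  also have "\<dots> = \<kappa>\<^sup>2 * nsq nuM (\<lambda>\<omega>. ?s \<omega> * of_real (w \<omega>))"
    using nsq_cmult[of nuM "of_real \<kappa>" "\<lambda>\<omega>. ?s \<omega> * of_real (w \<omega>)"] by (simp add: mult.assoc)
  also have "nsq nuM (\<lambda>\<omega>. ?s \<omega> * of_real (w \<omega>)) = nsq nuw ?s"
    by (rule nsq_w) measurable
  finally show ?thesis by (simp add: field_simps)
qed

text \<open>The Fourier series of q / Ld provides the coefficients: the lower filter bound makes
  this quotient square integrable, the upper one carries convergence over to the splines.\<close>

lemma in_l2_span_\<phi>:
  assumes h: "L2_inv_fourier (\<lambda>\<omega>. q \<omega> * u \<omega>) h" and [measurable]: "q \<in> borel_measurable borel" and q: "per q"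
  shows "h \<in> l2_span \<phi>"
proof -
  define F where "F \<omega> = q \<omega> / Ld \<omega>" for \<omega>
  have [measurable]: "F \<in> borel_measurable borel" unfolding F_def[abs_def] by measurable
  have FL: "AE \<omega> in cellm. F \<omega> * Ld \<omega> = q \<omega>" using AE_Ld by eventually_elim (simp add: F_def)
  have "(\<integral>\<^sup>+\<omega>. ennreal ((cmod (F \<omega> * Ld \<omega>))\<^sup>2) \<partial>nuM) = (\<integral>\<^sup>+\<omega>. ennreal ((cmod (q \<omega>))\<^sup>2) \<partial>nuM)"
    by (rule nn_integral_cong_AE) (use AE_nuM[OF FL] in eventually_elim, simp)
  also have "\<dots> < \<infinity>" using nn_nsq[OF inv_fourier_q(1)[OF h _ q]] by simp
  finally have F: "sq_int cellm F" by (intro sq_int_of_nn_le[OF _ a nn_Ld_lower]) auto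
  \<comment> \<open>The sign compensates the character of index -k in the transform of
    \<open>\<phi> k\<close>.\<close>
  define t where "t k = fcoeff F (- k)" for k
  have "(\<lambda>k. (cmod (fcoeff F k))\<^sup>2) summable_on UNIV"
    using parseval[OF F] by (rule has_sum_imp_summable)
  then have summ: "(\<lambda>k. (cmod (t k))\<^sup>2) summable_on UNIV"
    unfolding t_def by (subst summable_on_reindex_bij_betw[of uminus UNIV UNIV]) (auto simp: bij_uminus)
  have sh: "sq_int lborel h" by (rule inv_fourier_sq_int(2)[OF h])
  have sK: "sq_int lborel (\<lambda>x. \<Sum>k\<in>K. t k * \<phi> k x)" for K
    by (rule inv_fourier_sq_int(2)[OF sum_\<phi>])
  have est: "nsq lborel (\<lambda>x. (\<Sum>k\<in>K. t k * \<phi> k x) - h x)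
      \<le> b / ((2 * pi) ^ CARD('d)) * nsq cellm (\<lambda>\<omega>. F \<omega> - (\<Sum>k\<in>K. t k * chr (- k) \<omega>))" for K
  proof -
    let ?P = "\<lambda>\<omega>. \<Sum>k\<in>K. t k * chr (- k) \<omega>"
    have d: "sq_int cellm (\<lambda>\<omega>. F \<omega> - ?P \<omega>)"
      by (intro sq_int_diff F sq_int_sum sq_int_cmult sq_int_chr)
    have "L2_inv_fourier (\<lambda>\<omega>. (?P \<omega> * Ld \<omega> - q \<omega>) * u \<omega>) (\<lambda>x. (\<Sum>k\<in>K. t k * \<phi> k x) - h x)"
      using inv_fourier_diff[OF sum_\<phi> h] by (simp add: left_diff_distrib)
    note diff = this
    have per: "per (\<lambda>\<omega>. ?P \<omega> * Ld \<omega> - q \<omega>)"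
      using perD[OF per_chr] perD[OF per_Ld] perD[OF q] by (simp add: per_def)
    have "((2 * pi) ^ CARD('d)) * nsq lborel (\<lambda>x. (\<Sum>k\<in>K. t k * \<phi> k x) - h x) = nsq nuM (\<lambda>\<omega>. ?P \<omega> * Ld \<omega> - q \<omega>)"
      by (rule inv_fourier_q(2)[OF diff _ per, symmetric]) measurable
    also have "\<dots> = nsq nuM (\<lambda>\<omega>. q \<omega> - ?P \<omega> * Ld \<omega>)" by (rule nsq_minus_commute)
    also have "\<dots> = nsq nuM (\<lambda>\<omega>. (F \<omega> - ?P \<omega>) * Ld \<omega>)"
      by (rule nsq_cong_AE)
         (use AE_nuM[OF FL] in \<open>auto simp: borel_nu left_diff_distrib\<close>)
    also have "\<dots> \<le> b * nsq cellm (\<lambda>\<omega>. F \<omega> - ?P \<omega>)"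
    proof -
      have le: "(\<integral>\<^sup>+\<omega>. ennreal ((cmod ((F \<omega> - ?P \<omega>) * Ld \<omega>))\<^sup>2) \<partial>nuM) \<le> ennreal (b * nsq cellm (\<lambda>\<omega>. F \<omega> - ?P \<omega>))"
        using nn_Ld_upper[of "\<lambda>\<omega>. F \<omega> - ?P \<omega>"] b_nonneg by (simp add: nn_nsq[OF d] ennreal_mult)
      then have s: "sq_int nuM (\<lambda>\<omega>. (F \<omega> - ?P \<omega>) * Ld \<omega>)"
        by (subst sq_int_iff_nn) (auto simp: borel_nu intro: le_less_trans)
      show ?thesis using le b_nonneg by (simp add: nn_nsq[OF s])
    qed
    finally show ?thesis by (simp add: field_simps)
  qed
  have lim: "((\<lambda>K. nsq lborel (\<lambda>x. (\<Sum>k\<in>K. t k * \<phi> k x) - h x)) \<longlongrightarrow> 0) (finite_subsets_at_top UNIV)"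
  proof (rule tendstoI)
    fix \<epsilon> :: real assume "\<epsilon> > 0"
    \<comment> \<open>Division by b + 1 rather than b avoids a separate case b = 0 and leaves the
      final inequality strict.\<close>
    define \<eta> where "\<eta> = \<epsilon> * ((2 * pi) ^ CARD('d)) / (b + 1)"
    have "\<eta> > 0" using \<open>\<epsilon> > 0\<close> b_nonneg by (simp add: \<eta>_def)
    have "\<forall>\<^sub>F K in finite_subsets_at_top UNIV. nsq cellm (\<lambda>\<omega>. F \<omega> - (\<Sum>k\<in>K. fcoeff F k * chr k \<omega>)) < \<eta>"
      by (rule order_tendstoD(2)[OF fourier_tendsto[OF F] \<open>\<eta> > 0\<close>])
    then obtain K0 where K0: "finite K0"
      "\<And>K. finite K \<Longrightarrow> K0 \<subseteq> K \<Longrightarrow> nsq cellm (\<lambda>\<omega>. F \<omega> - (\<Sum>k\<in>K. fcoeff F k * chr k \<omega>)) < \<eta>"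
      unfolding eventually_finite_subsets_at_top by auto
    have "nsq lborel (\<lambda>x. (\<Sum>k\<in>K. t k * \<phi> k x) - h x) < \<epsilon>" if K: "finite K" "uminus ` K0 \<subseteq> K" for K
    proof -
      have "K0 \<subseteq> uminus ` K" using K(2) by force
      then have "nsq cellm (\<lambda>\<omega>. F \<omega> - (\<Sum>k\<in>uminus ` K. fcoeff F k * chr k \<omega>)) < \<eta>"
        using K0(2) K(1) by blast
      then have lt: "nsq cellm (\<lambda>\<omega>. F \<omega> - (\<Sum>k\<in>K. t k * chr (- k) \<omega>)) < \<eta>"
        by (simp add: sum.reindex t_def)
      have "b / ((2 * pi) ^ CARD('d)) * nsq cellm (\<lambda>\<omega>. F \<omega> - (\<Sum>k\<in>K. t k * chr (- k) \<omega>)) \<le> b / ((2 * pi) ^ CARD('d)) * \<eta>"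
        using lt b_nonneg by (intro mult_left_mono) auto
      also have "\<dots> = \<epsilon> * (b / (b + 1))" by (simp add: \<eta>_def)
      also have "\<dots> < \<epsilon> * 1" using \<open>\<epsilon> > 0\<close> b_nonneg by (intro mult_strict_left_mono) auto
      finally show ?thesis using est[of K] by simp
    qed
    then show "\<forall>\<^sub>F K in finite_subsets_at_top UNIV. dist (nsq lborel (\<lambda>x. (\<Sum>k\<in>K. t k * \<phi> k x) - h x)) 0 < \<epsilon>"
      unfolding eventually_finite_subsets_at_top using K0(1)
      by (intro exI[of _ "uminus ` K0"]) auto
  qed
  have "L2_tendsto (\<lambda>K x. \<Sum>k\<in>K. t k * \<phi> k x) h (finite_subsets_at_top UNIV)"
    using lim by (simp add: L2_tendsto_nsq sK sh)
  then show ?thesis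
    unfolding l2_span_def L2_iff using sh summ by blast
qed

lemma ip_nuM:
  assumes [measurable]: "q \<in> borel_measurable borel" "q' \<in> borel_measurable borel"
  shows "ip nuM q q' = (\<integral>\<omega>. of_real (M \<omega>) * (q \<omega> * cnj (q' \<omega>)) \<partial>cellm)"
proof -
  have "ip nuM q q' = (\<integral>\<omega>. M \<omega> *\<^sub>R (q \<omega> * cnj (q' \<omega>)) \<partial>cellm)"
    unfolding ip_def nuM_def by (rule integral_density) (auto simp: borel_cellm M_nonneg)
  then show ?thesis by (simp add: scaleR_conv_of_real)
qed

lemma D_minus: "- (D *v k) = D *v (- k)"
proof -
  have "D *v (0 - k) = - (D *v k)" by (simp only: matrix_vector_mult_diff_distrib) simp
  then show ?thesis by simp
qed

lemma per_lam_trig_Ld': "per_lam (\<lambda>\<omega>. chr (- (D *v k)) \<omega> * Ld' \<omega>)"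
  using per_lamD[OF per_lam_chr] per_lamD[OF per_Ld'] by (simp add: per_lam_def D_minus)

text \<open>The weight M of the inner product cancels w, leaving a wavelet character against a
  function periodic under the dual lattice of scale j + 1.\<close>

lemma ip_\<psi>_\<phi>':
  assumes i: "i \<in> wavelet_index"
  shows "ip lborel (\<psi> i) (\<phi>' k) = 0"
proof -
  let ?q = "\<lambda>\<omega>. of_real \<kappa> * chr (- freq i) \<omega> * of_real (w \<omega>)"
  let ?q' = "\<lambda>\<omega>. chr (- (D *v k)) \<omega> * Ld' \<omega>"
  have "complex_of_real ((2 * pi) ^ CARD('d)) * ip lborel (\<psi> i) (\<phi>' k) = ip nuM ?q ?q'"
    by (rule inv_fourier_q_ip[OF \<psi>[OF i] _ _ \<phi>', symmetric])
       (use perD[OF per_chr] perD[OF per_w] perD[OF per_lam_per[OF per_Ld']] in \<open>auto simp: per_def\<close>)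
  also have "\<dots> = (\<integral>\<omega>. of_real (M \<omega>) * (?q \<omega> * cnj (?q' \<omega>)) \<partial>cellm)"
    by (rule ip_nuM) measurable
  also have "\<dots> = (\<integral>\<omega>. of_real \<kappa> * (chr (- freq i) \<omega> * cnj (?q' \<omega>)) \<partial>cellm)"
  proof (rule integral_cong_AE)
    show "AE \<omega> in cellm. of_real (M \<omega>) * (?q \<omega> * cnj (?q' \<omega>)) = of_real \<kappa> * (chr (- freq i) \<omega> * cnj (?q' \<omega>))"
      using AE_wM
    proof eventually_elim
      case (elim \<omega>)
      have "of_real (M \<omega>) * (?q \<omega> * cnj (?q' \<omega>)) = of_real (w \<omega> * M \<omega>) * (of_real \<kappa> * (chr (- freq i) \<omega> * cnj (?q' \<omega>)))"
        by (simp add: mult_ac)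
      then show ?case by (simp only: elim) simp
    qed
  qed (simp_all add: borel_cellm)
  also have "\<dots> = of_real \<kappa> * cnj (ip cellm ?q' (chr (- freq i)))"
    unfolding ip_sym[of cellm "chr (- freq i)" ?q', symmetric] by (simp add: ip_def)
  also have "ip cellm ?q' (chr (- freq i)) = 0"
    by (rule ip_per_lam_chr_0[OF per_lam_trig_Ld' _ minus_freq_not_D[OF i]]) measurable
  finally show ?thesis by simp
qed

lemma \<psi>_in_W:
  assumes i: "i \<in> wavelet_index"
  shows "\<psi> i \<in> W"
proof -
  have "\<psi> i \<in> l2_span \<phi>"
    by (rule in_l2_span_\<phi>[OF \<psi>[OF i]])
       (use perD[OF per_chr] perD[OF per_w] in \<open>auto simp: per_def\<close>)
  moreover have "L2_inner (\<psi> i) v = 0" if v: "v \<in> l2_span \<phi>'" for v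
  proof -
    obtain t where t: "sq_int lborel v" "L2_tendsto (\<lambda>K x. \<Sum>k\<in>K. t k * \<phi>' k x) v (finite_subsets_at_top UNIV)"
      using v by (auto simp: l2_span_def L2_iff)
    have s\<phi>': "sq_int lborel (\<phi>' k)" for k by (rule inv_fourier_sq_int(2)[OF \<phi>'])
    have s\<psi>: "sq_int lborel (\<psi> i)" by (rule inv_fourier_sq_int(2)[OF \<psi>[OF i]])
    have "ip lborel (\<psi> i) v = 0"
    proof (rule ip_limit_0[OF _ t(1) s\<psi> t(2)])
      show "sq_int lborel (\<lambda>x. \<Sum>k\<in>K. t k * \<phi>' k x)" for K
        by (intro sq_int_sum sq_int_cmult s\<phi>')
      show "ip lborel (\<psi> i) (\<lambda>x. \<Sum>k\<in>K. t k * \<phi>' k x) = 0" for K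
        using ip_sum_right[of K lborel "\<lambda>k x. t k * \<phi>' k x" "\<psi> i", OF sq_int_cmult[OF s\<phi>'] s\<psi>]
        by (simp only: ip_cmult_right ip_\<psi>_\<phi>'[OF i]) simp
    qed simp
    then show ?thesis by (simp add: L2_inner_def ip_def)
  qed
  ultimately show ?thesis by blast
qed

text \<open>The orthogonal projection onto the coarse space averages over the cosets of the coarse lattice.\<close>

definition coarse :: "(real^'d \<Rightarrow> complex) \<Rightarrow> real^'d \<Rightarrow> complex" where
  "coarse q \<omega> = lam_sum (\<lambda>\<eta>. q \<eta> * of_real (M \<eta>)) \<omega> / of_real (lam_sum M \<omega>)"

lemma coarse_measurable [measurable]:
  assumes [measurable]: "q \<in> borel_measurable borel"
  shows "coarse q \<in> borel_measurable borel"
  unfolding coarse_def[abs_def] lam_sum_def by measurable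

lemma per_lam_coarse: "per q \<Longrightarrow> per_lam (coarse q)"
proof -
  assume q: "per q"
  have "per (\<lambda>\<eta>. q \<eta> * of_real (M \<eta>))" using perD[OF q] perD[OF per_M] by (simp add: per_def)
  from per_lam_lam_sum[OF this] per_lam_lam_sum[OF per_M] show ?thesis
    by (simp add: per_lam_def coarse_def)
qed

text \<open>Cauchy--Schwarz on one coset with the weight split into two square roots: the projection
  does not increase the norm.\<close>

lemma coarse_pointwise: "(cmod (coarse q \<omega>))\<^sup>2 * lam_sum M \<omega> \<le> lam_sum (\<lambda>\<eta>. (cmod (q \<eta>))\<^sup>2 * M \<eta>) \<omega>"
proof (cases "lam_sum M \<omega> = 0")
  case True
  then show ?thesis by (simp add: lam_sum_def sum_nonneg M_nonneg)
next
  case False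
  let ?M = "\<lambda>l. M (\<omega> + lam (e l))" and ?q = "\<lambda>l. cmod (q (\<omega> + lam (e l)))"
  have pos: "lam_sum M \<omega> > 0" using False by (simp add: lam_sum_def sum_nonneg M_nonneg order_less_le)
  have "cmod (lam_sum (\<lambda>\<eta>. q \<eta> * of_real (M \<eta>)) \<omega>) \<le> (\<Sum>l<n. ?q l * ?M l)"
    unfolding lam_sum_def by (rule order_trans[OF norm_sum]) (simp add: norm_mult M_nonneg)
  also have "\<dots> = (\<Sum>l<n. (?q l * sqrt (?M l)) * sqrt (?M l))"
    by (simp add: M_nonneg mult.assoc)
  finally have "(cmod (lam_sum (\<lambda>\<eta>. q \<eta> * of_real (M \<eta>)) \<omega>))\<^sup>2 \<le> (\<Sum>l<n. (?q l * sqrt (?M l)) * sqrt (?M l))\<^sup>2"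
    by (rule power_mono) simp
  also have "\<dots> \<le> (\<Sum>l<n. (?q l * sqrt (?M l))\<^sup>2) * (\<Sum>l<n. (sqrt (?M l))\<^sup>2)"
    by (rule Cauchy_Schwarz_ineq_sum)
  also have "\<dots> = lam_sum (\<lambda>\<eta>. (cmod (q \<eta>))\<^sup>2 * M \<eta>) \<omega> * lam_sum M \<omega>"
    by (simp add: power_mult_distrib M_nonneg lam_sum_def)
  finally have "(cmod (coarse q \<omega>))\<^sup>2 * lam_sum M \<omega> * lam_sum M \<omega>
      \<le> lam_sum (\<lambda>\<eta>. (cmod (q \<eta>))\<^sup>2 * M \<eta>) \<omega> * lam_sum M \<omega>"
    using pos by (simp add: coarse_def norm_divide power_divide power2_eq_square)
  then show ?thesis using pos by simp
qed

lemma coarse_sq_int: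
  assumes q: "sq_int nuM q" and p: "per q"
  shows "sq_int nuM (coarse q)"
proof -
  have [measurable]: "q \<in> borel_measurable borel" using sq_int_measurable[OF q] by (simp add: borel_nu)
  have "of_nat n * (\<integral>\<^sup>+\<omega>. ennreal ((cmod (coarse q \<omega>))\<^sup>2) \<partial>nuM)
      = (\<integral>\<^sup>+\<omega>. ennreal ((cmod (coarse q \<omega>))\<^sup>2 * lam_sum M \<omega>) \<partial>cellm)"
    by (rule nn_lam_sum_M[OF _ per_lam_coarse[OF p]]) measurable
  also have "\<dots> \<le> (\<integral>\<^sup>+\<omega>. (\<Sum>l<n. ennreal ((cmod (q (\<omega> + lam (e l))))\<^sup>2 * M (\<omega> + lam (e l)))) \<partial>cellm)"
  proof (rule nn_integral_mono)
    fix \<omega>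
    show "ennreal ((cmod (coarse q \<omega>))\<^sup>2 * lam_sum M \<omega>)
        \<le> (\<Sum>l<n. ennreal ((cmod (q (\<omega> + lam (e l))))\<^sup>2 * M (\<omega> + lam (e l))))"
      using coarse_pointwise[of q \<omega>] by (simp add: sum_ennreal M_nonneg ennreal_leI) (simp add: lam_sum_def ennreal_leI)
  qed
  also have "\<dots> = of_nat n * (\<integral>\<^sup>+\<omega>. ennreal ((cmod (q \<omega>))\<^sup>2 * M \<omega>) \<partial>cellm)"
    by (rule nn_sum_lam) (use perD[OF p] perD[OF per_M] in \<open>auto simp: per_def\<close>)
  also have "(\<integral>\<^sup>+\<omega>. ennreal ((cmod (q \<omega>))\<^sup>2 * M \<omega>) \<partial>cellm) = (\<integral>\<^sup>+\<omega>. ennreal ((cmod (q \<omega>))\<^sup>2) \<partial>nuM)"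
    by (subst nn_nuM) (auto simp: ennreal_mult[symmetric] M_nonneg mult.commute)
  also have "of_nat n * \<dots> < \<infinity>" by (simp add: nn_nsq[OF q] ennreal_mult_less_top of_nat_less_top)
  finally have "(\<integral>\<^sup>+\<omega>. ennreal ((cmod (coarse q \<omega>))\<^sup>2) \<partial>nuM) < \<infinity>"
    using n_pos by (auto simp: ennreal_mult_less_top)
  then show ?thesis by (subst sq_int_iff_nn) (auto simp: borel_nu)
qed

lemma AE_lam_sum_coarse:
  assumes p: "per q"
  shows "AE \<omega> in cellm. lam_sum (\<lambda>\<eta>. (q \<eta> - coarse q \<eta>) * of_real (M \<eta>)) \<omega> = 0"
  using AE_Ld'
proof eventually_elim
  case (elim \<omega>)
  have "lam_sum (\<lambda>\<eta>. (q \<eta> - coarse q \<eta>) * of_real (M \<eta>)) \<omega>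
      = lam_sum (\<lambda>\<eta>. q \<eta> * of_real (M \<eta>)) \<omega> - coarse q \<omega> * of_real (lam_sum M \<omega>)"
    using per_lamD[OF per_lam_coarse[OF p]]
    by (simp add: lam_sum_def left_diff_distrib sum_subtractf sum_distrib_left)
  then show ?case using elim by (simp add: coarse_def)
qed

text \<open>The difference of q and its coarse part is orthogonal to the coarse part, which is
  constant on cosets and comes out of the vanishing coset sum.\<close>

lemma ip_coarse:
  assumes q: "sq_int nuM q" and p: "per q"
  shows "ip nuM q (coarse q) = of_real (nsq nuM (coarse q))"
proof -
  have [measurable]: "q \<in> borel_measurable borel" using sq_int_measurable[OF q] by (simp add: borel_nu)
  have cq: "sq_int nuM (coarse q)" by (rule coarse_sq_int[OF q p])
  have pc: "per (coarse q)" by (rule per_lam_per[OF per_lam_coarse[OF p]])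
  let ?h = "\<lambda>\<omega>. of_real (M \<omega>) * ((q \<omega> - coarse q \<omega>) * cnj (coarse q \<omega>))"
  have ph: "per ?h" using perD[OF p] perD[OF pc] perD[OF per_M] by (simp add: per_def)
  have "integrable nuM (\<lambda>\<omega>. (q \<omega> - coarse q \<omega>) * cnj (coarse q \<omega>))"
    by (rule integrable_ip[OF sq_int_diff[OF q cq] cq])
  then have "integrable cellm (\<lambda>\<omega>. M \<omega> *\<^sub>R ((q \<omega> - coarse q \<omega>) * cnj (coarse q \<omega>)))"
    unfolding nuM_def by (subst (asm) integrable_density) (auto simp: borel_cellm M_nonneg)
  then have ih: "integrable cellm ?h" by (simp add: scaleR_conv_of_real)
  have "(\<integral>\<omega>. ?h \<omega> \<partial>cellm) = 0"
  proof (rule integral_lam_sum_0[OF _ ph ih])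
    show "AE \<omega> in cellm. lam_sum ?h \<omega> = 0"
      using AE_lam_sum_coarse[OF p]
    proof eventually_elim
      case (elim \<omega>)
      have "lam_sum ?h \<omega> = lam_sum (\<lambda>\<eta>. (q \<eta> - coarse q \<eta>) * of_real (M \<eta>)) \<omega> * cnj (coarse q \<omega>)"
        using per_lamD[OF per_lam_coarse[OF p]] by (simp add: lam_sum_def sum_distrib_left mult_ac)
      then show ?case using elim by simp
    qed
  qed measurable
  then have "ip nuM (\<lambda>\<omega>. q \<omega> - coarse q \<omega>) (coarse q) = 0"
    by (subst ip_nuM) auto
  then show ?thesis by (simp add: ip_diff_left[OF q cq cq] nsq_ip)
qed

text \<open>Divided by \<open>Ld'\<close>, such a q has Fourier coefficients only at frequencies in
  the image of D, and these are the frequencies of the coarse B-splines.\<close>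

lemma coarse_approx:
  assumes q: "sq_int nuM q" "per_lam q" and "\<eta> > 0"
  shows "\<exists>K t. finite K \<and> nsq nuM (\<lambda>\<omega>. q \<omega> - (\<Sum>k\<in>K. t k * chr (- (D *v k)) \<omega>) * Ld' \<omega>) < \<eta>"
proof -
  have [measurable]: "q \<in> borel_measurable borel" using sq_int_measurable[OF q(1)] by (simp add: borel_nu)
  define F where "F \<omega> = q \<omega> / Ld' \<omega>" for \<omega>
  have Fm [measurable]: "F \<in> borel_measurable borel" unfolding F_def[abs_def] by measurable
  have pF: "per_lam F" using per_lamD[OF q(2)] per_lamD[OF per_Ld'] by (simp add: per_lam_def F_def)
  have FL: "AE \<omega> in cellm. F \<omega> * Ld' \<omega> = q \<omega>" using AE_Ld' by eventually_elim (simp add: F_def)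
  have "(\<integral>\<^sup>+\<omega>. ennreal ((cmod (F \<omega> * Ld' \<omega>))\<^sup>2) \<partial>nuM) = (\<integral>\<^sup>+\<omega>. ennreal ((cmod (q \<omega>))\<^sup>2) \<partial>nuM)"
    by (rule nn_integral_cong_AE) (use AE_nuM[OF FL] in eventually_elim, simp)
  also have "\<dots> < \<infinity>" using nn_nsq[OF q(1)] by simp
  finally have "of_nat n * (\<integral>\<^sup>+\<omega>. ennreal ((cmod (F \<omega> * Ld' \<omega>))\<^sup>2) \<partial>nuM) < \<infinity>"
    by (simp add: ennreal_mult_less_top of_nat_less_top)
  then have F: "sq_int cellm F" by (rule sq_int_of_nn_le[OF Fm a' nn_Ld'_lower[OF Fm pF]])
  define \<epsilon> where "\<epsilon> = \<eta> / (b' + 1)"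
  have "\<epsilon> > 0" using \<open>\<eta> > 0\<close> b'_nonneg by (simp add: \<epsilon>_def)
  have "\<forall>\<^sub>F K in finite_subsets_at_top UNIV. nsq cellm (\<lambda>\<omega>. F \<omega> - (\<Sum>k\<in>K. fcoeff F k * chr k \<omega>)) < \<epsilon>"
    by (rule order_tendstoD(2)[OF fourier_tendsto[OF F] \<open>\<epsilon> > 0\<close>])
  then obtain K0 where K0: "finite K0" "nsq cellm (\<lambda>\<omega>. F \<omega> - (\<Sum>k\<in>K0. fcoeff F k * chr k \<omega>)) < \<epsilon>"
    unfolding eventually_finite_subsets_at_top by blast
  define K where "K = {k. - (D *v k) \<in> K0}"
  have inj: "inj_on (\<lambda>k. - (D *v k)) K" using rmat_D_inj by (auto simp: inj_on_def)
  have im: "(\<lambda>k. - (D *v k)) ` K = {k \<in> K0. \<exists>z. k = D *v z}"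
  proof (intro equalityI subsetI)
    fix k assume "k \<in> {k \<in> K0. \<exists>z. k = D *v z}"
    then obtain z where z: "k \<in> K0" "k = D *v z" by blast
    have kz: "k = - (D *v (- z))" by (simp add: D_minus z(2))
    have "- z \<in> K" using z(1) unfolding K_def by (simp add: kz[symmetric])
    with kz show "k \<in> (\<lambda>k. - (D *v k)) ` K" by (rule image_eqI)
  next
    fix k assume "k \<in> (\<lambda>k. - (D *v k)) ` K"
    then show "k \<in> {k \<in> K0. \<exists>z. k = D *v z}" by (auto simp: K_def D_minus)
  qed
  have fin: "finite K" using im K0(1) inj by (metis (no_types, lifting) finite_imageD finite_subset mem_Collect_eq subsetI)
  let ?P = "\<lambda>\<omega>. \<Sum>k\<in>K. fcoeff F (- (D *v k)) * chr (- (D *v k)) \<omega>"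
  have zero: "fcoeff F k = 0" if "\<nexists>z. k = D *v z" for k
    unfolding fcoeff_def using ip_per_lam_chr_0[OF pF Fm that] by simp
  have P: "?P \<omega> = (\<Sum>k\<in>K0. fcoeff F k * chr k \<omega>)" for \<omega>
  proof -
    have "?P \<omega> = (\<Sum>k\<in>(\<lambda>k. - (D *v k)) ` K. fcoeff F k * chr k \<omega>)"
      using inj by (simp add: sum.reindex)
    also have "\<dots> = (\<Sum>k\<in>K0. fcoeff F k * chr k \<omega>)"
      unfolding im using K0(1) zero by (intro sum.mono_neutral_left) auto
    finally show ?thesis .
  qed
  have d: "sq_int cellm (\<lambda>\<omega>. F \<omega> - ?P \<omega>)"
    by (intro sq_int_diff F sq_int_sum sq_int_cmult sq_int_chr)
  have pP: "per_lam (\<lambda>\<omega>. F \<omega> - ?P \<omega>)"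
    using per_lamD[OF pF] per_lamD[OF per_lam_chr] by (simp add: per_lam_def D_minus)
  have le: "of_nat n * (\<integral>\<^sup>+\<omega>. ennreal ((cmod ((F \<omega> - ?P \<omega>) * Ld' \<omega>))\<^sup>2) \<partial>nuM) \<le> ennreal (b' * nsq cellm (\<lambda>\<omega>. F \<omega> - ?P \<omega>))"
    using nn_Ld'_upper[OF _ pP] b'_nonneg by (simp add: nn_nsq[OF d] ennreal_mult)
  have s: "sq_int nuM (\<lambda>\<omega>. (F \<omega> - ?P \<omega>) * Ld' \<omega>)"
  proof -
    have "of_nat n * (\<integral>\<^sup>+\<omega>. ennreal ((cmod ((F \<omega> - ?P \<omega>) * Ld' \<omega>))\<^sup>2) \<partial>nuM) < \<infinity>"
      using le by (rule le_less_trans) simp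
    then have "(\<integral>\<^sup>+\<omega>. ennreal ((cmod ((F \<omega> - ?P \<omega>) * Ld' \<omega>))\<^sup>2) \<partial>nuM) < \<infinity>"
      using n_pos by (auto simp: ennreal_mult_less_top)
    then show ?thesis by (subst sq_int_iff_nn) (auto simp: borel_nu)
  qed
  have "real n * nsq nuM (\<lambda>\<omega>. (F \<omega> - ?P \<omega>) * Ld' \<omega>) \<le> b' * nsq cellm (\<lambda>\<omega>. F \<omega> - ?P \<omega>)"
    using le b'_nonneg by (simp add: nn_nsq[OF s] ennreal_mult[symmetric] ennreal_of_nat_eq_real_of_nat)
  moreover have "1 * nsq nuM (\<lambda>\<omega>. (F \<omega> - ?P \<omega>) * Ld' \<omega>) \<le> real n * nsq nuM (\<lambda>\<omega>. (F \<omega> - ?P \<omega>) * Ld' \<omega>)"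
    using n_pos by (intro mult_right_mono) auto
  moreover have "b' * nsq cellm (\<lambda>\<omega>. F \<omega> - ?P \<omega>) < \<eta>"
  proof -
    have "b' * nsq cellm (\<lambda>\<omega>. F \<omega> - ?P \<omega>) \<le> b' * \<epsilon>"
      using K0(2) b'_nonneg by (intro mult_left_mono) (simp_all add: P)
    also have "\<dots> < (b' + 1) * \<epsilon>" using \<open>\<epsilon> > 0\<close> by simp
    also have "\<dots> = \<eta>" using b'_nonneg by (simp add: \<epsilon>_def)
    finally show ?thesis .
  qed
  ultimately have "nsq nuM (\<lambda>\<omega>. (F \<omega> - ?P \<omega>) * Ld' \<omega>) < \<eta>" by linarith
  moreover have "nsq nuM (\<lambda>\<omega>. q \<omega> - ?P \<omega> * Ld' \<omega>) = nsq nuM (\<lambda>\<omega>. (F \<omega> - ?P \<omega>) * Ld' \<omega>)"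
    by (rule nsq_cong_AE)
       (use AE_nuM[OF FL] in \<open>auto simp: borel_nu left_diff_distrib\<close>)
  ultimately show ?thesis
    using fin by (intro exI[of _ K] exI[of _ "\<lambda>k. fcoeff F (- (D *v k))"]) simp
qed

lemma ip_W_\<phi>':
  assumes "h \<in> W"
  shows "ip lborel h (\<phi>' k) = 0"
  using assms l2_span_generator[of \<phi>' k, OF inv_fourier_sq_int(2)[OF \<phi>']]
  by (auto simp: L2_inner_def ip_def)

text \<open>
  Since \<open>h\<close> is orthogonal to the coarse spline space, the coarse part of a spline close to \<open>h\<close> is small.
  The coarse part need not be known to have an inverse transform: it is tested against finite
  combinations of the \<open>\<phi>' k\<close> only.
\<close>

lemma coarse_small:
  assumes h: "h \<in> W" and \<eta>: "nsq lborel (\<lambda>x. (\<Sum>k\<in>K. t k * \<phi> k x) - h x) \<le> \<eta>"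
  shows "nsq nuM (coarse (\<lambda>\<omega>. (\<Sum>k\<in>K. t k * chr (- k) \<omega>) * Ld \<omega>)) \<le> 16 * ((2 * pi) ^ CARD('d) * \<eta>)"
proof -
  define q where "q \<omega> = (\<Sum>k\<in>K. t k * chr (- k) \<omega>) * Ld \<omega>" for \<omega>
  define s where "s x = (\<Sum>k\<in>K. t k * \<phi> k x)" for x
  define X where "X = nsq nuM (coarse q)"
  let ?c = "(2 * pi) ^ CARD('d) :: real"
  have \<eta>0: "0 \<le> \<eta>" using \<eta> nsq_nonneg order_trans by blast
  have sq: "L2_inv_fourier (\<lambda>\<omega>. q \<omega> * u \<omega>) s"
    using sum_\<phi>[of t K] by (simp add: q_def s_def[abs_def])
  have qm [measurable]: "q \<in> borel_measurable borel" unfolding q_def[abs_def] by measurable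
  have qp: "per q" unfolding q_def[abs_def] by (rule per_trig_Ld)
  have qs: "sq_int nuM q" by (rule inv_fourier_q(1)[OF sq qm qp])
  have cs: "sq_int nuM (coarse q)" by (rule coarse_sq_int[OF qs qp])
  have "X \<le> 16 * (?c * \<eta>)"
  proof (cases "X = 0")
    case True
    then show ?thesis using \<eta>0 by simp
  next
    case False
    then have X: "X > 0" using nsq_nonneg[of nuM "coarse q"] unfolding X_def by linarith
    \<comment> \<open>The first bound keeps the norm of v under 4X, the second makes the error of
      replacing \<open>coarse q\<close> by v at most X/2 in the inner product with q.\<close>
    define \<theta> where "\<theta> = min X (X\<^sup>2 / (4 * (nsq nuM q + 1)))"
    have q1: "nsq nuM q + 1 > 0" using nsq_nonneg[of nuM q] by linarith
    then have \<theta>: "\<theta> > 0" using X by (simp add: \<theta>_def)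
    from coarse_approx[OF cs per_lam_coarse[OF qp] this] obtain K' t' where
      K': "nsq nuM (\<lambda>\<omega>. coarse q \<omega> - (\<Sum>k\<in>K'. t' k * chr (- (D *v k)) \<omega>) * Ld' \<omega>) < \<theta>"
      by (elim exE conjE) (rule that)
    define v where "v \<omega> = (\<Sum>k\<in>K'. t' k * chr (- (D *v k)) \<omega>) * Ld' \<omega>" for \<omega>
    define V where "V x = (\<Sum>k\<in>K'. t' k * \<phi>' k x)" for x
    have lt: "nsq nuM (\<lambda>\<omega>. coarse q \<omega> - v \<omega>) < \<theta>" using K' by (simp add: v_def)
    have vm [measurable]: "v \<in> borel_measurable borel" unfolding v_def[abs_def] by measurable
    have vp: "per v" unfolding v_def[abs_def]
      using perD[OF per_chr] perD[OF per_lam_per[OF per_Ld']] by (simp add: per_def)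
    have vV: "L2_inv_fourier (\<lambda>\<omega>. v \<omega> * u \<omega>) V"
    proof -
      have "L2_inv_fourier (\<lambda>\<omega>. \<Sum>k\<in>K'. t' k * (chr (- (D *v k)) \<omega> * Ld' \<omega> * u \<omega>)) (\<lambda>x. \<Sum>k\<in>K'. t' k * \<phi>' k x)"
        by (intro inv_fourier_sum inv_fourier_cmult \<phi>')
      then show ?thesis by (simp add: v_def V_def[abs_def] sum_distrib_right mult.assoc)
    qed
    have vs: "sq_int nuM v" by (rule inv_fourier_q(1)[OF vV vm vp])
    have sh: "sq_int lborel h" using h by (simp add: l2_span_def L2_iff)
    have ss: "sq_int lborel s" by (rule inv_fourier_sq_int(2)[OF sq])
    have sV: "sq_int lborel V" by (rule inv_fourier_sq_int(2)[OF vV])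
    have hV: "ip lborel h V = 0"
    proof -
      have "ip lborel h V = (\<Sum>k\<in>K'. ip lborel h (\<lambda>x. t' k * \<phi>' k x))"
        unfolding V_def[abs_def]
        by (rule ip_sum_right[OF sq_int_cmult[OF inv_fourier_sq_int(2)[OF \<phi>']] sh])
      then show ?thesis by (simp only: ip_cmult_right ip_W_\<phi>'[OF h]) simp
    qed
    \<comment> \<open>Since h is orthogonal to V, only the small difference s - h
      contributes.\<close>
    have ipA: "ip nuM q v = of_real ?c * ip lborel (\<lambda>x. s x - h x) V"
      using inv_fourier_q_ip[OF sq qm qp vV vm vp] by (simp add: ip_diff_left ss sh sV hV)
    have A: "(cmod (ip nuM q v))\<^sup>2 \<le> 4 * (?c * \<eta>) * X"
    proof -
      have "(cmod (ip nuM q v))\<^sup>2 = ?c\<^sup>2 * (cmod (ip lborel (\<lambda>x. s x - h x) V))\<^sup>2"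
        unfolding ipA by (simp add: norm_mult power_mult_distrib norm_power)
      also have "\<dots> \<le> ?c\<^sup>2 * (nsq lborel (\<lambda>x. s x - h x) * nsq lborel V)"
        by (intro mult_left_mono ip_Cauchy_Schwarz sq_int_diff ss sh sV) auto
      also have "\<dots> \<le> ?c\<^sup>2 * (\<eta> * nsq lborel V)"
        using \<eta> by (intro mult_left_mono mult_right_mono) (auto simp: s_def)
      also have "\<dots> = ?c * \<eta> * nsq nuM v"
        by (simp add: inv_fourier_q(2)[OF vV vm vp] power2_eq_square)
      also have "\<dots> \<le> ?c * \<eta> * (4 * X)"
      proof (rule mult_left_mono)
        have "nsq nuM v \<le> 2 * nsq nuM (coarse q) + 2 * nsq nuM (\<lambda>\<omega>. (-1) * (coarse q \<omega> - v \<omega>))"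
          using nsq_add_le[OF cs sq_int_cmult[OF sq_int_diff[OF cs vs], of "-1"]] by simp
        also have "\<dots> \<le> 4 * X" using lt by (simp only: nsq_cmult) (simp add: X_def \<theta>_def)
        finally show "nsq nuM v \<le> 4 * X" .
      qed (use \<eta>0 in simp)
      finally show ?thesis by (simp add: mult_ac)
    qed
    have B: "cmod (ip nuM q (\<lambda>\<omega>. coarse q \<omega> - v \<omega>)) \<le> X / 2"
    proof (rule power2_le_imp_le)
      have "(cmod (ip nuM q (\<lambda>\<omega>. coarse q \<omega> - v \<omega>)))\<^sup>2 \<le> nsq nuM q * nsq nuM (\<lambda>\<omega>. coarse q \<omega> - v \<omega>)"
        by (rule ip_Cauchy_Schwarz[OF qs sq_int_diff[OF cs vs]])
      also have "\<dots> \<le> (nsq nuM q + 1) * (X\<^sup>2 / (4 * (nsq nuM q + 1)))"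
        using lt by (intro mult_mono) (auto simp: \<theta>_def)
      also have "\<dots> = (X / 2)\<^sup>2"
      proof -
        have "y * (X\<^sup>2 / (4 * y)) = (X / 2)\<^sup>2" if "y \<noteq> 0" for y using that by (simp add: power_divide)
        from this[of "nsq nuM q + 1"] show ?thesis using q1 by linarith
      qed
      finally show "(cmod (ip nuM q (\<lambda>\<omega>. coarse q \<omega> - v \<omega>)))\<^sup>2 \<le> (X / 2)\<^sup>2" .
    qed (use X in simp)
    have "complex_of_real X = ip nuM q v + ip nuM q (\<lambda>\<omega>. coarse q \<omega> - v \<omega>)"
      using ip_coarse[OF qs qp] by (simp add: X_def ip_diff_right cs vs qs)
    then have "cmod (complex_of_real X) \<le> cmod (ip nuM q v) + cmod (ip nuM q (\<lambda>\<omega>. coarse q \<omega> - v \<omega>))"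
      by (metis norm_triangle_ineq)
    then have "X / 2 \<le> cmod (ip nuM q v)" using B X by simp
    \<comment> \<open>Together with (A) this reads X^2/4 at most 4 c \<eta> X, the origin of the
      constant 16.\<close>
    then have "(X / 2)\<^sup>2 \<le> (cmod (ip nuM q v))\<^sup>2" using X by (intro power_mono) auto
    then have "X * X \<le> 16 * (?c * \<eta>) * X" using A by (simp add: power2_eq_square)
    then show ?thesis using X by simp
  qed
  then show ?thesis by (simp add: X_def q_def[abs_def])
qed

text \<open>A spline near h is replaced by its difference with its coarse part, which is then
  approximated by wavelets on the Fourier side.\<close>

lemma wavelets_dense:
  assumes \<delta>: "separated \<delta>" and h: "h \<in> W" and \<epsilon>: "\<epsilon> > 0"
  shows "\<exists>J t. finite J \<and> J \<subseteq> wavelet_index \<and> nsq lborel (\<lambda>x. h x - (\<Sum>i\<in>J. t i * \<psi> i x)) < \<epsilon>"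
proof -
  let ?c = "(2 * pi) ^ CARD('d) :: real"
  obtain t where t: "sq_int lborel h" "L2_tendsto (\<lambda>K x. \<Sum>k\<in>K. t k * \<phi> k x) h (finite_subsets_at_top UNIV)"
    using h by (auto simp: l2_span_def L2_iff)
  have sK: "sq_int lborel (\<lambda>x. \<Sum>k\<in>K. t k * \<phi> k x)" for K
    by (rule inv_fourier_sq_int(2)[OF sum_\<phi>])
  \<comment> \<open>The total error is 2 \<eta> + 2 (32 \<eta> + \<epsilon>/8) = 66 \<eta> +
    \<epsilon>/4, that is, three quarters of \<epsilon>.\<close>
  define \<eta> where "\<eta> = \<epsilon> / 132"
  have "\<eta> > 0" using \<epsilon> by (simp add: \<eta>_def)
  have "((\<lambda>K. nsq lborel (\<lambda>x. (\<Sum>k\<in>K. t k * \<phi> k x) - h x)) \<longlongrightarrow> 0) (finite_subsets_at_top UNIV)"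
    using t(2) by (simp add: L2_tendsto_nsq sK t(1))
  from order_tendstoD(2)[OF this \<open>\<eta> > 0\<close>]
  obtain K where K: "nsq lborel (\<lambda>x. (\<Sum>k\<in>K. t k * \<phi> k x) - h x) < \<eta>"
    unfolding eventually_finite_subsets_at_top by blast
  define q where "q \<omega> = (\<Sum>k\<in>K. t k * chr (- k) \<omega>) * Ld \<omega>" for \<omega>
  define s where "s x = (\<Sum>k\<in>K. t k * \<phi> k x)" for x
  have cq: "nsq nuM (coarse q) \<le> 16 * (?c * \<eta>)"
    using coarse_small[OF h less_imp_le[OF K]] by (simp add: q_def[abs_def])
  have sq: "L2_inv_fourier (\<lambda>\<omega>. q \<omega> * u \<omega>) s"
    using sum_\<phi>[of t K] by (simp add: q_def s_def[abs_def])
  have qm [measurable]: "q \<in> borel_measurable borel" unfolding q_def[abs_def] by measurable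
  have qp: "per q" unfolding q_def[abs_def] by (rule per_trig_Ld)
  have qs: "sq_int nuM q" by (rule inv_fourier_q(1)[OF sq qm qp])
  have cs: "sq_int nuM (coarse q)" by (rule coarse_sq_int[OF qs qp])
  have cp: "per (coarse q)" by (rule per_lam_per[OF per_lam_coarse[OF qp]])
  define z where "z \<omega> = (q \<omega> - coarse q \<omega>) * of_real (M \<omega>)" for \<omega>
  have zm [measurable]: "z \<in> borel_measurable borel" unfolding z_def[abs_def] by measurable
  have zp: "per z" unfolding z_def[abs_def] using perD[OF qp] perD[OF cp] perD[OF per_M] by (simp add: per_def)
  have z0: "AE \<omega> in cellm. lam_sum z \<omega> = 0"
    using AE_lam_sum_coarse[OF qp] by (simp add: z_def[abs_def])
  have zw: "AE \<omega> in cellm. z \<omega> * of_real (w \<omega>) = q \<omega> - coarse q \<omega>"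
    using AE_wM
  proof eventually_elim
    case (elim \<omega>)
    have "z \<omega> * of_real (w \<omega>) = (q \<omega> - coarse q \<omega>) * of_real (w \<omega> * M \<omega>)" by (simp add: z_def mult_ac)
    then show ?case using elim by simp
  qed
  \<comment> \<open>Separation enters here: z has finite norm with weight w, and
    \<open>separated_lower\<close> removes the weight.\<close>
  have zs: "sq_int cellm z"
  proof (rule sq_int_of_nn_le[OF zm _ separated_lower[OF \<delta> zm zp z0]])
    show "0 < \<delta> / (2 * real n)" using \<delta> n_pos by (simp add: separated_def)
    have "(\<integral>\<^sup>+\<omega>. ennreal ((cmod (z \<omega>))\<^sup>2) \<partial>nuw) = (\<integral>\<^sup>+\<omega>. ennreal ((cmod (z \<omega> * of_real (w \<omega>)))\<^sup>2) \<partial>nuM)"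
      by (rule nn_w[symmetric]) measurable
    also have "\<dots> = (\<integral>\<^sup>+\<omega>. ennreal ((cmod (q \<omega> - coarse q \<omega>))\<^sup>2) \<partial>nuM)"
      by (rule nn_integral_cong_AE) (use AE_nuM[OF zw] in eventually_elim, simp)
    also have "\<dots> < \<infinity>" by (simp add: nn_nsq[OF sq_int_diff[OF qs cs]])
    finally show "(\<integral>\<^sup>+\<omega>. ennreal ((cmod (z \<omega>))\<^sup>2) \<partial>nuw) < \<infinity>" .
  qed
  \<comment> \<open>Makes 2 \<theta>/c equal to the share \<epsilon>/8 of the error, up to the
    Plancherel constant.\<close>
  define \<theta> where "\<theta> = c * ?c * \<epsilon> / 16"
  have "\<theta> > 0" using c \<epsilon> by (simp add: \<theta>_def)
  from wavelet_approx[OF zs zp z0 this] obtain J y where J: "finite J" "J \<subseteq> wavelet_index"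
    and y: "nsq cellm (\<lambda>\<omega>. z \<omega> - (\<Sum>i\<in>J. y i * chr (- freq i) \<omega>)) < \<theta>"
    by (elim exE conjE) (rule that)
  let ?P = "\<lambda>\<omega>. \<Sum>i\<in>J. y i * chr (- freq i) \<omega>"
  define t' where "t' i = y i / of_real \<kappa>" for i
  have \<kappa>t: "of_real \<kappa> * (\<Sum>i\<in>J. t' i * chr (- freq i) \<omega>) = ?P \<omega>" for \<omega>
    using \<kappa> by (simp add: t'_def sum_distrib_left)
  let ?\<Psi> = "\<lambda>x. \<Sum>i\<in>J. t' i * \<psi> i x"
  have \<Psi>: "L2_inv_fourier (\<lambda>\<omega>. (?P \<omega> * of_real (w \<omega>)) * u \<omega>) ?\<Psi>"
    using sum_\<psi>[OF J(2), of t'] by (simp only: \<kappa>t)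
  have d: "sq_int cellm (\<lambda>\<omega>. z \<omega> - ?P \<omega>)"
    by (intro sq_int_diff zs sq_int_sum sq_int_cmult sq_int_chr)
  have dm: "(\<lambda>\<omega>. z \<omega> - ?P \<omega>) \<in> borel_measurable borel" by measurable
  have dw: "sq_int nuM (\<lambda>\<omega>. (z \<omega> - ?P \<omega>) * of_real (w \<omega>))"
    using sq_int_nuw[OF d] sq_int_w[OF dm] by simp
  have "?c * nsq lborel (\<lambda>x. s x - ?\<Psi> x) = nsq nuM (\<lambda>\<omega>. q \<omega> - ?P \<omega> * of_real (w \<omega>))"
  proof (rule inv_fourier_q(2)[symmetric])
    show "L2_inv_fourier (\<lambda>\<omega>. (q \<omega> - ?P \<omega> * of_real (w \<omega>)) * u \<omega>) (\<lambda>x. s x - ?\<Psi> x)"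
      using inv_fourier_diff[OF sq \<Psi>] by (simp add: left_diff_distrib)
    show "per (\<lambda>\<omega>. q \<omega> - ?P \<omega> * of_real (w \<omega>))"
      using perD[OF qp] perD[OF per_chr] perD[OF per_w] by (simp add: per_def)
  qed measurable
  also have "\<dots> = nsq nuM (\<lambda>\<omega>. coarse q \<omega> + (z \<omega> - ?P \<omega>) * of_real (w \<omega>))"
    by (rule nsq_cong_AE)
       (use AE_nuM[OF zw] in \<open>auto simp: borel_nu left_diff_distrib\<close>)
  also have "\<dots> \<le> 2 * nsq nuM (coarse q) + 2 * nsq nuM (\<lambda>\<omega>. (z \<omega> - ?P \<omega>) * of_real (w \<omega>))"
    by (rule nsq_add_le[OF cs dw])
  also have "nsq nuM (\<lambda>\<omega>. (z \<omega> - ?P \<omega>) * of_real (w \<omega>)) = nsq nuw (\<lambda>\<omega>. z \<omega> - ?P \<omega>)"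
    by (rule nsq_w[OF dm])
  also have "2 * nsq nuM (coarse q) + 2 * nsq nuw (\<lambda>\<omega>. z \<omega> - ?P \<omega>) \<le> 2 * (16 * (?c * \<eta>)) + 2 * (\<theta> / c)"
  proof -
    have "nsq nuw (\<lambda>\<omega>. z \<omega> - ?P \<omega>) \<le> nsq cellm (\<lambda>\<omega>. z \<omega> - ?P \<omega>) / c" by (rule nsq_nuw_le[OF d])
    also have "\<dots> \<le> \<theta> / c" using y c by (simp add: divide_right_mono)
    finally show ?thesis using cq by linarith
  qed
  also have "\<dots> = ?c * (32 * \<eta> + \<epsilon> / 8)" using c by (simp add: \<theta>_def algebra_simps)
  finally have sP: "nsq lborel (\<lambda>x. s x - ?\<Psi> x) \<le> 32 * \<eta> + \<epsilon> / 8" by simp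
  have "nsq lborel (\<lambda>x. (h x - s x) + (s x - ?\<Psi> x)) \<le> 2 * nsq lborel (\<lambda>x. h x - s x) + 2 * nsq lborel (\<lambda>x. s x - ?\<Psi> x)"
    by (intro nsq_add_le sq_int_diff t(1) inv_fourier_sq_int(2)[OF sq] inv_fourier_sq_int(2)[OF \<Psi>])
  also have "\<dots> < \<epsilon>"
    using K sP \<epsilon> nsq_minus_commute[of lborel h s] by (simp add: s_def[symmetric] \<eta>_def)
  finally have "nsq lborel (\<lambda>x. h x - ?\<Psi> x) < \<epsilon>" by simp
  then show ?thesis using J by (intro exI[of _ J] exI[of _ t']) simp
qed

text \<open>By \<open>nsq_sum_\<psi>\<close> the Riesz bounds are bounds in L2 of \<open>nuw\<close>
  up to a constant. The lower one forces the condition; conversely the condition gives a separation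
  constant, from which the lower bound and density follow.\<close>

theorem riesz_basis_iff:
  "riesz_basis wavelet_index \<psi> W \<longleftrightarrow> (\<forall>m\<in>{1..n - 1}. \<forall>\<omega>. w \<omega> \<noteq> 0 \<or> w (\<omega> + lam (e m)) \<noteq> 0)"
proof
  let ?c = "(2 * pi) ^ CARD('d) :: real"
  assume "riesz_basis wavelet_index \<psi> W"
  then obtain A B where A: "A > 0" and AB: "\<forall>J t. finite J \<and> J \<subseteq> wavelet_index \<longrightarrow>
      A * (\<Sum>i\<in>J. (cmod (t i))\<^sup>2) \<le> (L2_norm (\<lambda>x. \<Sum>i\<in>J. t i * \<psi> i x))\<^sup>2 \<and>
      (L2_norm (\<lambda>x. \<Sum>i\<in>J. t i * \<psi> i x))\<^sup>2 \<le> B * (\<Sum>i\<in>J. (cmod (t i))\<^sup>2)"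
    unfolding riesz_basis_def by (elim conjE exE) (rule that)
  have "A * ?c / \<kappa>\<^sup>2 * (\<Sum>i\<in>J. (cmod (t i))\<^sup>2) \<le> nsq nuw (\<lambda>\<omega>. \<Sum>i\<in>J. t i * chr (- freq i) \<omega>)"
    if "finite J" "J \<subseteq> wavelet_index" for J t
  proof -
    have "A * (\<Sum>i\<in>J. (cmod (t i))\<^sup>2) \<le> \<kappa>\<^sup>2 / ?c * nsq nuw (\<lambda>\<omega>. \<Sum>i\<in>J. t i * chr (- freq i) \<omega>)"
      using AB[rule_format, of J t] that nsq_sum_\<psi>[OF that(2), of t] by (simp add: L2_norm_nsq)
    then show ?thesis using \<kappa> by (simp add: field_simps)
  qed
  then show "\<forall>m\<in>{1..n - 1}. \<forall>\<omega>. w \<omega> \<noteq> 0 \<or> w (\<omega> + lam (e m)) \<noteq> 0"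
    using wavelet_lower_imp_disjoint[of "A * ?c / \<kappa>\<^sup>2"] A \<kappa> by simp
next
  let ?c = "(2 * pi) ^ CARD('d) :: real"
  assume "\<forall>m\<in>{1..n - 1}. \<forall>\<omega>. w \<omega> \<noteq> 0 \<or> w (\<omega> + lam (e m)) \<noteq> 0"
  then obtain \<delta> where \<delta>: "separated \<delta>" using separated_ex by blast
  show "riesz_basis wavelet_index \<psi> W"
    unfolding riesz_basis_def
  proof (intro conjI ballI allI impI)
    show "\<psi> i \<in> W" if "i \<in> wavelet_index" for i by (rule \<psi>_in_W[OF that])
  next
    fix h and \<epsilon> :: real assume h: "h \<in> W" and "\<epsilon> > 0"
    then have "\<epsilon>\<^sup>2 > 0" by simp
    from wavelets_dense[OF \<delta> h this] obtain J t where J: "finite J" "J \<subseteq> wavelet_index"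
      "nsq lborel (\<lambda>x. h x - (\<Sum>i\<in>J. t i * \<psi> i x)) < \<epsilon>\<^sup>2"
      by (elim exE conjE) (rule that)
    have "sqrt (nsq lborel (\<lambda>x. h x - (\<Sum>i\<in>J. t i * \<psi> i x))) < \<epsilon>"
      using J(3) \<open>\<epsilon> > 0\<close> by (intro real_less_lsqrt) auto
    then have "L2_norm (\<lambda>x. h x - (\<Sum>i\<in>J. t i * \<psi> i x)) < \<epsilon>"
      by (simp add: L2_norm_def nsq_def)
    then show "\<exists>J t. finite J \<and> J \<subseteq> wavelet_index \<and> L2_norm (\<lambda>x. h x - (\<Sum>i\<in>J. t i * \<psi> i x)) < \<epsilon>"
      using J(1,2) by (intro exI[of _ J] exI[of _ t]) simp
  next
    show "\<exists>A>0. \<exists>B. \<forall>J t. finite J \<and> J \<subseteq> wavelet_index \<longrightarrow>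
        A * (\<Sum>i\<in>J. (cmod (t i))\<^sup>2) \<le> (L2_norm (\<lambda>x. \<Sum>i\<in>J. t i * \<psi> i x))\<^sup>2 \<and>
        (L2_norm (\<lambda>x. \<Sum>i\<in>J. t i * \<psi> i x))\<^sup>2 \<le> B * (\<Sum>i\<in>J. (cmod (t i))\<^sup>2)"
    proof (rule exI[of _ "\<kappa>\<^sup>2 / ?c * (\<delta> / (2 * real n) * covol)"], intro conjI[OF _ exI[of _ "\<kappa>\<^sup>2 / ?c * (covol / c)"]] allI impI conjI)
      show "0 < \<kappa>\<^sup>2 / ?c * (\<delta> / (2 * real n) * covol)"
        using \<kappa> \<delta> n_pos covol_pos by (simp add: separated_def)
      fix J :: "(nat \<times> (int^'d)) set" and t :: "nat \<times> (int^'d) \<Rightarrow> complex"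
      assume J: "finite J \<and> J \<subseteq> wavelet_index"
      have n: "(L2_norm (\<lambda>x. \<Sum>i\<in>J. t i * \<psi> i x))\<^sup>2 = \<kappa>\<^sup>2 / ?c * nsq nuw (\<lambda>\<omega>. \<Sum>i\<in>J. t i * chr (- freq i) \<omega>)"
        using nsq_sum_\<psi> J by (simp add: L2_norm_nsq)
      have "\<kappa>\<^sup>2 / ?c * (\<delta> / (2 * real n) * covol * (\<Sum>i\<in>J. (cmod (t i))\<^sup>2)) \<le> (L2_norm (\<lambda>x. \<Sum>i\<in>J. t i * \<psi> i x))\<^sup>2"
        unfolding n using wavelet_sum_lower[OF \<delta>] J by (intro mult_left_mono) auto
      then show "\<kappa>\<^sup>2 / ?c * (\<delta> / (2 * real n) * covol) * (\<Sum>i\<in>J. (cmod (t i))\<^sup>2) \<le> (L2_norm (\<lambda>x. \<Sum>i\<in>J. t i * \<psi> i x))\<^sup>2"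
        by (simp only: mult.assoc)
      have "(L2_norm (\<lambda>x. \<Sum>i\<in>J. t i * \<psi> i x))\<^sup>2 \<le> \<kappa>\<^sup>2 / ?c * (covol / c * (\<Sum>i\<in>J. (cmod (t i))\<^sup>2))"
        unfolding n using wavelet_sum_upper J by (intro mult_left_mono) auto
      then show "(L2_norm (\<lambda>x. \<Sum>i\<in>J. t i * \<psi> i x))\<^sup>2 \<le> \<kappa>\<^sup>2 / ?c * (covol / c) * (\<Sum>i\<in>J. (cmod (t i))\<^sup>2)"
        by (simp only: mult.assoc)
    qed
  qed
qed

end

section \<open>The wavelets of a spline-admissible pair\<close>

lemma L2_tendsto_unique:
  fixes h h' :: "real^'d \<Rightarrow> complex"
  assumes s: "\<And>i. s i \<in> borel_measurable borel" and h: "h \<in> borel_measurable borel" "h' \<in> borel_measurable borel"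
    and lim: "L2_tendsto s h F" "L2_tendsto s h' F" and F: "F \<noteq> bot"
  shows "AE x in lborel. h x = h' x"
proof -
  note [measurable] = s h
  have le: "(\<integral>\<^sup>+x. ennreal ((cmod (h x - h' x))\<^sup>2) \<partial>lborel)
    \<le> 2 * (\<integral>\<^sup>+x. ennreal ((cmod (s i x - h x))\<^sup>2) \<partial>lborel) + 2 * (\<integral>\<^sup>+x. ennreal ((cmod (s i x - h' x))\<^sup>2) \<partial>lborel)" for i
  proof -
    have "ennreal ((cmod (h x - h' x))\<^sup>2) \<le> 2 * ennreal ((cmod (s i x - h x))\<^sup>2) + 2 * ennreal ((cmod (s i x - h' x))\<^sup>2)" for x
    proof -
      have "(cmod (h x - h' x))\<^sup>2 \<le> 2 * (cmod (s i x - h x))\<^sup>2 + 2 * (cmod (s i x - h' x))\<^sup>2"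
        using cmod_add_sq_le[of "h x - s i x" "s i x - h' x"] by (simp add: norm_minus_commute)
      then have "ennreal ((cmod (h x - h' x))\<^sup>2) \<le> ennreal (2 * (cmod (s i x - h x))\<^sup>2 + 2 * (cmod (s i x - h' x))\<^sup>2)"
        by (rule ennreal_leI)
      then show ?thesis by (simp add: ennreal_mult)
    qed
    then have "(\<integral>\<^sup>+x. ennreal ((cmod (h x - h' x))\<^sup>2) \<partial>lborel)
      \<le> (\<integral>\<^sup>+x. 2 * ennreal ((cmod (s i x - h x))\<^sup>2) + 2 * ennreal ((cmod (s i x - h' x))\<^sup>2) \<partial>lborel)"
      by (intro nn_integral_mono)
    then show ?thesis by (simp add: nn_integral_add nn_integral_cmult)
  qed
  have "((\<lambda>i. 2 * (\<integral>\<^sup>+x. ennreal ((cmod (s i x - h x))\<^sup>2) \<partial>lborel) + 2 * (\<integral>\<^sup>+x. ennreal ((cmod (s i x - h' x))\<^sup>2) \<partial>lborel))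
      \<longlongrightarrow> 2 * 0 + 2 * 0) F"
    using lim unfolding L2_tendsto_def by (intro tendsto_add ennreal_tendsto_cmult) auto
  then have "(\<integral>\<^sup>+x. ennreal ((cmod (h x - h' x))\<^sup>2) \<partial>lborel) \<le> 2 * 0 + 2 * 0"
    by (rule tendsto_lowerbound[OF _ always_eventually F]) (use le in blast)
  then have "(\<integral>\<^sup>+x. ennreal ((cmod (h x - h' x))\<^sup>2) \<partial>lborel) = 0" by simp
  then have "AE x in lborel. ennreal ((cmod (h x - h' x))\<^sup>2) = 0"
    by (subst (asm) nn_integral_0_iff_AE) auto
  then show ?thesis by eventually_elim simp
qed

text \<open>Identifies the transform hidden in \<open>fourier_multiplier\<close> with the given one
  of the interpolant.\<close>

lemma L2_fourier_unique:
  fixes h G G' :: "real^'d \<Rightarrow> complex"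
  assumes "L2_fourier h G" "L2_fourier h G'"
  shows "AE \<omega> in lborel. G \<omega> = G' \<omega>"
proof (rule L2_tendsto_unique)
  let ?s = "\<lambda>R \<omega>. LINT x:cball 0 R|lborel. h x * cis (- (x \<bullet> \<omega>))"
  show "L2_tendsto ?s G at_top" "L2_tendsto ?s G' at_top" using assms by (auto simp: L2_fourier_def)
  show "G \<in> borel_measurable borel" "G' \<in> borel_measurable borel" using assms by (auto simp: L2_fourier_def L2_def)
  have h: "sq_int lborel h" using assms by (simp add: L2_fourier_def L2_iff)
  have m: "trunc R h \<in> borel_measurable borel" for R
    using sq_int_measurable[OF sq_int_trunc[OF h]] by simp
  have "?s R = (\<lambda>\<omega>. ift (trunc R h) (- \<omega>))" for R
    by (simp add: ift_trunc[symmetric] inner_commute)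
  then show "?s R \<in> borel_measurable borel" for R
    using measurable_compose[OF _ ift_measurable[OF m], of uminus borel] by simp
qed simp

lemma inv_fourier_cong_AE:
  fixes F G :: "real^'d \<Rightarrow> complex"
  assumes F: "L2_inv_fourier F h" and G: "G \<in> borel_measurable borel" and eq: "AE \<omega> in lborel. F \<omega> = G \<omega>"
  shows "L2_inv_fourier G h"
proof -
  note s = inv_fourier_sq_int[OF F]
  have sG: "sq_int lborel G" by (rule sq_int_cong_AE[OF s(1) _ eq]) (use G in simp)
  have "ift (trunc R F) x = ift (trunc R G) x" for R x
    unfolding ift_def
  proof (rule integral_cong_AE)
    show "AE \<omega> in lborel. trunc R F \<omega> * cis (x \<bullet> \<omega>) = trunc R G \<omega> * cis (x \<bullet> \<omega>)"
      using eq by eventually_elim (simp add: trunc_def)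
    show "(\<lambda>\<omega>. trunc R F \<omega> * cis (x \<bullet> \<omega>)) \<in> borel_measurable lborel"
      "(\<lambda>\<omega>. trunc R G \<omega> * cis (x \<bullet> \<omega>)) \<in> borel_measurable lborel"
      using sq_int_measurable[OF sq_int_trunc[OF s(1)]] sq_int_measurable[OF sq_int_trunc[OF sG]] by measurable
  qed
  then show ?thesis using F s sG by (simp add: L2_inv_fourier_alt)
qed

context lattice
begin

text \<open>Absolutely summable coefficients: the Weierstrass test gives continuity, and the uniform
  bound on the filter is what yields the lower bound on M.\<close>

lemma
  assumes p: "(\<lambda>k. cmod (p k)) summable_on UNIV"
  shows chr_series_continuous: "continuous_on UNIV (\<lambda>\<omega>. \<Sum>\<^sub>\<infinity>k\<in>UNIV. p k * chr (h k) \<omega>)"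
    and chr_series_bound: "cmod (\<Sum>\<^sub>\<infinity>k\<in>UNIV. p k * chr (h k) \<omega>) \<le> (\<Sum>\<^sub>\<infinity>k\<in>UNIV. cmod (p k))"
proof -
  show "continuous_on UNIV (\<lambda>\<omega>. \<Sum>\<^sub>\<infinity>k\<in>UNIV. p k * chr (h k) \<omega>)"
  proof (rule uniform_limit_theorem)
    show "uniform_limit UNIV (\<lambda>X \<omega>. \<Sum>k\<in>X. p k * chr (h k) \<omega>) (\<lambda>\<omega>. \<Sum>\<^sub>\<infinity>k\<in>UNIV. p k * chr (h k) \<omega>) (finite_subsets_at_top UNIV)"
      by (rule Weierstrass_m_test_general[OF _ p]) (simp add: norm_mult)
    show "\<forall>\<^sub>F X in finite_subsets_at_top UNIV. continuous_on UNIV (\<lambda>\<omega>. \<Sum>k\<in>X. p k * chr (h k) \<omega>)"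
      by (intro always_eventually allI continuous_intros chr_continuous)
  qed simp
  show "cmod (\<Sum>\<^sub>\<infinity>k\<in>UNIV. p k * chr (h k) \<omega>) \<le> (\<Sum>\<^sub>\<infinity>k\<in>UNIV. cmod (p k))"
    using norm_infsum_bound[of "\<lambda>k. p k * chr (h k) \<omega>" UNIV] p by (simp add: norm_mult)
qed

end

text \<open>Grouping the larger dual lattice by cosets of the smaller one brings the localization
  condition of scale j + 1 into the form of a coset sum.\<close>

lemma (in wavelet_fourier) lam_sum_M: "lam_sum M \<omega> = (\<Sum>\<^sub>\<infinity>k\<in>UNIV. (cmod (u (\<omega> + lam k)))\<^sup>2)"
proof -
  let ?F = "\<lambda>(m, k). (cmod (u (\<omega> + lam (e m + transpose D *v k))))\<^sup>2"
  have arg: "\<omega> + lam (e m + transpose D *v k) = \<omega> + lam (e m) + pt k" for m k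
    by (simp add: lam_add lam_transpose)
  have f: "((\<lambda>k. ?F (m, k)) has_sum M (\<omega> + lam (e m))) UNIV" for m
    unfolding prod.case arg using M_summable[of "\<omega> + lam (e m)"] by (simp add: M_def)
  have g: "((\<lambda>m. M (\<omega> + lam (e m))) has_sum lam_sum M \<omega>) {..<n}"
    unfolding lam_sum_def by (rule has_sum_finite) simp
  have s: "?F summable_on {..<n} \<times> UNIV"
    by (rule summable_on_SigmaI[OF f]) (auto intro: summable_on_finite)
  have "(?F has_sum lam_sum M \<omega>) ({..<n} \<times> UNIV)"
    by (rule has_sum_SigmaI[OF f g s])
  then have "((\<lambda>x. (\<lambda>k. (cmod (u (\<omega> + lam k)))\<^sup>2) ((\<lambda>(m, k). e m + transpose D *v k) x)) has_sum lam_sum M \<omega>) ({..<n} \<times> UNIV)"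
    by (simp add: case_prod_beta')
  then have "((\<lambda>k. (cmod (u (\<omega> + lam k)))\<^sup>2) has_sum lam_sum M \<omega>) UNIV"
    using has_sum_reindex_bij_betw[OF bij_cosets, of "\<lambda>k. (cmod (u (\<omega> + lam k)))\<^sup>2"] by blast
  then show ?thesis by (simp add: infsumI)
qed

lemma spline_space_l2_span:
  "spline_space D \<phi> i = l2_span (\<lambda>k x. \<phi> i (x - mat_zpow (rmat D) i *v rvec k))"
  by (simp add: spline_space_def l2_span_def)

lemma infsum_cmod_cmult: "(\<Sum>\<^sub>\<infinity>k\<in>K. (cmod (c * h k))\<^sup>2) = (cmod c)\<^sup>2 * (\<Sum>\<^sub>\<infinity>k\<in>K. (cmod (h k))\<^sup>2)"
  by (simp add: norm_mult power_mult_distrib infsum_cmult_right')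

lemma rmat_invertible:
  assumes "spline_admissible f g D r"
  shows "invertible (rmat D)"
proof -
  obtain a R where "a > 1" "orthogonal_matrix R" "rmat D = a *\<^sub>R R"
    using assms unfolding spline_admissible_def by blast
  then have "rmat D ** ((1 / a) *\<^sub>R transpose R) = mat 1" "((1 / a) *\<^sub>R transpose R) ** rmat D = mat 1"
    by (simp_all add: scalar_matrix_assoc[symmetric] matrix_scalar_ac orthogonal_matrix_def)
  then show ?thesis unfolding invertible_def by blast
qed

theorem theorem2:
  fixes f g :: "real^'d \<Rightarrow> complex"
    and D :: "int^'d^'d"
    and r :: real
    and p :: "int \<Rightarrow> int^'d \<Rightarrow> complex"
    and \<phi> :: "int \<Rightarrow> real^'d \<Rightarrow> complex"
    and \<phi>\<^sub>I \<psi> :: "real^'d \<Rightarrow> complex"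
    and e :: "nat \<Rightarrow> int^'d"
    and j :: int
    and n :: nat
  assumes n: "n = nat \<bar>det D\<bar>"
    and pair: "spline_admissible f g D r"
    and localizing: "\<And>i. localizing f g D i (p i)"
    and bsplines: "\<And>i. L2_inv_fourier (bspline_hat f g D i (p i)) (\<phi> i)"
    and interpolant: "L2_fourier \<phi>\<^sub>I (interpolant_hat f g D j (p j))"
    and wavelet: "fourier_multiplier (\<lambda>\<omega>. cnj (symbol f g \<omega>)) \<phi>\<^sub>I \<psi>"
    and e_0: "e 0 = 0"
    and e_reps: "coset_reps D n e" "coset_reps (transpose D) n e"
  shows "riesz_basis ({1..n - 1} \<times> UNIV)
           (\<lambda>(m, k) x. \<psi> (x - mat_zpow (rmat D) (j + 1) *v rvec k - mat_zpow (rmat D) j *v rvec (e m)))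
           (wavelet_space D \<phi> (j + 1))
         \<longleftrightarrow> (\<forall>m\<in>{1..n - 1}. shifted_zeros f g D j (e 0) \<inter> shifted_zeros f g D j (e m) = {})"
proof -
  let ?A = "rmat D" and ?A' = "transpose (rmat D)"
  have inv: "invertible ?A" by (rule rmat_invertible[OF pair])
  have inv': "invertible ?A'" by (rule invertible_transpose_real[OF inv])
  \<comment> \<open>With this scaling \<open>pt\<close> gives the dual points of scale j and
    \<open>chr k\<close> is the exponential with frequency D^j k.\<close>
  define T where "T = (2 * pi) *\<^sub>R mat_zpow ?A' (- j)"
  define S where "S = (1 / (2 * pi)) *\<^sub>R mat_zpow ?A' j"
  define B where "B = matrix_inv ?A'"
  interpret refinement T S D B e n
  proof
    show "T ** S = mat 1" "S ** T = mat 1"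
      using mat_zpow_minus[OF inv', of j] mat_zpow_minus[OF inv', of "- j"]
      by (simp_all add: T_def S_def scalar_matrix_assoc[symmetric] matrix_scalar_ac)
    show "?A' ** B = mat 1" unfolding B_def by (rule matrix_inv_both[OF inv'])
  qed (use e_0 e_reps in auto)
  have S: "rvec k \<bullet> (S *v \<omega>) = ((mat_zpow ?A j *v rvec k) \<bullet> \<omega>) / (2 * pi)" for k \<omega>
    unfolding S_def transpose_mat_zpow[OF inv, symmetric]
    by (simp add: scaleR_matrix_vector_assoc[symmetric] inner_transpose_mult)
  have chr_j: "chr k \<omega> = cis ((mat_zpow ?A j *v rvec k) \<bullet> \<omega>)" for k \<omega>
    by (simp add: chr_def S)
  have zD: "mat_zpow ?A (j + 1) *v rvec k = mat_zpow ?A j *v rvec (D *v k)" for k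
    by (simp add: mat_zpow_add_1[OF inv] rvec_mult matrix_vector_mul_assoc)
  have chr_j1: "chr (D *v k) \<omega> = cis ((mat_zpow ?A (j + 1) *v rvec k) \<bullet> \<omega>)" for k \<omega>
    by (simp add: chr_j zD)
  have chr_jm: "chr (- k) \<omega> = cis (- ((mat_zpow ?A j *v rvec k) \<bullet> \<omega>))"
    and chr_j1m: "chr (- (D *v k)) \<omega> = cis (- ((mat_zpow ?A (j + 1) *v rvec k) \<bullet> \<omega>))" for k \<omega>
    unfolding chr_minus by (simp_all only: chr_j zD cis_cnj)
  have Tv: "T *v x = (2 * pi) *\<^sub>R (mat_zpow ?A' (- j) *v x)" for x
    by (simp add: T_def scaleR_matrix_vector_assoc)
  have dual_j: "dual_point D j k = pt k" for k
    by (simp add: dual_point_def pt_def Tv)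
  have dual_j1: "dual_point D (j + 1) v = lam v" for v
  proof -
    have "mat_zpow ?A' (- (j + 1)) = mat_zpow ?A' (- j) ** B"
      using mat_zpow_diff_1[OF inv', of "- j"] by (simp add: B_def)
    then show ?thesis
      by (simp add: dual_point_def lam_def Tv matrix_vector_mul_assoc[symmetric])
  qed
  define Ld where "Ld = periodic_symbol D j (p j)"
  define Ld' where "Ld' = periodic_symbol D (j + 1) (p (j + 1))"
  have Ld: "Ld \<omega> = (\<Sum>\<^sub>\<infinity>k\<in>UNIV. p j k * chr k \<omega>)" for \<omega>
    by (simp add: Ld_def periodic_symbol_def chr_j inner_commute)
  have Ld': "Ld' \<omega> = (\<Sum>\<^sub>\<infinity>k\<in>UNIV. p (j + 1) k * chr (D *v k) \<omega>)" for \<omega>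
    by (simp add: Ld'_def periodic_symbol_def chr_j1 inner_commute)
  have sp: "(\<lambda>k. cmod (p i k)) summable_on UNIV" for i using localizing[of i] by (simp add: localizing_def)
  have Ldm: "Ld \<in> borel_measurable borel"
    using chr_series_continuous[OF sp[of j], of "\<lambda>k. k"] by (intro borel_measurable_continuous_onI) (simp add: Ld[abs_def])
  have Ldm': "Ld' \<in> borel_measurable borel"
    using chr_series_continuous[OF sp[of "j + 1"], of "\<lambda>k. D *v k"] by (intro borel_measurable_continuous_onI) (simp add: Ld'[abs_def])
  have Ldp: "per Ld" using perD[OF per_chr] by (simp add: per_def Ld)
  define P where "P = (\<Sum>\<^sub>\<infinity>k\<in>UNIV. cmod (p j k))"
  have LdP: "cmod (Ld \<omega>) \<le> P" for \<omega>
    unfolding Ld P_def by (rule chr_series_bound[OF sp])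
  let ?u = "\<lambda>\<omega>. g \<omega> / f \<omega>"
  have bh: "bspline_hat f g D i (p i) \<omega> = periodic_symbol D i (p i) \<omega> * ?u \<omega>" for i \<omega>
    by (simp add: bspline_hat_def symbol_def)
  have sum_j: "(\<Sum>\<^sub>\<infinity>k\<in>UNIV. (cmod (bspline_hat f g D j (p j) (\<omega> + dual_point D j k)))\<^sup>2)
      = (cmod (Ld \<omega>))\<^sup>2 * (\<Sum>\<^sub>\<infinity>k\<in>UNIV. (cmod (?u (\<omega> + pt k)))\<^sup>2)" for \<omega>
    by (simp only: bh dual_j Ld_def[symmetric] perD[OF Ldp] infsum_cmod_cmult)
  have Ldl': "Ld' (\<omega> + lam v) = Ld' \<omega>" for \<omega> v
    by (simp add: Ld' chr_add_arg)
  have sum_j1: "(\<Sum>\<^sub>\<infinity>k\<in>UNIV. (cmod (bspline_hat f g D (j + 1) (p (j + 1)) (\<omega> + dual_point D (j + 1) k)))\<^sup>2)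
      = (cmod (Ld' \<omega>))\<^sup>2 * (\<Sum>\<^sub>\<infinity>k\<in>UNIV. (cmod (?u (\<omega> + lam k)))\<^sup>2)" for \<omega>
    by (simp only: bh dual_j1 Ld'_def[symmetric] Ldl' infsum_cmod_cmult)
  obtain a b where a: "0 < a" and ab: "AE \<omega> in lborel.
      a \<le> (cmod (Ld \<omega>))\<^sup>2 * (\<Sum>\<^sub>\<infinity>k\<in>UNIV. (cmod (?u (\<omega> + pt k)))\<^sup>2) \<and>
      (cmod (Ld \<omega>))\<^sup>2 * (\<Sum>\<^sub>\<infinity>k\<in>UNIV. (cmod (?u (\<omega> + pt k)))\<^sup>2) \<le> b"
    using localizing[of j] unfolding localizing_def sum_j by (elim conjE exE) (rule that, auto)
  obtain a' b' where a': "0 < a'" and ab': "AE \<omega> in lborel.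
      a' \<le> (cmod (Ld' \<omega>))\<^sup>2 * (\<Sum>\<^sub>\<infinity>k\<in>UNIV. (cmod (?u (\<omega> + lam k)))\<^sup>2) \<and>
      (cmod (Ld' \<omega>))\<^sup>2 * (\<Sum>\<^sub>\<infinity>k\<in>UNIV. (cmod (?u (\<omega> + lam k)))\<^sup>2) \<le> b'"
    using localizing[of "j + 1"] unfolding localizing_def sum_j1 by (elim conjE exE) (rule that, auto)
  obtain C where C: "C > 0" "AE \<omega> in lborel. norm \<omega> powr (2 * r) \<le> C * (1 + (cmod (symbol f g \<omega>))\<^sup>2)"
    using pair unfolding spline_admissible_def by blast
  have adm: "admissible f g" and r: "r > real CARD('d) / 2" using pair by (auto simp: spline_admissible_def)
  \<comment> \<open>The filter is bounded by P; adding 1 keeps the denominator positive without a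
    lower bound on P.\<close>
  have low: "a / (P\<^sup>2 + 1) \<le> x" if "a \<le> (cmod (Ld \<omega>))\<^sup>2 * x" "0 \<le> x" for \<omega> x
  proof -
    have "(cmod (Ld \<omega>))\<^sup>2 \<le> P\<^sup>2 + 1" using power_mono[OF LdP[of \<omega>], of 2] by simp
    then have "a \<le> (P\<^sup>2 + 1) * x" using that mult_right_mono[of "(cmod (Ld \<omega>))\<^sup>2" "P\<^sup>2 + 1" x] by linarith
    then show ?thesis by (simp add: pos_divide_le_eq add_nonneg_pos mult.commute)
  qed
  interpret symbol_lattice T S f g r C "a / (P\<^sup>2 + 1)"
  proof
    show "continuous_on UNIV f" "continuous_on UNIV g" "{\<omega>. f \<omega> * g \<omega> = 0} \<in> null_sets lborel"
      "{\<omega>. f \<omega> = 0} \<inter> {\<omega>. g \<omega> = 0} = {}"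
      using adm by (simp_all add: admissible_def)
    show "0 < a / (P\<^sup>2 + 1)" using a by (simp add: add_nonneg_pos)
    show "AE \<omega> in lborel. a / (P\<^sup>2 + 1) \<le> (\<Sum>\<^sub>\<infinity>k\<in>UNIV. (cmod (?u (\<omega> + pt k)))\<^sup>2)"
      using ab by eventually_elim (intro low infsum_nonneg, auto)
  qed (use r C in auto)
  interpret wavelet_fourier T S D B e n f g r C "a / (P\<^sup>2 + 1)" ..
  define \<kappa> where "\<kappa> = real_of_int \<bar>det D\<bar> powi j"
  \<comment> \<open>A complete set of representatives is nonempty, so n is positive.\<close>
  have "det D \<noteq> 0" using n n_pos by auto
  then have \<kappa>: "\<kappa> > 0" by (simp add: \<kappa>_def)
  let ?\<psi> = "\<lambda>(m, k) x. \<psi> (x - mat_zpow ?A (j + 1) *v rvec k - mat_zpow ?A j *v rvec (e m))"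
  have Mab: "AE \<omega> in lborel. a \<le> (cmod (Ld \<omega>))\<^sup>2 * M \<omega> \<and> (cmod (Ld \<omega>))\<^sup>2 * M \<omega> \<le> b"
    using ab by (simp add: M_def u_def)
  have wm: "(\<lambda>\<omega>. of_real \<kappa> * of_real (w \<omega>) * u \<omega>) \<in> borel_measurable borel" by measurable
  \<comment> \<open>Almost everywhere |Ld|^2 cancels in the interpolant, leaving \<kappa> w |u|^2,
    and the conjugate symbol turns |u|^2 into u.\<close>
  have \<psi>hat: "L2_inv_fourier (\<lambda>\<omega>. of_real \<kappa> * of_real (w \<omega>) * u \<omega>) \<psi>"
  proof -
    obtain F where F: "L2_fourier \<phi>\<^sub>I F" "L2_inv_fourier (\<lambda>\<omega>. cnj (symbol f g \<omega>) * F \<omega>) \<psi>"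
      using wavelet unfolding fourier_multiplier_def by blast
    have "AE \<omega> in lborel. cnj (symbol f g \<omega>) * F \<omega> = of_real \<kappa> * of_real (w \<omega>) * u \<omega>"
      using L2_fourier_unique[OF F(1) interpolant] Mab AE_not_Z adm[unfolded admissible_def, THEN conjunct2, THEN conjunct2, THEN conjunct1, THEN AE_not_in]
    proof eventually_elim
      case (elim \<omega>)
      have fg: "f \<omega> \<noteq> 0" "g \<omega> \<noteq> 0" using elim by auto
      have L: "(cmod (Ld \<omega>))\<^sup>2 \<noteq> 0" "M \<omega> \<noteq> 0" using elim a by auto
      have "F \<omega> = of_real (\<kappa> * (cmod (Ld \<omega> * u \<omega>))\<^sup>2 / ((cmod (Ld \<omega>))\<^sup>2 * M \<omega>))"
        unfolding elim(1) interpolant_hat_def sum_j by (simp only: bh Ld_def \<kappa>_def M_def u_def)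
      also have "\<kappa> * (cmod (Ld \<omega> * u \<omega>))\<^sup>2 / ((cmod (Ld \<omega>))\<^sup>2 * M \<omega>) = \<kappa> * w \<omega> * (cmod (u \<omega>))\<^sup>2"
        using L elim by (simp add: norm_mult power_mult_distrib w_def)
      finally have "cnj (symbol f g \<omega>) * F \<omega> = of_real \<kappa> * of_real (w \<omega>) * (cnj (symbol f g \<omega>) * of_real ((cmod (u \<omega>))\<^sup>2))"
        by (simp add: mult_ac)
      also have "cnj (symbol f g \<omega>) * of_real ((cmod (u \<omega>))\<^sup>2) = u \<omega>"
        unfolding complex_norm_square using fg by (simp add: symbol_def u_def)
      finally show ?case .
    qed
    then show ?thesis by (rule inv_fourier_cong_AE[OF F(2) wm])
  qed
  interpret wavelet_system T S D B e n f g r C "a / (P\<^sup>2 + 1)" Ld Ld' \<kappa> a b a' b'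
    "\<lambda>k x. \<phi> j (x - mat_zpow ?A j *v rvec k)" "\<lambda>k x. \<phi> (j + 1) (x - mat_zpow ?A (j + 1) *v rvec k)" ?\<psi>
  proof
    show "Ld \<in> borel_measurable borel" "per Ld" "Ld' \<in> borel_measurable borel" "0 < \<kappa>" "0 < a" "0 < a'"
      by (fact Ldm Ldp Ldm' \<kappa> a a')+
    show "per_lam Ld'" by (simp add: per_lam_def Ldl')
    show "AE \<omega> in lborel. a \<le> (cmod (Ld \<omega>))\<^sup>2 * M \<omega> \<and> (cmod (Ld \<omega>))\<^sup>2 * M \<omega> \<le> b" by (rule Mab)
    show "AE \<omega> in lborel. a' \<le> (cmod (Ld' \<omega>))\<^sup>2 * lam_sum M \<omega> \<and> (cmod (Ld' \<omega>))\<^sup>2 * lam_sum M \<omega> \<le> b'"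
      using ab' by (simp add: lam_sum_M u_def)
    show "L2_inv_fourier (\<lambda>\<omega>. chr (- k) \<omega> * Ld \<omega> * u \<omega>) (\<lambda>x. \<phi> j (x - mat_zpow ?A j *v rvec k))" for k
      using inv_fourier_translate[OF bsplines[of j], of "mat_zpow ?A j *v rvec k"]
      by (simp only: bh Ld_def[symmetric] chr_jm u_def mult.assoc)
    show "L2_inv_fourier (\<lambda>\<omega>. chr (- (D *v k)) \<omega> * Ld' \<omega> * u \<omega>) (\<lambda>x. \<phi> (j + 1) (x - mat_zpow ?A (j + 1) *v rvec k))" for k
      using inv_fourier_translate[OF bsplines[of "j + 1"], of "mat_zpow ?A (j + 1) *v rvec k"]
      by (simp only: bh Ld'_def[symmetric] chr_j1m u_def mult.assoc)
    show "L2_inv_fourier (\<lambda>\<omega>. of_real \<kappa> * chr (- freq i) \<omega> * of_real (w \<omega>) * u \<omega>) (?\<psi> i)" for i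
    proof (cases i)
      case (Pair m k)
      let ?v = "mat_zpow ?A (j + 1) *v rvec k + mat_zpow ?A j *v rvec (e m)"
      have v: "?v = mat_zpow ?A j *v rvec (freq i)"
        by (simp add: Pair freq_def zD rvec_add matrix_vector_right_distrib)
      have "chr (- freq i) \<omega> = cis (- (?v \<bullet> \<omega>))" for \<omega>
        by (simp only: chr_jm v)
      then show ?thesis
        using inv_fourier_translate[OF \<psi>hat, of ?v] by (simp add: Pair diff_diff_eq mult_ac)
    qed
  qed
  have wav: "wavelet_space D \<phi> (j + 1) = W"
    by (simp add: wavelet_space_def spline_space_l2_span)
  have zeros: "\<omega> \<in> shifted_zeros f g D j v \<longleftrightarrow> w (\<omega> + lam v) = 0" for \<omega> v
  proof -
    \<comment> \<open>Admissibility keeps g nonzero at the zeros of f, so the zeros of the symbol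
      are those of its numerator, poles excluded.\<close>
    have z: "q \<in> symbol_zeros f g \<longleftrightarrow> f q = 0" for q
      using disj_fg by (auto simp: symbol_zeros_def symbol_def)
    show ?thesis
      unfolding w_eq_0 shifted_zeros_def dual_j dual_j1 z Z_def mem_Collect_eq
    proof safe
      fix q k assume "f q = 0"
      then show "\<exists>l. f (q - lam v + pt k + lam v + pt l) = 0"
        by (intro exI[of _ "- k"]) (simp add: pt_minus)
    next
      fix k assume "f (\<omega> + lam v + pt k) = 0"
      then show "\<exists>q l. \<omega> = q - lam v + pt l \<and> f q = 0"
        by (intro exI[of _ "\<omega> + lam v + pt k"] exI[of _ "- k"]) (simp add: pt_minus)
    qed
  qed
  have "(\<forall>m\<in>{1..n - 1}. \<forall>\<omega>. w \<omega> \<noteq> 0 \<or> w (\<omega> + lam (e m)) \<noteq> 0)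
      \<longleftrightarrow> (\<forall>m\<in>{1..n - 1}. shifted_zeros f g D j (e 0) \<inter> shifted_zeros f g D j (e m) = {})"
    by (simp add: disjoint_iff zeros e_0)
  then show ?thesis using riesz_basis_iff unfolding wav by simp
qed

end
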